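(* Let $T>0$, $r>0$, $H\in(\tfrac12,1)$, and let $B^H=\{B^H_t,\ t\in[0,T]\}$ be a fractional Brownian motion with Hurst parameter $H$ on a complete probability space $(\Omega,\mathcal F,\mathbb P)$. Let $\theta\in(0,1]$ and let $\eta:[-r,0]\to\mathbb R_+$ be $\theta$-Hölder continuous. Let $b,\sigma:[0,T]\times\mathcal C_r\to\mathbb R$ satisfy the assumptions on $b$ and $\sigma$ listed in the context, with $\beta\in(0,1)$ the time-Hölder exponent of $\sigma$, and suppose $1-H<\theta\wedge\beta$. Then there exists a stochastic process $X$ with trajectories in $C^{\theta\wedge\frac12}([-r,T])$ that is a solution to the stochastic equation $$X(t)=\eta(0)+\int_0^t b(s,X_s)\,ds+\int_0^t\sigma(s,X_s)\,dB^H_s+Y(t),\quad t\in[0,T],\qquad X(t)=\eta(t),\quad t\in[-r,0],$$ where $Y$ is the regulator term $$Y(t)=\sup_{0\le s\le t}\big(Z(s)\big)^-,\qquad Z(t)=\eta(0)+\int_0^t b(s,X_s)\,ds+\int_0^t\sigma(s,X_s)\,dB^H_s .$$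
   Context: Notation: $a^-=\max(-a,0)$, $a\wedge b=\min(a,b)$. $\mathcal C_r=C([-r,0],\mathbb R)$ with the sup norm $\|\cdot\|_{\mathcal C_r}$. For $x:[-r,T]\to\mathbb R$ continuous and $t\in[0,T]$, $x_t\in\mathcal C_r$ is $x_t(s)=x(t+s)$, $s\in[-r,0]$. $C^\mu([a,b])$ is the space of $\mu$-Hölder continuous real functions on $[a,b]$. Assumptions on $b$: $b:[0,T]\times\mathcal C_r\to\mathbb R$ is measurable and there are constants with $|b(t,x)|\le L_b^2(1+\|x\|_{\mathcal C_r})$ and $|b(t,x)-b(t,y)|\le L_b^1\|x-y\|_{\mathcal C_r}$ for all $t\in[0,T]$, $x,y\in\mathcal C_r$. Assumptions on $\sigma$: $\sigma:[0,T]\times\mathcal C_r\to\mathbb R$ and there are constants and $\beta\in(0,1)$ with $|\sigma(t,x)|\le L_\sigma^1(1+\|x\|_{\mathcal C_r})$, $|\sigma(t,x)-\sigma(s,x)|\le L_\sigma^3|t-s|^\beta(1+\|x\|_{\mathcal C_r})$, $|\sigma(t,x)-\sigma(t,y)|\le L_\sigma^2\|x-y\|_{\mathcal C_r}$ for all $s,t\in[0,T]$, $x,y\in\mathcal C_r$. Fractional Brownian motion: centered Gaussian process with $B^H_0=0$ and $\mathbb E[B^H_tB^H_s]=\frac12(t^{2H}+s^{2H}-|t-s|^{2H})$, taken with continuous trajectories (which are then a.s. $\gamma$-Hölder for every $\gamma<H$). Integral: the integral with respect to $B^H$ is the pathwise generalized Lebesgue–Stieltjes integral (in the sense of Zähle),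 taken with some $\alpha$ such that $1-H<\alpha<\frac12\wedge\theta\wedge\beta$: for functions $f,g$ on $[a,b]$, $$\int_a^b f\,dg:=(-1)^\alpha\int_a^b D^\alpha_{a+}f(x)\,D^{1-\alpha}_{b-}g_{b-}(x)\,dx,\qquad g_{b-}(x)=g(x)-g(b-),$$ whenever $D^\alpha_{a+}f\in L^1[a,b]$ and $D^{1-\alpha}_{b-}g_{b-}\in L^\infty[a,b]$, and $\int_c^d f\,dg:=\int_a^b \mathbf 1_{(c,d)}f\,dg$ for $a\le c<d\le b$. The Weyl–Marchaud derivatives are, for $x\in(a,b)$, $$D_{a+}^{\alpha}f(x)=\frac{1}{\Gamma(1-\alpha)}\Big(\frac{f(x)}{(x-a)^{\alpha}}+\alpha\int_a^x\frac{f(x)-f(y)}{(x-y)^{\alpha+1}}dy\Big),\quad D_{b-}^{\alpha}f(x)=\frac{(-1)^\alpha}{\Gamma(1-\alpha)}\Big(\frac{f(x)}{(b-x)^{\alpha}}+\alpha\int_x^b\frac{f(x)-f(y)}{(y-x)^{\alpha+1}}dy\Big).$$ A solution is a process with continuous trajectories for which, almost surely, all integrals are defined and the equation holds for all $t$. *)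

theory Defs
  imports "HOL-Probability.Probability"
begin

section \<open>Hoelder functions and the space of continuous functions on [-r,0]\<close>

definition holder_on :: "real \<Rightarrow> real set \<Rightarrow> (real \<Rightarrow> real) \<Rightarrow> bool" where
  "holder_on \<mu> S f \<longleftrightarrow> (\<exists>C. \<forall>x\<in>S. \<forall>y\<in>S. \<bar>f x - f y\<bar> \<le> C * \<bar>x - y\<bar> powr \<mu>)"

text \<open>The elements of the space \<open>C_space r\<close> are the real functions that are continuous
  on \<open>[-r,0]\<close> and \<^const>\<open>undefined\<close> outside, so that they correspond one-to-one to \<open>C([-r,0])\<close>;
  the metric is the uniform distance.\<close>

definition C_space :: "real \<Rightarrow> (real \<Rightarrow> real) metric" where
  "C_space r = cfunspace (top_of_set {-r..0}) euclidean_metric"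

definition C_norm :: "real \<Rightarrow> (real \<Rightarrow> real) \<Rightarrow> real" where
  "C_norm r x = (SUP s\<in>{-r..0}. \<bar>x s\<bar>)"

definition C_borel :: "real \<Rightarrow> (real \<Rightarrow> real) measure" where
  "C_borel r = sigma (mspace (C_space r)) {U. openin (mtopology_of (C_space r)) U}"

definition segment :: "real \<Rightarrow> (real \<Rightarrow> real) \<Rightarrow> real \<Rightarrow> (real \<Rightarrow> real)" where
  "segment r x t = restrict (\<lambda>s. x (t + s)) {-r..0}"


section \<open>Assumptions on the coefficients\<close>

text \<open>In the Lipschitz conditions the difference of \<open>x\<close> and \<open>y\<close> is only evaluated on \<open>[-r,0]\<close>
  by \<^const>\<open>C_norm\<close>.\<close>

definition drift_assms :: "real \<Rightarrow> real \<Rightarrow> (real \<Rightarrow> (real \<Rightarrow> real) \<Rightarrow> real) \<Rightarrow> bool" where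
  "drift_assms r T b \<longleftrightarrow>
     (\<lambda>(t, x). b t x) \<in> borel_measurable (restrict_space borel {0..T} \<Otimes>\<^sub>M C_borel r) \<and>
     (\<exists>L2. \<forall>t\<in>{0..T}. \<forall>x\<in>mspace (C_space r). \<bar>b t x\<bar> \<le> L2 * (1 + C_norm r x)) \<and>
     (\<exists>L1. \<forall>t\<in>{0..T}. \<forall>x\<in>mspace (C_space r). \<forall>y\<in>mspace (C_space r).
        \<bar>b t x - b t y\<bar> \<le> L1 * C_norm r (\<lambda>s. x s - y s))"

definition diffusion_assms ::
    "real \<Rightarrow> real \<Rightarrow> real \<Rightarrow> (real \<Rightarrow> (real \<Rightarrow> real) \<Rightarrow> real) \<Rightarrow> bool" where
  "diffusion_assms r T \<beta> \<sigma> \<longleftrightarrow>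
     (\<exists>L1. \<forall>t\<in>{0..T}. \<forall>x\<in>mspace (C_space r). \<bar>\<sigma> t x\<bar> \<le> L1 * (1 + C_norm r x)) \<and>
     (\<exists>L3. \<forall>s\<in>{0..T}. \<forall>t\<in>{0..T}. \<forall>x\<in>mspace (C_space r).
        \<bar>\<sigma> t x - \<sigma> s x\<bar> \<le> L3 * \<bar>t - s\<bar> powr \<beta> * (1 + C_norm r x)) \<and>
     (\<exists>L2. \<forall>t\<in>{0..T}. \<forall>x\<in>mspace (C_space r). \<forall>y\<in>mspace (C_space r).
        \<bar>\<sigma> t x - \<sigma> t y\<bar> \<le> L2 * C_norm r (\<lambda>s. x s - y s))"


section \<open>Fractional Brownian motion\<close>

text \<open>A Gaussian random variable may be degenerate (almost surely constant).\<close>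

definition gaussian_rv :: "'a measure \<Rightarrow> ('a \<Rightarrow> real) \<Rightarrow> bool" where
  "gaussian_rv M Z \<longleftrightarrow> Z \<in> borel_measurable M \<and>
     (\<exists>m. (AE \<omega> in M. Z \<omega> = m) \<or> (\<exists>s>0. distributed M lborel Z (normal_density m s)))"

definition gaussian_process :: "'a measure \<Rightarrow> real set \<Rightarrow> (real \<Rightarrow> 'a \<Rightarrow> real) \<Rightarrow> bool" where
  "gaussian_process M I Z \<longleftrightarrow>
     (\<forall>F c. finite F \<and> F \<subseteq> I \<longrightarrow> gaussian_rv M (\<lambda>\<omega>. \<Sum>t\<in>F. c t * Z t \<omega>))"

definition fractional_brownian_motion ::
    "'a measure \<Rightarrow> real \<Rightarrow> real \<Rightarrow> (real \<Rightarrow> 'a \<Rightarrow> real) \<Rightarrow> bool" where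
  "fractional_brownian_motion M T H B \<longleftrightarrow>
     gaussian_process M {0..T} B \<and>
     (\<forall>t\<in>{0..T}. (\<integral>\<omega>. B t \<omega> \<partial>M) = 0) \<and>
     (AE \<omega> in M. B 0 \<omega> = 0) \<and>
     (\<forall>s\<in>{0..T}. \<forall>t\<in>{0..T}. (\<integral>\<omega>. B t \<omega> * B s \<omega> \<partial>M)
        = (t powr (2 * H) + s powr (2 * H) - \<bar>t - s\<bar> powr (2 * H)) / 2) \<and>
     (\<forall>\<omega>\<in>space M. continuous_on {0..T} (\<lambda>t. B t \<omega>))"


section \<open>Generalized Lebesgue-Stieltjes integral\<close>

definition weyl_left :: "real \<Rightarrow> real \<Rightarrow> (real \<Rightarrow> real) \<Rightarrow> real \<Rightarrow> real" where
  "weyl_left \<alpha> a f x = 1 / Gamma (1 - \<alpha>) *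
     (f x / (x - a) powr \<alpha> + \<alpha> * (LBINT y:{a<..<x}. (f x - f y) / (x - y) powr (\<alpha> + 1)))"

definition weyl_left_defined :: "real \<Rightarrow> real \<Rightarrow> (real \<Rightarrow> real) \<Rightarrow> real \<Rightarrow> bool" where
  "weyl_left_defined \<alpha> a f x \<longleftrightarrow>
     set_integrable lborel {a<..<x} (\<lambda>y. (f x - f y) / (x - y) powr (\<alpha> + 1))"

text \<open>The power \<open>(-1)\<^sup>\<alpha>\<close> is the principal one, \<open>exp (\<i> \<pi> \<alpha>)\<close>.\<close>

definition weyl_right :: "real \<Rightarrow> real \<Rightarrow> (real \<Rightarrow> real) \<Rightarrow> real \<Rightarrow> complex" where
  "weyl_right \<alpha> b f x = (-1) powr complex_of_real \<alpha> * complex_of_real (1 / Gamma (1 - \<alpha>) *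
     (f x / (b - x) powr \<alpha> + \<alpha> * (LBINT y:{x<..<b}. (f x - f y) / (y - x) powr (\<alpha> + 1))))"

definition weyl_right_defined :: "real \<Rightarrow> real \<Rightarrow> (real \<Rightarrow> real) \<Rightarrow> real \<Rightarrow> bool" where
  "weyl_right_defined \<alpha> b f x \<longleftrightarrow>
     set_integrable lborel {x<..<b} (\<lambda>y. (f x - f y) / (y - x) powr (\<alpha> + 1))"

definition left_limit_shift :: "real \<Rightarrow> (real \<Rightarrow> real) \<Rightarrow> real \<Rightarrow> real" where
  "left_limit_shift b g x = g x - Lim (at_left b) g"

text \<open>The left derivative has to be in \<open>L\<^sup>1\<close> and the right derivative in \<open>L\<^sup>\<infinity>\<close>; in particular
  they have to be defined almost everywhere.\<close>

definition gls_integrable ::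
    "real \<Rightarrow> real \<Rightarrow> real \<Rightarrow> (real \<Rightarrow> real) \<Rightarrow> (real \<Rightarrow> real) \<Rightarrow> bool" where
  "gls_integrable \<alpha> a b f g \<longleftrightarrow>
     (AE x\<in>{a<..<b} in lborel. weyl_left_defined \<alpha> a f x) \<and>
     set_integrable lborel {a<..<b} (weyl_left \<alpha> a f) \<and>
     (\<exists>l. (g \<longlongrightarrow> l) (at_left b)) \<and>
     (AE x\<in>{a<..<b} in lborel. weyl_right_defined (1 - \<alpha>) b (left_limit_shift b g) x) \<and>
     set_borel_measurable lborel {a<..<b} (weyl_right (1 - \<alpha>) b (left_limit_shift b g)) \<and>
     (\<exists>C. AE x\<in>{a<..<b} in lborel. cmod (weyl_right (1 - \<alpha>) b (left_limit_shift b g) x) \<le> C)"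

text \<open>The number under \<^const>\<open>Re\<close> is real, because \<open>(-1)\<^sup>\<alpha> (-1)\<^bsup>1 - \<alpha>\<^esup> = -1\<close>.\<close>

definition gls_integral ::
    "real \<Rightarrow> real \<Rightarrow> real \<Rightarrow> (real \<Rightarrow> real) \<Rightarrow> (real \<Rightarrow> real) \<Rightarrow> real" where
  "gls_integral \<alpha> a b f g = Re ((-1) powr complex_of_real \<alpha> *
     (LBINT x:{a<..<b}. complex_of_real (weyl_left \<alpha> a f x) *
        weyl_right (1 - \<alpha>) b (left_limit_shift b g) x))"

definition gls_integrable_on ::
    "real \<Rightarrow> real \<Rightarrow> real \<Rightarrow> real \<Rightarrow> real \<Rightarrow> (real \<Rightarrow> real) \<Rightarrow> (real \<Rightarrow> real) \<Rightarrow> bool" where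
  "gls_integrable_on \<alpha> a b c d f g \<longleftrightarrow>
     gls_integrable \<alpha> a b (\<lambda>x. indicator {c<..<d} x * f x) g"

definition gls_integral_on ::
    "real \<Rightarrow> real \<Rightarrow> real \<Rightarrow> real \<Rightarrow> real \<Rightarrow> (real \<Rightarrow> real) \<Rightarrow> (real \<Rightarrow> real) \<Rightarrow> real" where
  "gls_integral_on \<alpha> a b c d f g = gls_integral \<alpha> a b (\<lambda>x. indicator {c<..<d} x * f x) g"


section \<open>The reflected delay equation\<close>

text \<open>In the following, \<open>x\<close> is a trajectory of the solution and \<open>g\<close> one of the driving process.\<close>

definition Z_path ::
    "real \<Rightarrow> real \<Rightarrow> real \<Rightarrow> (real \<Rightarrow> real) \<Rightarrow> (real \<Rightarrow> (real \<Rightarrow> real) \<Rightarrow> real) \<Rightarrow>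
     (real \<Rightarrow> (real \<Rightarrow> real) \<Rightarrow> real) \<Rightarrow> (real \<Rightarrow> real) \<Rightarrow> (real \<Rightarrow> real) \<Rightarrow> real \<Rightarrow> real" where
  "Z_path \<alpha> r T \<eta> b \<sigma> g x t =
     \<eta> 0 + (LBINT s:{0..t}. b s (segment r x s))
         + gls_integral_on \<alpha> 0 T 0 t (\<lambda>s. \<sigma> s (segment r x s)) g"

definition neg_part :: "real \<Rightarrow> real" where
  "neg_part a = max (- a) 0"

definition regulator :: "(real \<Rightarrow> real) \<Rightarrow> real \<Rightarrow> real" where
  "regulator z t = (SUP s\<in>{0..t}. neg_part (z s))"

text \<open>The boundedness condition says that the supremum defining the regulator is finite.\<close>

definition solves_path ::
    "real \<Rightarrow> real \<Rightarrow> real \<Rightarrow> (real \<Rightarrow> real) \<Rightarrow> (real \<Rightarrow> (real \<Rightarrow> real) \<Rightarrow> real) \<Rightarrow>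
     (real \<Rightarrow> (real \<Rightarrow> real) \<Rightarrow> real) \<Rightarrow> (real \<Rightarrow> real) \<Rightarrow> (real \<Rightarrow> real) \<Rightarrow> bool" where
  "solves_path \<alpha> r T \<eta> b \<sigma> g x \<longleftrightarrow>
     (\<forall>t\<in>{0..T}.
        set_integrable lborel {0..t} (\<lambda>s. b s (segment r x s)) \<and>
        gls_integrable_on \<alpha> 0 T 0 t (\<lambda>s. \<sigma> s (segment r x s)) g \<and>
        bdd_above ((\<lambda>s. neg_part (Z_path \<alpha> r T \<eta> b \<sigma> g x s)) ` {0..t}) \<and>
        x t = Z_path \<alpha> r T \<eta> b \<sigma> g x t + regulator (Z_path \<alpha> r T \<eta> b \<sigma> g x) t) \<and>
     (\<forall>t\<in>{-r..0}. x t = \<eta> t)"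

definition is_solution ::
    "'a measure \<Rightarrow> real \<Rightarrow> real \<Rightarrow> real \<Rightarrow> (real \<Rightarrow> real) \<Rightarrow> (real \<Rightarrow> (real \<Rightarrow> real) \<Rightarrow> real) \<Rightarrow>
     (real \<Rightarrow> (real \<Rightarrow> real) \<Rightarrow> real) \<Rightarrow> (real \<Rightarrow> 'a \<Rightarrow> real) \<Rightarrow> (real \<Rightarrow> 'a \<Rightarrow> real) \<Rightarrow> bool" where
  "is_solution M \<alpha> r T \<eta> b \<sigma> B X \<longleftrightarrow>
     (\<forall>t\<in>{-r..T}. X t \<in> borel_measurable M) \<and>
     (\<forall>\<omega>\<in>space M. continuous_on {-r..T} (\<lambda>t. X t \<omega>)) \<and>
     (AE \<omega> in M. solves_path \<alpha> r T \<eta> b \<sigma> (\<lambda>t. B t \<omega>) (\<lambda>t. X t \<omega>))"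

end

theory Submission
  imports Defs
begin

text \<open>Pathwise, the driving function is \<open>\<gamma>\<close>-Hoelder for some \<open>\<gamma> > 1 - \<alpha>\<close>, by Kolmogorov's chaining
  argument. Fractional integration inverts fractional differentiation, so the generalized
  Lebesgue-Stieltjes integral of the indicator of an interval is the increment of the integrator,
  and the integral of a \<open>\<mu>\<close>-Hoelder function with \<open>\<mu> > \<alpha>\<close> is the limit of its Riemann sums. Solutions
  are limits of a reflected Euler scheme. Young's discrete estimate gives a Hoelder bound on short
  time steps whose length does not depend on the mesh, hence a uniform bound on \<open>[-r,T]\<close>, and
  every pointwise limit of the scheme solves the equation. As \<open>\<sigma>\<close> is only Lipschitz, solutions need
  not be unique; a solution that is measurable in \<open>\<omega>\<close> is obtained by choosing the convergent
  subsequence measurably.\<close>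

section \<open>Hoelder functions on a mesh\<close>

text \<open>Lipschitz continuity of \<open>\<sigma>\<close> in the sup norm gives no contraction in
  a Hoelder norm, yet Hoelder norms control the integral; so compactness replaces a fixed point
  argument. A path of exponent \<nu> = min \<theta> (1/2) gives an integrand of exponent \<mu> = min
  \<nu> \<beta>. The choice of \<alpha> yields \<alpha> < \<mu>, which makes the integral exist, and
  \<gamma> > 1 - \<alpha> then yields \<mu> + \<gamma> > 1, as Young's estimate requires. All bounds
  are affine in the Hoelder constant of the path, so the length of a time step depends on the
  driving path only through its Hoelder constant. The regulator remembers the whole past, but its
  increments are bounded by the oscillation of Z over the same interval, so it fits into local
  estimates. The integral up to t cuts the integrand off inside [0,T]; additivity and local bounds
  therefore concern functions with jumps, whose fractional derivatives are unbounded but integrable.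
  The scheme sees the driving path through finitely many integers only, so measurability does not
  rest on continuity of a solution map.\<close>

definition holder_with :: "real \<Rightarrow> real \<Rightarrow> real set \<Rightarrow> (real \<Rightarrow> real) \<Rightarrow> bool" where
  "holder_with K \<mu> S f \<longleftrightarrow> (\<forall>x\<in>S. \<forall>y\<in>S. \<bar>f x - f y\<bar> \<le> K * \<bar>x - y\<bar> powr \<mu>)"

lemma holder_withD:
  "holder_with K \<mu> S f \<Longrightarrow> x \<in> S \<Longrightarrow> y \<in> S \<Longrightarrow> \<bar>f x - f y\<bar> \<le> K * \<bar>x - y\<bar> powr \<mu>"
  by (auto simp: holder_with_def)

lemma holder_withI:
  assumes "\<And>x y. x \<in> S \<Longrightarrow> y \<in> S \<Longrightarrow> x < y \<Longrightarrow> \<bar>f y - f x\<bar> \<le> K * (y - x) powr \<mu>"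
  shows "holder_with K \<mu> S f"
  unfolding holder_with_def
proof (intro ballI)
  fix x y assume xy: "x \<in> S" "y \<in> S"
  consider "x < y" | "x = y" | "y < x" by linarith
  then show "\<bar>f x - f y\<bar> \<le> K * \<bar>x - y\<bar> powr \<mu>"
  proof cases
    case 1
    with assms[of x y] xy show ?thesis by (simp add: abs_minus_commute)
  next
    case 2
    then show ?thesis by simp
  next
    case 3
    with assms[of y x] xy show ?thesis by simp
  qed
qed

lemma holder_on_iff_with: "holder_on \<mu> S f \<longleftrightarrow> (\<exists>K. holder_with K \<mu> S f)"
  by (simp add: holder_on_def holder_with_def)

lemma holder_with_subset: "holder_with K \<mu> S f \<Longrightarrow> R \<subseteq> S \<Longrightarrow> holder_with K \<mu> R f"
  by (auto simp: holder_with_def)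

lemma holder_with_mono:
  assumes "holder_with K \<mu> S f" "K \<le> L"
  shows "holder_with L \<mu> S f"
  using assms unfolding holder_with_def
  by (meson mult_right_mono order_trans powr_ge_zero)

lemma holder_with_const_nonneg:
  assumes "holder_with K \<mu> {a..b} f" "a < b"
  shows "K \<ge> 0"
proof -
  have "0 \<le> K * \<bar>a - b\<bar> powr \<mu>"
    using holder_withD[OF assms(1), of a b] assms(2) by (intro order_trans[OF abs_ge_zero]) auto
  moreover have "\<bar>a - b\<bar> powr \<mu> > 0" using assms(2) by simp
  ultimately show ?thesis by (simp add: zero_le_mult_iff)
qed

text \<open>Lowering the exponent costs a power of the diameter bound \<open>D\<close>. On short
  sets this power is small, which is the gain that \<open>euler_holder_step\<close> absorbs.\<close>

lemma holder_with_exponent_mono: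
  assumes "holder_with K \<mu> S f" "\<nu> \<le> \<mu>" "K \<ge> 0" "\<And>x y. x \<in> S \<Longrightarrow> y \<in> S \<Longrightarrow> \<bar>x - y\<bar> \<le> D"
  shows "holder_with (K * D powr (\<mu> - \<nu>)) \<nu> S f"
proof (rule holder_withI)
  fix x y assume xy: "x \<in> S" "y \<in> S" "x < y"
  have "(y - x) powr \<mu> = (y - x) powr (\<mu> - \<nu>) * (y - x) powr \<nu>"
    by (simp flip: powr_add)
  also have "\<dots> \<le> D powr (\<mu> - \<nu>) * (y - x) powr \<nu>"
    using assms(4)[of y x] xy assms(2) by (intro mult_right_mono powr_mono2) auto
  finally have "(y - x) powr \<mu> \<le> D powr (\<mu> - \<nu>) * (y - x) powr \<nu>" .
  then have "K * (y - x) powr \<mu> \<le> K * (D powr (\<mu> - \<nu>) * (y - x) powr \<nu>)"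
    using assms(3) by (rule mult_left_mono)
  then show "\<bar>f y - f x\<bar> \<le> K * D powr (\<mu> - \<nu>) * (y - x) powr \<nu>"
    using holder_withD[OF assms(1) xy(2,1)] xy(3) by (simp add: mult.assoc)
qed

lemma holder_with_imp_continuous_on:
  assumes "holder_with K \<mu> S f" "\<mu> > 0"
  shows "continuous_on S f"
  unfolding continuous_on_def
proof
  fix x assume x: "x \<in> S"
  have "((\<lambda>y. \<bar>y - x\<bar>) \<longlongrightarrow> \<bar>x - x\<bar>) (at x within S)"
    by (intro tendsto_intros)
  then have "((\<lambda>y. \<bar>y - x\<bar> powr \<mu>) \<longlongrightarrow> 0) (at x within S)"
    using assms(2) by (intro tendsto_zero_powrI[where b = \<mu>]) auto
  then have "((\<lambda>y. K * \<bar>y - x\<bar> powr \<mu>) \<longlongrightarrow> 0) (at x within S)"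
    by (rule tendsto_mult_right_zero)
  then have "((\<lambda>y. f y - f x) \<longlongrightarrow> 0) (at x within S)"
    by (rule Lim_null_comparison[rotated])
       (auto simp: eventually_at_filter intro!: always_eventually holder_withD[OF assms(1)] x)
  then show "(f \<longlongrightarrow> f x) (at x within S)"
    by (simp add: LIM_zero_iff)
qed

text \<open>Increments across \<open>c\<close> are split there. The constants add, so a bound on a
  short new piece can be attached to the bound on the past.\<close>

lemma holder_with_concat:
  assumes "holder_with K1 \<mu> {a..c} f" "holder_with K2 \<mu> {c..d} f" "0 \<le> K1" "0 \<le> K2" "\<mu> \<ge> 0"
    and "a \<le> c" "c \<le> d"
  shows "holder_with (K1 + K2) \<mu> {a..d} f"
proof (rule holder_withI)
  fix x y assume xy: "x \<in> {a..d}" "y \<in> {a..d}" "x < y"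
  consider "y \<le> c" | "c \<le> x" | "x \<le> c" "c \<le> y" by linarith
  then show "\<bar>f y - f x\<bar> \<le> (K1 + K2) * (y - x) powr \<mu>"
  proof cases
    case 1
    then have "\<bar>f y - f x\<bar> \<le> K1 * (y - x) powr \<mu>"
      using holder_withD[OF assms(1), of y x] xy by auto
    then show ?thesis using \<open>0 \<le> K2\<close> by (simp add: distrib_right add_increasing2)
  next
    case 2
    then have "\<bar>f y - f x\<bar> \<le> K2 * (y - x) powr \<mu>"
      using holder_withD[OF assms(2), of y x] xy by auto
    then show ?thesis using \<open>0 \<le> K1\<close> by (simp add: distrib_right add_increasing)
  next
    case 3
    have "\<bar>f c - f x\<bar> \<le> K1 * (c - x) powr \<mu>"
      using holder_withD[OF assms(1), of c x] xy 3 by auto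
    moreover have "K1 * (c - x) powr \<mu> \<le> K1 * (y - x) powr \<mu>"
      using 3 assms by (intro mult_left_mono powr_mono2) auto
    moreover have "\<bar>f y - f c\<bar> \<le> K2 * (y - c) powr \<mu>"
      using holder_withD[OF assms(2), of y c] xy 3 by auto
    moreover have "K2 * (y - c) powr \<mu> \<le> K2 * (y - x) powr \<mu>"
      using 3 assms by (intro mult_left_mono powr_mono2) auto
    ultimately show ?thesis by (simp add: distrib_right)
  qed
qed

lemma holder_with_limit:
  assumes "\<And>n. holder_with K \<mu> S (f n)" "\<And>t. t \<in> S \<Longrightarrow> (\<lambda>n. f n t) \<longlonglongrightarrow> g t"
  shows "holder_with K \<mu> S g"
  unfolding holder_with_def
proof (intro ballI)
  fix x y assume "x \<in> S" "y \<in> S"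
  then have "(\<lambda>n. \<bar>f n x - f n y\<bar>) \<longlonglongrightarrow> \<bar>g x - g y\<bar>"
    by (intro tendsto_intros assms)
  then show "\<bar>g x - g y\<bar> \<le> K * \<bar>x - y\<bar> powr \<mu>"
    by (rule LIMSEQ_le_const2) (use assms(1) \<open>x \<in> S\<close> \<open>y \<in> S\<close> in \<open>auto simp: holder_with_def\<close>)
qed

lemma exists_grid_cell:
  assumes "h > 0" "0 \<le> t" "t < real n * h"
  obtains k where "k < n" "real k * h \<le> t" "t < real (Suc k) * h"
proof -
  define k where "k = nat \<lfloor>t / h\<rfloor>"
  have th: "0 \<le> t / h" using assms by simp
  then have rk: "real k = of_int \<lfloor>t / h\<rfloor>"
    unfolding k_def by simp
  have 1: "real k \<le> t / h" "t / h < real k + 1"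
    unfolding rk by linarith+
  then have "real k * h \<le> t" "t < real (Suc k) * h"
    using assms(1) by (auto simp: field_simps)
  moreover have "k < n"
  proof (rule ccontr)
    assume "\<not> k < n"
    then have "real n * h \<le> real k * h" using assms(1) by simp
    with \<open>real k * h \<le> t\<close> assms(3) show False by simp
  qed
  ultimately show ?thesis using that by blast
qed

text \<open>An increment splits into a partial cell, a run of whole cells and another partial cell,
  hence the factor 3. The endpoint \<open>\<tau>\<close> need not be a node, so the hypotheses are
  required only below it.\<close>

lemma holder_with_grid:
  fixes \<phi> :: "real \<Rightarrow> real"
  assumes h: "h > 0" and A: "A \<ge> 0" and \<gamma>: "\<gamma> \<ge> 0" and \<tau>: "\<tau> \<le> real n * h"
    and cell: "\<And>k s t. k < n \<Longrightarrow> real k * h \<le> s \<Longrightarrow> s < t \<Longrightarrow> t \<le> real (Suc k) * h \<Longrightarrow> t \<le> \<tau> \<Longrightarrow>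
      \<bar>\<phi> t - \<phi> s\<bar> \<le> A * (t - s) powr \<gamma>"
    and grid: "\<And>i j. i < j \<Longrightarrow> j \<le> n \<Longrightarrow> real j * h \<le> \<tau> \<Longrightarrow>
      \<bar>\<phi> (real j * h) - \<phi> (real i * h)\<bar> \<le> A * (real j * h - real i * h) powr \<gamma>"
  shows "holder_with (3 * A) \<gamma> {0..\<tau>} \<phi>"
proof (rule holder_withI)
  fix s t assume st: "s \<in> {0..\<tau>}" "t \<in> {0..\<tau>}" "s < t"
  let ?P = "(t - s) powr \<gamma>"
  have mono: "A * (v - u) powr \<gamma> \<le> A * ?P" if "s \<le> u" "u \<le> v" "v \<le> t" for u v
    using that A \<gamma> by (intro mult_left_mono powr_mono2) auto
  have cell': "\<bar>\<phi> v - \<phi> u\<bar> \<le> A * ?P"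
    if "k < n" "real k * h \<le> u" "u \<le> v" "v \<le> real (Suc k) * h" "s \<le> u" "v \<le> t" for k u v
    using cell[of k u v] mono[of u v] that st A by (cases "u = v") auto
  have A0: "0 \<le> A * ?P" using A by simp
  obtain i where i: "i < n" "real i * h \<le> s" "s < real (Suc i) * h"
    using exists_grid_cell[OF h, of s n] st \<tau> by auto
  have "\<exists>j\<le>n. real j * h \<le> t \<and> i \<le> j \<and> (t = real j * h \<or> j < n \<and> t \<le> real (Suc j) * h)"
  proof (cases "t = real n * h")
    case True
    then show ?thesis using i by (intro exI[of _ n]) auto
  next
    case False
    then obtain j where j: "j < n" "real j * h \<le> t" "t < real (Suc j) * h"
      using exists_grid_cell[OF h, of t n] st \<tau> by auto
    have "real i * h < real (Suc j) * h" using i j st by linarith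
    then have "i < Suc j" using h by (simp del: of_nat_Suc)
    then show ?thesis using j by (intro exI[of _ j]) auto
  qed
  then obtain j where j: "j \<le> n" "real j * h \<le> t" "i \<le> j"
    "t = real j * h \<or> j < n \<and> t \<le> real (Suc j) * h" by blast
  show "\<bar>\<phi> t - \<phi> s\<bar> \<le> 3 * A * (t - s) powr \<gamma>"
  proof (cases "i = j")
    case True
    then have "j < n \<and> t \<le> real (Suc j) * h" using j i st by auto
    with cell'[of j s t] i st True have "\<bar>\<phi> t - \<phi> s\<bar> \<le> A * ?P" by auto
    then show ?thesis using A0 by (simp add: mult.assoc)
  next
    case False
    then have ij: "Suc i \<le> j" using j by simp
    then have ijh: "real (Suc i) * h \<le> real j * h" using h by simp
    have 1: "\<bar>\<phi> (real (Suc i) * h) - \<phi> s\<bar> \<le> A * ?P"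
      using cell'[of i s "real (Suc i) * h"] i ijh j by auto
    have 2: "\<bar>\<phi> (real j * h) - \<phi> (real (Suc i) * h)\<bar> \<le> A * ?P"
    proof (cases "Suc i = j")
      case True
      then show ?thesis using A0 by simp
    next
      case False
      then show ?thesis
        using grid[of "Suc i" j] ij j mono[of "real (Suc i) * h" "real j * h"] i ijh st by auto
    qed
    have 3: "\<bar>\<phi> t - \<phi> (real j * h)\<bar> \<le> A * ?P"
      using j(4) cell'[of j "real j * h" t] j A0 i ijh by auto
    show ?thesis using 1 2 3 by (simp add: mult.assoc)
  qed
qed

section \<open>Piecewise linear interpolation\<close>

definition lin_interp :: "nat \<Rightarrow> real \<Rightarrow> (real \<Rightarrow> real) \<Rightarrow> real \<Rightarrow> real" where
  "lin_interp n h \<phi> x = \<phi> 0 +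
     (\<Sum>k<n. (\<phi> (real (Suc k) * h) - \<phi> (real k * h)) * max 0 (min 1 (x / h - real k)))"

lemma lin_interp_cell:
  assumes h: "h > 0" and k: "k < n" and x: "real k * h \<le> x" "x \<le> real (Suc k) * h"
  shows "lin_interp n h \<phi> x = \<phi> (real k * h) + (\<phi> (real (Suc k) * h) - \<phi> (real k * h)) * (x / h - real k)"
proof -
  define d where "d = (\<lambda>k. \<phi> (real (Suc k) * h) - \<phi> (real k * h))"
  have xh: "real k \<le> x / h" "x / h \<le> real k + 1"
    using h x by (auto simp: field_simps)
  have "(\<Sum>i<n. d i * max 0 (min 1 (x / h - real i)))
      = (\<Sum>i<n. (if i < k then d i else 0) + (if i = k then d k * (x / h - real k) else 0))"
  proof (rule sum.cong)
    fix i assume "i \<in> {..<n}"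
    consider "i < k" | "i = k" | "k < i" by linarith
    then show "d i * max 0 (min 1 (x / h - real i)) =
      (if i < k then d i else 0) + (if i = k then d k * (x / h - real k) else 0)"
    proof cases
      case 1
      then have "real i + 1 \<le> real k" by linarith
      then have "x / h - real i \<ge> 1" using xh by linarith
      then show ?thesis using 1 by simp
    next
      case 2
      then show ?thesis using xh by simp
    next
      case 3
      then have "real k + 1 \<le> real i" by linarith
      then have "x / h - real i \<le> 0" using xh by linarith
      then show ?thesis using 3 by simp
    qed
  qed simp
  also have "\<dots> = (\<Sum>i<k. d i) + d k * (x / h - real k)"
  proof -
    have "{..<n} \<inter> {i. i < k} = {..<k}" using k by auto
    then show ?thesis using k by (simp add: sum.distrib sum.If_cases)
  qed
  also have "(\<Sum>i<k. d i) = \<phi> (real k * h) - \<phi> 0"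
    unfolding d_def using sum_lessThan_telescope[of "\<lambda>k. \<phi> (real k * h)" k] by simp
  finally show ?thesis unfolding lin_interp_def d_def by simp
qed

lemma lin_interp_grid:
  assumes "h > 0" "k \<le> n"
  shows "lin_interp n h \<phi> (real k * h) = \<phi> (real k * h)"
proof (cases "k < n")
  case True
  then show ?thesis using lin_interp_cell[OF assms(1) True, of "real k * h" \<phi>] assms(1) by simp
next
  case False
  show ?thesis
  proof (cases k)
    case 0
    with False assms show ?thesis by (simp add: lin_interp_def)
  next
    case (Suc m)
    have *: "real k * h / h - real m = 1" using assms False Suc by simp
    have nm: "n = Suc m" using assms False Suc by simp
    then show ?thesis
      using lin_interp_cell[OF assms(1), of m n "real k * h" \<phi>] Suc False assms
      unfolding * by (simp add: nm del: of_nat_Suc)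
  qed
qed

lemma holder_with_lin_interp:
  assumes h: "h > 0" and K: "K \<ge> 0" and \<gamma>: "0 \<le> \<gamma>" "\<gamma> \<le> 1"
    and grid: "\<And>i j. i < j \<Longrightarrow> j \<le> n \<Longrightarrow>
      \<bar>\<phi> (real j * h) - \<phi> (real i * h)\<bar> \<le> K * (real j * h - real i * h) powr \<gamma>"
  shows "holder_with (3 * K) \<gamma> {0..real n * h} (lin_interp n h \<phi>)"
proof (rule holder_with_grid[OF h K \<gamma>(1) order_refl])
  fix k s t assume k: "k < n" "real k * h \<le> s" "s < t" "t \<le> real (Suc k) * h"
  have "lin_interp n h \<phi> t - lin_interp n h \<phi> s =
      (\<phi> (real (Suc k) * h) - \<phi> (real k * h)) * ((t - s) / h)"
  proof -
    have *: "u + c * (y - q) - (u + c * (x - q)) = c * (y - x)" for u c x y q :: real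
      by (simp add: algebra_simps)
    have "lin_interp n h \<phi> t - lin_interp n h \<phi> s =
      (\<phi> (real (Suc k) * h) - \<phi> (real k * h)) * (t / h - s / h)"
      unfolding lin_interp_cell[OF h k(1) order_trans[OF k(2) less_imp_le[OF k(3)]] k(4)]
        lin_interp_cell[OF h k(1) k(2) order_trans[OF less_imp_le[OF k(3)] k(4)]] by (rule *)
    then show ?thesis by (simp only: diff_divide_distrib)
  qed
  then have "\<bar>lin_interp n h \<phi> t - lin_interp n h \<phi> s\<bar> =
      \<bar>\<phi> (real (Suc k) * h) - \<phi> (real k * h)\<bar> * ((t - s) / h)"
    using k(3) h by (simp only: abs_mult) simp
  also have "\<dots> \<le> K * h powr \<gamma> * ((t - s) / h)"
    using grid[of k "Suc k"] k h by (intro mult_right_mono) (auto simp: algebra_simps)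
  \<comment> \<open>Inside a cell the quotient is at most 1, hence below its own power with exponent
    \<open>\<gamma> \<le> 1\<close>: a linear piece inherits the Hoelder bound of its
    endpoints.\<close>
  also have "\<dots> \<le> K * h powr \<gamma> * ((t - s) / h) powr \<gamma>"
  proof -
    have q: "0 \<le> (t - s) / h" "(t - s) / h \<le> 1" using k h by (auto simp: field_simps)
    have "((t - s) / h) powr 1 \<le> ((t - s) / h) powr \<gamma>"
      using q \<gamma> by (intro powr_mono') auto
    then have "(t - s) / h \<le> ((t - s) / h) powr \<gamma>" using q(1) by (simp only: powr_one)
    then show ?thesis using K by (intro mult_left_mono) auto
  qed
  also have "\<dots> = K * (t - s) powr \<gamma>"
    using h by (simp add: powr_divide)
  finally show "\<bar>lin_interp n h \<phi> t - lin_interp n h \<phi> s\<bar> \<le> K * (t - s) powr \<gamma>" .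
next
  fix i j assume "i < j" "j \<le> n"
  then show "\<bar>lin_interp n h \<phi> (real j * h) - lin_interp n h \<phi> (real i * h)\<bar>
      \<le> K * (real j * h - real i * h) powr \<gamma>"
    using grid[of i j] by (simp add: lin_interp_grid h)
qed

text \<open>Both functions are compared at the left node of the cell containing \<open>x\<close>.
  The slack \<open>\<epsilon>\<close> is 0 for exact interpolation and the rounding error when the
  node values are only approximate.\<close>

lemma lin_interp_dist:
  assumes h: "h > 0" and \<gamma>: "0 \<le> \<gamma>"
    and I: "holder_with L \<gamma> {0..real n * h} (lin_interp n h \<phi>)"
    and g: "holder_with K \<gamma> {0..real n * h} g"
    and close: "\<And>k. k \<le> n \<Longrightarrow> \<bar>\<phi> (real k * h) - g (real k * h)\<bar> \<le> \<epsilon>"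
    and x: "x \<in> {0..real n * h}" and LK: "L \<ge> 0" "K \<ge> 0"
  shows "\<bar>lin_interp n h \<phi> x - g x\<bar> \<le> (L + K) * h powr \<gamma> + \<epsilon>"
proof -
  obtain k where k: "k \<le> n" "real k * h \<le> x" "x \<le> real (Suc k) * h"
  proof (cases "x = real n * h")
    case True
    then show ?thesis using that[of n] h by simp
  next
    case False
    then show ?thesis using exists_grid_cell[OF h, of x n] x that
      by (metis atLeastAtMost_iff less_imp_le order_le_less)
  qed
  have p: "(x - real k * h) powr \<gamma> \<le> h powr \<gamma>"
  proof (rule powr_mono2)
    show "x - real k * h \<le> h" using k(3) by (simp add: distrib_right)
  qed (use \<gamma> k(2) in auto)
  have kin: "real k * h \<in> {0..real n * h}" using k(1) h by simp
  have "\<bar>lin_interp n h \<phi> x - \<phi> (real k * h)\<bar> \<le> L * (x - real k * h) powr \<gamma>"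
    using holder_withD[OF I x kin] k(2) unfolding lin_interp_grid[OF h k(1)] by simp
  moreover have "\<bar>g x - g (real k * h)\<bar> \<le> K * (x - real k * h) powr \<gamma>"
    using holder_withD[OF g x kin] k(2) by simp
  moreover have "L * (x - real k * h) powr \<gamma> \<le> L * h powr \<gamma>" "K * (x - real k * h) powr \<gamma> \<le> K * h powr \<gamma>"
    using p LK by (auto intro: mult_left_mono)
  ultimately show ?thesis using close[OF k(1)] unfolding distrib_right by linarith
qed

section \<open>Young's estimate for Riemann sums\<close>

lemma powr_add_le_of_balanced:
  fixes a b p :: real
  assumes "a \<ge> 0" "b \<ge> 0" "a \<le> 2/3 * (a + b)" "b \<le> 2/3 * (a + b)" "p \<ge> 1"
  shows "a powr p + b powr p \<le> (2/3) powr (p - 1) * (a + b) powr p"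
proof -
  \<comment> \<open>One factor \<open>c\<close> is kept, so that the two bounds add up to a multiple
    of \<open>a + b\<close>; the remaining power \<open>p - 1\<close> supplies the
    contraction.\<close>
  have *: "c powr p \<le> c * ((2/3) powr (p - 1) * (a + b) powr (p - 1))"
    if "c \<ge> 0" "c \<le> 2/3 * (a + b)" for c
  proof -
    have "c powr p = c * c powr (p - 1)"
      using that powr_mult_base[of c "p - 1"] by simp
    also have "\<dots> \<le> c * (2/3 * (a + b)) powr (p - 1)"
      using that assms by (intro mult_left_mono powr_mono2) auto
    also have "(2/3 * (a + b)) powr (p - 1) = (2/3) powr (p - 1) * (a + b) powr (p - 1)"
      by (rule powr_mult)
    finally show ?thesis .
  qed
  have "a powr p + b powr p \<le> (a + b) * ((2/3) powr (p - 1) * (a + b) powr (p - 1))"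
    using *[of a] *[of b] assms by (simp add: distrib_right)
  also have "\<dots> = (2/3) powr (p - 1) * (a + b) powr p"
    using assms powr_mult_base[of "a + b" "p - 1"] by (simp add: mult_ac)
  finally show ?thesis .
qed

text \<open>The sum of the geometric series with ratio (2/3)^(p-1). The 2/3 is the worst case of
  halving an integer range, when three cells are split into one and two.\<close>

definition young_const :: "real \<Rightarrow> real" where
  "young_const p = 1 / (1 - (2/3) powr (p - 1))"

lemma young_const_pos: "p > 1 \<Longrightarrow> young_const p > 0"
  by (simp add: young_const_def powr_def mult_pos_neg)

text \<open>Splitting the index range in the middle produces the error
  \<open>(f m - f i) * (g j - g m)\<close>; both halves have at most two thirds of the length, so these errors
  sum up like a geometric series because \<open>\<mu> + \<gamma> > 1\<close>.\<close>

lemma discrete_young: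
  fixes f g :: "nat \<Rightarrow> real"
  assumes p: "\<mu> + \<gamma> > 1" and "\<mu> \<ge> 0" "\<gamma> \<ge> 0" and F: "F \<ge> 0" and G: "G \<ge> 0"
    and f: "\<And>k l. i \<le> k \<Longrightarrow> k < l \<Longrightarrow> l < j \<Longrightarrow> \<bar>f l - f k\<bar> \<le> F * (real l - real k) powr \<mu>"
    and g: "\<And>k l. i \<le> k \<Longrightarrow> k < l \<Longrightarrow> l \<le> j \<Longrightarrow> \<bar>g l - g k\<bar> \<le> G * (real l - real k) powr \<gamma>"
    and "i \<le> j"
  shows "\<bar>(\<Sum>k=i..<j. f k * (g (Suc k) - g k)) - f i * (g j - g i)\<bar>
    \<le> young_const (\<mu> + \<gamma>) * F * G * (real j - real i) powr (\<mu> + \<gamma>)"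
  using f g \<open>i \<le> j\<close>
proof (induction "j - i" arbitrary: i j rule: less_induct)
  case less
  let ?p = "\<mu> + \<gamma>" and ?C = "young_const (\<mu> + \<gamma>)"
  let ?A = "\<lambda>i j. (\<Sum>k=i..<j. f k * (g (Suc k) - g k)) - f i * (g j - g i)"
  have C: "?C > 0" using young_const_pos p by simp
  show ?case
  proof (cases "j - i \<le> 1")
    case True
    then have "j = i \<or> j = Suc i" using less.prems(3) by linarith
    then have "?A i j = 0" by auto
    then show ?thesis using C F G by simp
  next
    case False
    define m where "m = i + (j - i) div 2"
    have m: "i < m" "m < j" using False by (auto simp: m_def)
    have m3: "3 * (m - i) \<le> 2 * (j - i)" "3 * (j - m) \<le> 2 * (j - i)"
      using False by (auto simp: m_def)
    have split: "?A i j = ?A i m + ?A m j + (f m - f i) * (g j - g m)"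
    proof -
      have "(\<Sum>k=i..<j. f k * (g (Suc k) - g k)) =
         (\<Sum>k=i..<m. f k * (g (Suc k) - g k)) + (\<Sum>k=m..<j. f k * (g (Suc k) - g k))"
        using m by (intro sum.atLeastLessThan_concat[symmetric]) auto
      then show ?thesis by (simp add: algebra_simps)
    qed
    have 1: "\<bar>?A i m\<bar> \<le> ?C * F * G * (real m - real i) powr ?p"
      using m by (intro less.hyps) (auto intro: less.prems)
    have 2: "\<bar>?A m j\<bar> \<le> ?C * F * G * (real j - real m) powr ?p"
      using m by (intro less.hyps) (auto intro: less.prems)
    have 3: "\<bar>(f m - f i) * (g j - g m)\<bar> \<le> F * G * (real j - real i) powr ?p"
    proof -
      have "\<bar>f m - f i\<bar> \<le> F * (real m - real i) powr \<mu>" using m by (intro less.prems) auto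
      also have "\<dots> \<le> F * (real j - real i) powr \<mu>"
        using m F \<open>\<mu> \<ge> 0\<close> by (intro mult_left_mono powr_mono2) auto
      finally have a: "\<bar>f m - f i\<bar> \<le> F * (real j - real i) powr \<mu>" .
      have "\<bar>g j - g m\<bar> \<le> G * (real j - real m) powr \<gamma>" using m by (intro less.prems) auto
      also have "\<dots> \<le> G * (real j - real i) powr \<gamma>"
        using m G \<open>\<gamma> \<ge> 0\<close> by (intro mult_left_mono powr_mono2) auto
      finally have b: "\<bar>g j - g m\<bar> \<le> G * (real j - real i) powr \<gamma>" .
      have "\<bar>(f m - f i) * (g j - g m)\<bar> \<le> (F * (real j - real i) powr \<mu>) * (G * (real j - real i) powr \<gamma>)"
        unfolding abs_mult using a b F by (intro mult_mono) auto
      then show ?thesis by (simp add: powr_add mult_ac)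
    qed
    have 4: "(real m - real i) powr ?p + (real j - real m) powr ?p
       \<le> (2/3) powr (?p - 1) * (real j - real i) powr ?p"
    proof -
      have "3 * real (m - i) \<le> 2 * real (j - i)" "3 * real (j - m) \<le> 2 * real (j - i)"
        using m3 by linarith+
      then show ?thesis
        using powr_add_le_of_balanced[of "real m - real i" "real j - real m" ?p] m p
        by (simp add: of_nat_diff)
    qed
    have "\<bar>?A i j\<bar> \<le> ?C * F * G * ((real m - real i) powr ?p + (real j - real m) powr ?p)
       + F * G * (real j - real i) powr ?p"
    proof -
      have *: "\<bar>a + b + c\<bar> \<le> q * (x + y) + z" if "\<bar>a\<bar> \<le> q * x" "\<bar>b\<bar> \<le> q * y" "\<bar>c\<bar> \<le> z" for a b c q x y z :: real
        using that by (simp add: distrib_left)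
      show ?thesis unfolding split using 1 2 3 by (rule *)
    qed
    also have "\<dots> \<le> ?C * F * G * ((2/3) powr (?p - 1) * (real j - real i) powr ?p)
       + F * G * (real j - real i) powr ?p"
      using 4 C F G by (intro add_right_mono mult_left_mono) auto
    also have "\<dots> = F * G * (real j - real i) powr ?p * (?C * (2/3) powr (?p - 1) + 1)"
      by (simp add: algebra_simps)
    \<comment> \<open>\<open>young_const\<close> solves the recursion C = C q + 1, so the induction
      reproduces the same constant.\<close>
    also have "?C * (2/3) powr (?p - 1) + 1 = ?C"
    proof -
      have "(2/3 :: real) powr (?p - 1) < 1"
        using p by (simp add: powr_def mult_pos_neg)
      moreover have "1 / (1 - q) * q + 1 = 1 / (1 - q)" if "q < 1" for q :: real
        using that by (simp add: field_simps)
      ultimately show ?thesis unfolding young_const_def by blast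
    qed
    finally show ?thesis by (simp only: mult_ac)
  qed
qed

section \<open>The generalized Lebesgue-Stieltjes integral of Hoelder functions\<close>

text \<open>The sign of \<open>f\<close> turns gauge integrability into absolute integrability even
  when \<open>f\<close> blows up at an endpoint. Leaving open which endpoints belong to
  \<open>S\<close> lets one lemma serve open and half-open intervals.\<close>

lemma nonneg_FTC:
  fixes f F :: "real \<Rightarrow> real"
  assumes "a \<le> b" "continuous_on {a..b} F"
    and "\<And>x. x \<in> {a<..<b} \<Longrightarrow> (F has_real_derivative f x) (at x)"
    and nn: "\<And>x. x \<in> {a<..<b} \<Longrightarrow> f x \<ge> 0"
    and f [measurable]: "f \<in> borel_measurable borel"
    and S: "{a<..<b} \<subseteq> S" "S \<subseteq> {a..b}" and S' [measurable]: "S \<in> sets borel"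
  shows "set_integrable lborel S f" "(LBINT x:S. f x) = F b - F a"
proof -
  have "(f has_integral F b - F a) {a..b}"
    using assms(1,2) by (rule fundamental_theorem_of_calculus_interior)
      (use assms(3) in \<open>simp add: has_real_derivative_iff_has_vector_derivative\<close>)
  then have Ioo: "(f has_integral F b - F a) {a<..<b}"
    by (simp add: has_integral_Icc_iff_Ioo)
  then have abs: "f absolutely_integrable_on {a<..<b}"
    by (intro nonnegative_absolutely_integrable_1) (auto simp: nn)
  have ng: "negligible ({a<..<b} - S \<union> (S - {a<..<b}))"
  proof (rule negligible_subset)
    show "negligible {a, b}" by simp
  qed (use S in force)
  have "f absolutely_integrable_on S"
  proof (subst absolutely_integrable_spike_set_eq)
    show "f absolutely_integrable_on {a<..<b}" by (fact abs)
    show "negligible {x \<in> S - {a<..<b}. f x \<noteq> 0}" "negligible {x \<in> {a<..<b} - S. f x \<noteq> 0}"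
      by (rule negligible_subset[OF ng]; blast)+
  qed
  then show i: "set_integrable lborel S f"
    unfolding set_integrable_def by (subst (asm) integrable_completion) auto
  have "integral S f = integral {a<..<b} f"
    by (rule integral_spike_set; rule negligible_subset[OF ng]; blast)
  with set_borel_integral_eq_integral(2)[OF i] integral_unique[OF Ioo]
  show "(LBINT x:S. f x) = F b - F a" by simp
qed

section \<open>Power and Beta integrals\<close>

lemma power_integral_at_left:
  fixes a x q :: real
  assumes "a \<le> x" "q > -1"
  shows "set_integrable lborel {a<..<x} (\<lambda>y. (x - y) powr q)"
    "(LBINT y:{a<..<x}. (x - y) powr q) = (x - a) powr (q + 1) / (q + 1)"
proof -
  define F where "F = (\<lambda>y. - ((x - y) powr (q + 1) / (q + 1)))"
  have c: "continuous_on {a..x} F"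
    unfolding F_def
    by (rule continuous_on_minus, rule continuous_on_divide, rule continuous_on_powr') (use assms in \<open>auto intro!: continuous_intros\<close>)
  have d: "(F has_real_derivative (x - y) powr q) (at y)" if "y \<in> {a<..<x}" for y
    unfolding F_def using that assms by (auto intro!: derivative_eq_intros)
  note * = nonneg_FTC[OF assms(1) c d, of "{a<..<x}"]
  show "set_integrable lborel {a<..<x} (\<lambda>y. (x - y) powr q)"
    by (rule *(1)) auto
  have "(LBINT y:{a<..<x}. (x - y) powr q) = F x - F a"
    by (rule *(2)) auto
  then show "(LBINT y:{a<..<x}. (x - y) powr q) = (x - a) powr (q + 1) / (q + 1)"
    using assms by (simp add: F_def)
qed

lemma power_integral_at_right:
  fixes a b q :: real
  assumes "a \<le> b" "q > -1"
  shows "set_integrable lborel {a<..<b} (\<lambda>y. (y - a) powr q)"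
    "(LBINT y:{a<..<b}. (y - a) powr q) = (b - a) powr (q + 1) / (q + 1)"
proof -
  define F where "F = (\<lambda>y. (y - a) powr (q + 1) / (q + 1))"
  have c: "continuous_on {a..b} F"
    unfolding F_def
    by (rule continuous_on_divide, rule continuous_on_powr') (use assms in \<open>auto intro!: continuous_intros\<close>)
  have d: "(F has_real_derivative (y - a) powr q) (at y)" if "y \<in> {a<..<b}" for y
    unfolding F_def using that assms by (auto intro!: derivative_eq_intros)
  note * = nonneg_FTC[OF assms(1) c d, of "{a<..<b}"]
  show "set_integrable lborel {a<..<b} (\<lambda>y. (y - a) powr q)"
    by (rule *(1)) auto
  have "(LBINT y:{a<..<b}. (y - a) powr q) = F b - F a"
    by (rule *(2)) auto
  then show "(LBINT y:{a<..<b}. (y - a) powr q) = (b - a) powr (q + 1) / (q + 1)"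
    using assms by (simp add: F_def)
qed

lemma power_integral_left_of:
  fixes c d x \<alpha> :: real
  assumes "c \<le> d" "d < x" "\<alpha> > 0"
    and S: "{c<..<d} \<subseteq> S" "S \<subseteq> {c..d}" and S' [measurable]: "S \<in> sets borel"
  shows "set_integrable lborel S (\<lambda>y. 1 / (x - y) powr (\<alpha> + 1))"
    "(LBINT y:S. 1 / (x - y) powr (\<alpha> + 1)) = ((x - d) powr -\<alpha> - (x - c) powr -\<alpha>) / \<alpha>"
proof -
  define F where "F = (\<lambda>y. (x - y) powr -\<alpha> / \<alpha>)"
  have c: "continuous_on {c..d} F"
    unfolding F_def
    by (rule continuous_on_divide, rule continuous_on_powr) (use assms in \<open>auto intro!: continuous_intros\<close>)
  have d: "(F has_real_derivative 1 / (x - y) powr (\<alpha> + 1)) (at y)" if "y \<in> {c<..<d}" for y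
  proof -
    have "(x - y) powr (- \<alpha> - 1) = 1 / (x - y) powr (\<alpha> + 1)"
      by (metis add_uminus_conv_diff inverse_eq_divide minus_add_distrib powr_minus)
    then show ?thesis
      unfolding F_def using that assms by (auto intro!: derivative_eq_intros)
  qed
  note * = nonneg_FTC[OF assms(1) c d _ _ S]
  show "set_integrable lborel S (\<lambda>y. 1 / (x - y) powr (\<alpha> + 1))"
    by (rule *(1)) auto
  have "(LBINT y:S. 1 / (x - y) powr (\<alpha> + 1)) = F d - F c"
    by (rule *(2)) auto
  then show "(LBINT y:S. 1 / (x - y) powr (\<alpha> + 1)) = ((x - d) powr -\<alpha> - (x - c) powr -\<alpha>) / \<alpha>"
    by (simp add: F_def diff_divide_distrib)
qed

lemma power_integral_right_of:
  fixes c d x \<alpha> :: real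
  assumes "c \<le> d" "x < c" "\<alpha> > 0"
    and S: "{c<..<d} \<subseteq> S" "S \<subseteq> {c..d}" and S' [measurable]: "S \<in> sets borel"
  shows "set_integrable lborel S (\<lambda>y. 1 / (y - x) powr (\<alpha> + 1))"
    "(LBINT y:S. 1 / (y - x) powr (\<alpha> + 1)) = ((c - x) powr -\<alpha> - (d - x) powr -\<alpha>) / \<alpha>"
proof -
  define F where "F = (\<lambda>y. - ((y - x) powr -\<alpha> / \<alpha>))"
  have c: "continuous_on {c..d} F"
    unfolding F_def
    by (rule continuous_on_minus, rule continuous_on_divide, rule continuous_on_powr) (use assms in \<open>auto intro!: continuous_intros\<close>)
  have d: "(F has_real_derivative 1 / (y - x) powr (\<alpha> + 1)) (at y)" if "y \<in> {c<..<d}" for y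
  proof -
    have "(y - x) powr (- \<alpha> - 1) = 1 / (y - x) powr (\<alpha> + 1)"
      by (metis add_uminus_conv_diff inverse_eq_divide minus_add_distrib powr_minus)
    then show ?thesis
      unfolding F_def using that assms by (auto intro!: derivative_eq_intros)
  qed
  note * = nonneg_FTC[OF assms(1) c d _ _ S]
  show "set_integrable lborel S (\<lambda>y. 1 / (y - x) powr (\<alpha> + 1))"
    by (rule *(1)) auto
  have "(LBINT y:S. 1 / (y - x) powr (\<alpha> + 1)) = F d - F c"
    by (rule *(2)) auto
  then show "(LBINT y:S. 1 / (y - x) powr (\<alpha> + 1)) = ((c - x) powr -\<alpha> - (d - x) powr -\<alpha>) / \<alpha>"
    by (simp add: F_def diff_divide_distrib)
qed

lemma beta_integral_Ioo:
  assumes "c < a" "p > 0" "q > (0::real)"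
  shows "set_integrable lborel {c<..<a} (\<lambda>x. (x - c) powr (p - 1) * (a - x) powr (q - 1))"
    "(LBINT x:{c<..<a}. (x - c) powr (p - 1) * (a - x) powr (q - 1)) = Beta p q * (a - c) powr (p + q - 1)"
proof -
  let ?B = "\<lambda>t::real. t powr (p - 1) * (1 - t) powr (q - 1)"
  have hi: "(?B has_integral Beta p q) {0<..<1}"
    using has_integral_Beta_real[OF assms(2,3)] by (simp add: has_integral_Icc_iff_Ioo)
  then have "?B absolutely_integrable_on {0<..<1}"
    by (intro nonnegative_absolutely_integrable_1) auto
  then have i: "set_integrable lborel {0<..<1} ?B"
    unfolding set_integrable_def by (subst (asm) integrable_completion) auto
  have v: "(LBINT t:{0<..<1}. ?B t) = Beta p q"
    using set_borel_integral_eq_integral(2)[OF i] integral_unique[OF hi] by simp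
  define d where "d = a - c"
  have d: "d > 0" using assms by (simp add: d_def)
  \<comment> \<open>Substitution x = c + d t: the two factors scale by d^(p+q-2), which the
    prefactor removes.\<close>
  have eq: "indicator {0<..<1} t *\<^sub>R ?B t = d powr (2 - p - q) *
      (indicator {c<..<a} (c + d * t) *\<^sub>R ((c + d * t - c) powr (p - 1) * (a - (c + d * t)) powr (q - 1)))" for t
  proof (cases "t \<in> {0<..<1}")
    case True
    then have "c + d * t < a" "c < c + d * t"
      using d by (auto simp: d_def) (metis diff_gt_0_iff_gt add.commute less_diff_eq mult.right_neutral mult_less_cancel_left_pos assms(1))
    moreover have "a - (c + d * t) = d * (1 - t)" by (simp add: d_def algebra_simps)
    moreover have "d powr (2 - p - q) * ((d * t) powr (p - 1) * (d * (1 - t)) powr (q - 1)) = ?B t"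
    proof -
      have "d powr (2 - p - q) * (d powr (p - 1) * d powr (q - 1)) = 1"
        using d by (simp flip: powr_add)
      then show ?thesis by (simp add: powr_mult mult_ac)
    qed
    ultimately show ?thesis using True by simp
  next
    case False
    then have "c + d * t \<notin> {c<..<a}"
      using d by (auto simp: d_def zero_less_mult_iff) (metis add.commute diff_gt_0_iff_gt less_diff_eq mult.right_neutral mult_less_cancel_left_pos)
    then show ?thesis using False by simp
  qed
  let ?h = "\<lambda>x. indicator {c<..<a} x *\<^sub>R ((x - c) powr (p - 1) * (a - x) powr (q - 1))"
  have "integrable lborel (\<lambda>t. d powr (2 - p - q) * ?h (c + d * t))"
    using i unfolding set_integrable_def eq .
  then have "integrable lborel (\<lambda>t. ?h (c + d * t))"
    using d by (subst (asm) integrable_mult_left_iff) auto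
  then show "set_integrable lborel {c<..<a} (\<lambda>x. (x - c) powr (p - 1) * (a - x) powr (q - 1))"
    unfolding set_integrable_def using lborel_integrable_real_affine_iff[of d ?h c] d by simp
  have "Beta p q = d powr (2 - p - q) * (\<integral>t. ?h (c + d * t) \<partial>lborel)"
    using v unfolding set_lebesgue_integral_def eq by simp
  also have "(\<integral>t. ?h (c + d * t) \<partial>lborel) = (\<integral>x. ?h x \<partial>lborel) / d"
    using lborel_integral_real_affine[of d ?h c] d by simp
  finally have B: "Beta p q = d powr (2 - p - q) * ((\<integral>x. ?h x \<partial>lborel) / d)" .
  have "(\<integral>x. ?h x \<partial>lborel) = Beta p q * (d * d powr - (2 - p - q))"
  proof -
    have "I = B * (d * inverse e)" if "B = e * (I / d)" "e > 0" for B e I :: real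
      using that d by (simp add: field_simps)
    from this[OF B] d show ?thesis by (simp only: powr_minus) simp
  qed
  also have "d * d powr - (2 - p - q) = d powr (p + q - 1)"
    using powr_mult_base[of d "- (2 - p - q)"] d by (simp add: algebra_simps)
  finally show "(LBINT x:{c<..<a}. (x - c) powr (p - 1) * (a - x) powr (q - 1)) = Beta p q * (a - c) powr (p + q - 1)"
    unfolding set_lebesgue_integral_def d_def .
qed

section \<open>Left Weyl derivatives of cut-off functions\<close>

lemma borel_measurable_weyl_left [measurable]:
  assumes [measurable]: "f \<in> borel_measurable borel"
  shows "weyl_left \<alpha> a f \<in> borel_measurable borel"
proof -
  have [measurable]: "(\<lambda>x. \<integral>y. (if a < y \<and> y < x then (f x - f y) / (x - y) powr (\<alpha> + 1) else 0) \<partial>lborel)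
      \<in> borel_measurable borel"
    by measurable
  have "weyl_left \<alpha> a f = (\<lambda>x. 1 / Gamma (1 - \<alpha>) * (f x / (x - a) powr \<alpha> + \<alpha> *
     (\<integral>y. (if a < y \<and> y < x then (f x - f y) / (x - y) powr (\<alpha> + 1) else 0) \<partial>lborel)))"
    unfolding weyl_left_def set_lebesgue_integral_def
    by (intro ext arg_cong2[where f = "(*)"] arg_cong2[where f = "(+)"] Bochner_Integration.integral_cong refl)
       (auto simp: indicator_def)
  then show ?thesis by simp
qed

lemma weyl_left_linear:
  assumes "weyl_left_defined \<alpha> a f x" "weyl_left_defined \<alpha> a g x"
  shows "weyl_left_defined \<alpha> a (\<lambda>y. u * f y + v * g y) x"
    "weyl_left \<alpha> a (\<lambda>y. u * f y + v * g y) x = u * weyl_left \<alpha> a f x + v * weyl_left \<alpha> a g x"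
proof -
  let ?I = "\<lambda>f y. (f x - f y) / (x - y) powr (\<alpha> + 1)"
  have eq: "?I (\<lambda>y. u * f y + v * g y) = (\<lambda>y. u * ?I f y + v * ?I g y)"
    by (auto simp: fun_eq_iff field_simps simp flip: add_divide_distrib diff_divide_distrib)
  have i: "set_integrable lborel {a<..<x} (\<lambda>y. u * ?I f y)" "set_integrable lborel {a<..<x} (\<lambda>y. v * ?I g y)"
    using assms unfolding weyl_left_defined_def by - (rule set_integrable_mult_right, assumption)+
  show "weyl_left_defined \<alpha> a (\<lambda>y. u * f y + v * g y) x"
    unfolding weyl_left_defined_def eq by (intro set_integral_add i)
  have "(LBINT y:{a<..<x}. ?I (\<lambda>y. u * f y + v * g y) y)
      = u * (LBINT y:{a<..<x}. ?I f y) + v * (LBINT y:{a<..<x}. ?I g y)"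
    unfolding eq by (subst set_integral_add(2)[OF i]) (simp only: set_integral_mult_right)
  then show "weyl_left \<alpha> a (\<lambda>y. u * f y + v * g y) x = u * weyl_left \<alpha> a f x + v * weyl_left \<alpha> a g x"
    unfolding weyl_left_def by (simp add: algebra_simps add_divide_distrib)
qed

lemma weyl_left_cong_AE:
  assumes [measurable]: "f \<in> borel_measurable borel" "g \<in> borel_measurable borel"
    and "AE y in lborel. f y = g y" "f x = g x"
  shows "weyl_left_defined \<alpha> a f x \<longleftrightarrow> weyl_left_defined \<alpha> a g x"
    "weyl_left \<alpha> a f x = weyl_left \<alpha> a g x"
proof -
  have *: "AE y in lborel. indicator {a<..<x} y *\<^sub>R ((f x - f y) / (x - y) powr (\<alpha> + 1)) =
     indicator {a<..<x} y *\<^sub>R ((g x - g y) / (x - y) powr (\<alpha> + 1))"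
    using assms(3) by eventually_elim (simp add: assms(4))
  show "weyl_left_defined \<alpha> a f x \<longleftrightarrow> weyl_left_defined \<alpha> a g x"
    unfolding weyl_left_defined_def set_integrable_def by (intro integrable_cong_AE * ) auto
  have "(LBINT y:{a<..<x}. (f x - f y) / (x - y) powr (\<alpha> + 1)) =
        (LBINT y:{a<..<x}. (g x - g y) / (x - y) powr (\<alpha> + 1))"
    unfolding set_lebesgue_integral_def by (intro integral_cong_AE * ) auto
  then show "weyl_left \<alpha> a f x = weyl_left \<alpha> a g x"
    unfolding weyl_left_def using assms(4) by simp
qed

abbreviation cutoff :: "real \<Rightarrow> real \<Rightarrow> (real \<Rightarrow> real) \<Rightarrow> real \<Rightarrow> real" where
  "cutoff c d \<phi> \<equiv> \<lambda>y. indicator {c<..<d} y * \<phi> y"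

text \<open>Between 0 and \<open>c\<close> the cut-off vanishes and the kernel integrates in closed
  form; the resulting power of \<open>x\<close> cancels the boundary term at 0. So the derivative
  based at 0 is the one based at \<open>c\<close>.\<close>

lemma weyl_left_cutoff_inside:
  assumes "0 \<le> c" "c < x" "x < d" "\<alpha> > 0"
    and i: "set_integrable lborel {c<..<x} (\<lambda>y. (\<phi> x - \<phi> y) / (x - y) powr (\<alpha> + 1))"
  shows "weyl_left_defined \<alpha> 0 (cutoff c d \<phi>) x"
    "weyl_left \<alpha> 0 (cutoff c d \<phi>) x = 1 / Gamma (1 - \<alpha>) *
      (\<phi> x * (x - c) powr -\<alpha> + \<alpha> * (LBINT y:{c<..<x}. (\<phi> x - \<phi> y) / (x - y) powr (\<alpha> + 1)))"
proof -
  let ?F = "cutoff c d \<phi>"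
  let ?I = "\<lambda>f y. (f x - f y) / (x - y) powr (\<alpha> + 1)"
  have Fx: "?F x = \<phi> x" using assms by simp
  have S: "{0<..<x} = {0<..c} \<union> {c<..<x}" "{0<..c} \<inter> {c<..<x} = {}" using assms by auto
  have eqA: "indicator {0<..c} y *\<^sub>R ?I ?F y = indicator {0<..c} y *\<^sub>R (\<phi> x * (1 / (x - y) powr (\<alpha> + 1)))" for y
    using Fx by (auto simp: indicator_def)
  have eqB: "indicator {c<..<x} y *\<^sub>R ?I ?F y = indicator {c<..<x} y *\<^sub>R ?I \<phi> y" for y
    using assms by (auto simp: indicator_def)
  have P: "set_integrable lborel {0<..c} (\<lambda>y. 1 / (x - y) powr (\<alpha> + 1))"
    "(LBINT y:{0<..c}. 1 / (x - y) powr (\<alpha> + 1)) = ((x - c) powr -\<alpha> - (x - 0) powr -\<alpha>) / \<alpha>"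
    using power_integral_left_of[of 0 c x \<alpha> "{0<..c}"] assms by force+
  have A: "set_integrable lborel {0<..c} (?I ?F)"
    unfolding set_integrable_def eqA
    using P(1) unfolding set_integrable_def[symmetric] by (intro set_integrable_mult_right)
  have A': "(LBINT y:{0<..c}. ?I ?F y) = \<phi> x * (((x - c) powr -\<alpha> - x powr -\<alpha>) / \<alpha>)"
    unfolding set_lebesgue_integral_def eqA
    using P(2) unfolding set_lebesgue_integral_def[symmetric] by (subst set_integral_mult_right) simp
  have B: "set_integrable lborel {c<..<x} (?I ?F)"
    using i unfolding set_integrable_def eqB .
  have B': "(LBINT y:{c<..<x}. ?I ?F y) = (LBINT y:{c<..<x}. ?I \<phi> y)"
    unfolding set_lebesgue_integral_def eqB ..
  show "weyl_left_defined \<alpha> 0 ?F x"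
    unfolding weyl_left_defined_def S(1) using A B by (intro set_integrable_Un) auto
  have "(LBINT y:{0<..<x}. ?I ?F y) = \<phi> x * (((x - c) powr -\<alpha> - x powr -\<alpha>) / \<alpha>) + (LBINT y:{c<..<x}. ?I \<phi> y)"
    unfolding S(1) by (subst set_integral_Un[OF S(2) A B]) (simp only: A' B')
  then have "weyl_left \<alpha> 0 ?F x = 1 / Gamma (1 - \<alpha>) * (\<phi> x / x powr \<alpha> +
     \<alpha> * (\<phi> x * (((x - c) powr -\<alpha> - x powr -\<alpha>) / \<alpha>) + (LBINT y:{c<..<x}. ?I \<phi> y)))"
    unfolding weyl_left_def Fx by simp
  also have "\<phi> x / x powr \<alpha> + \<alpha> * (\<phi> x * (((x - c) powr -\<alpha> - x powr -\<alpha>) / \<alpha>) + (LBINT y:{c<..<x}. ?I \<phi> y))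
     = \<phi> x * (x - c) powr -\<alpha> + \<alpha> * (LBINT y:{c<..<x}. ?I \<phi> y)"
  proof -
    have "\<alpha> * (f * ((p - q) / \<alpha>) + I) = f * p - f * q + \<alpha> * I" for f p q I :: real
      using assms(4) by (simp add: distrib_left) (simp add: right_diff_distrib)
    moreover have "\<phi> x / x powr \<alpha> = \<phi> x * x powr -\<alpha>" by (simp add: powr_minus_divide)
    ultimately show ?thesis by (simp only:)
  qed
  finally show "weyl_left \<alpha> 0 ?F x = 1 / Gamma (1 - \<alpha>) *
      (\<phi> x * (x - c) powr -\<alpha> + \<alpha> * (LBINT y:{c<..<x}. ?I \<phi> y))" .
qed

text \<open>The cut-off is 0 at \<open>x\<close>, so the boundary term drops, but the derivative
  still remembers the values on (c,d).\<close>

lemma weyl_left_cutoff_outside: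
  assumes "0 \<le> c" "d < x" "\<alpha> > 0"
    and i: "set_integrable lborel {c<..<d} (\<lambda>y. \<phi> y / (x - y) powr (\<alpha> + 1))"
  shows "weyl_left_defined \<alpha> 0 (cutoff c d \<phi>) x"
    "weyl_left \<alpha> 0 (cutoff c d \<phi>) x = - (\<alpha> / Gamma (1 - \<alpha>) * (LBINT y:{c<..<d}. \<phi> y / (x - y) powr (\<alpha> + 1)))"
proof -
  let ?F = "cutoff c d \<phi>"
  have Fx: "?F x = 0" using assms by simp
  have eq: "indicator {0<..<x} y *\<^sub>R ((?F x - ?F y) / (x - y) powr (\<alpha> + 1)) =
     - (indicator {c<..<d} y *\<^sub>R (\<phi> y / (x - y) powr (\<alpha> + 1)))" for y
    using assms Fx by (auto simp: indicator_def)
  show "weyl_left_defined \<alpha> 0 ?F x"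
    unfolding weyl_left_defined_def set_integrable_def eq
    using i unfolding set_integrable_def by simp
  show "weyl_left \<alpha> 0 ?F x = - (\<alpha> / Gamma (1 - \<alpha>) * (LBINT y:{c<..<d}. \<phi> y / (x - y) powr (\<alpha> + 1)))"
  proof -
    have "(LBINT y:{0<..<x}. (?F x - ?F y) / (x - y) powr (\<alpha> + 1)) = - (LBINT y:{c<..<d}. \<phi> y / (x - y) powr (\<alpha> + 1))"
      unfolding set_lebesgue_integral_def eq by (rule Bochner_Integration.integral_minus)
    then show ?thesis unfolding weyl_left_def Fx by simp
  qed
qed

lemma weyl_left_cutoff_before:
  assumes "x \<le> c"
  shows "weyl_left_defined \<alpha> 0 (cutoff c d \<phi>) x" "weyl_left \<alpha> 0 (cutoff c d \<phi>) x = 0"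
proof -
  let ?F = "cutoff c d \<phi>"
  have Fx: "?F x = 0" using assms by simp
  have eq: "indicator {0<..<x} y *\<^sub>R ((?F x - ?F y) / (x - y) powr (\<alpha> + 1)) = 0" for y
    using assms Fx by (auto simp: indicator_def)
  show "weyl_left_defined \<alpha> 0 ?F x"
    unfolding weyl_left_defined_def set_integrable_def eq by simp
  have "(LBINT y:{0<..<x}. (?F x - ?F y) / (x - y) powr (\<alpha> + 1)) = 0"
    unfolding set_lebesgue_integral_def eq by simp
  then show "weyl_left \<alpha> 0 ?F x = 0"
    unfolding weyl_left_def Fx by simp
qed

text \<open>The function (x - c)_+^(-\<alpha>). Divided by Gamma(1 - \<alpha>) it is the left
  derivative of a jump from 0 to 1 at \<open>c\<close>.\<close>

definition power_from :: "real \<Rightarrow> real \<Rightarrow> real \<Rightarrow> real" where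
  "power_from \<alpha> c x = indicator {c<..} x * (x - c) powr -\<alpha>"

lemma borel_measurable_power_from [measurable]: "power_from \<alpha> c \<in> borel_measurable borel"
  unfolding power_from_def by measurable

lemma power_from_integral:
  assumes "0 \<le> c" "c \<le> T" "\<alpha> < 1"
  shows "set_integrable lborel {0<..<T} (power_from \<alpha> c)"
    "(LBINT x:{0<..<T}. power_from \<alpha> c x) = (T - c) powr (1 - \<alpha>) / (1 - \<alpha>)"
proof -
  have eq: "indicator {0<..<T} x *\<^sub>R power_from \<alpha> c x = indicator {c<..<T} x *\<^sub>R ((x - c) powr -\<alpha>)" for x
    using assms by (auto simp: power_from_def indicator_def)
  show "set_integrable lborel {0<..<T} (power_from \<alpha> c)"
    unfolding set_integrable_def eq
    using power_integral_at_right(1)[of c T "-\<alpha>"] assms by (simp add: set_integrable_def)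
  show "(LBINT x:{0<..<T}. power_from \<alpha> c x) = (T - c) powr (1 - \<alpha>) / (1 - \<alpha>)"
    unfolding set_lebesgue_integral_def eq
    using power_integral_at_right(2)[of c T "-\<alpha>"] assms by (simp add: set_lebesgue_integral_def)
qed

text \<open>An indicator is a difference of two jumps. At x = d the derivative does not exist: the
  value there is 0, the left limit is 1, and the kernel has exponent above 1.\<close>

lemma weyl_left_indicator:
  assumes "0 \<le> c" "c < d" "0 < \<alpha>" "x \<noteq> d"
  shows "weyl_left_defined \<alpha> 0 (cutoff c d (\<lambda>_. 1)) x"
    "weyl_left \<alpha> 0 (cutoff c d (\<lambda>_. 1)) x = (power_from \<alpha> c x - power_from \<alpha> d x) / Gamma (1 - \<alpha>)"
proof -
  consider "x \<le> c" | "c < x" "x < d" | "d < x" using assms by linarith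
  then have "weyl_left_defined \<alpha> 0 (cutoff c d (\<lambda>_. 1)) x \<and>
    weyl_left \<alpha> 0 (cutoff c d (\<lambda>_. 1)) x = (power_from \<alpha> c x - power_from \<alpha> d x) / Gamma (1 - \<alpha>)"
  proof cases
    case 1
    then show ?thesis
      using weyl_left_cutoff_before[OF 1, of \<alpha> d "\<lambda>_. 1"] assms by (simp add: power_from_def)
  next
    case 2
    then show ?thesis
      using weyl_left_cutoff_inside[of c x d \<alpha> "\<lambda>_. 1"] assms
      by (simp add: power_from_def set_integrable_def set_lebesgue_integral_def)
  next
    case 3
    have P: "set_integrable lborel {c<..<d} (\<lambda>y. 1 / (x - y) powr (\<alpha> + 1))"
      "(LBINT y:{c<..<d}. 1 / (x - y) powr (\<alpha> + 1)) = ((x - d) powr -\<alpha> - (x - c) powr -\<alpha>) / \<alpha>"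
      using power_integral_left_of[of c d x \<alpha> "{c<..<d}"] assms 3 by force+
    have *: "- (\<alpha> / G * ((p - q) / \<alpha>)) = (q - p) / G" for G p q :: real
    proof -
      have "\<alpha> / G * ((p - q) / \<alpha>) = (p - q) / G" using assms(3) by simp
      then show ?thesis using minus_divide_left[of "p - q" G] by simp
    qed
    have "power_from \<alpha> c x = (x - c) powr -\<alpha>" "power_from \<alpha> d x = (x - d) powr -\<alpha>"
      using 3 assms by (auto simp: power_from_def)
    then show ?thesis
      using weyl_left_cutoff_outside[OF assms(1) 3 assms(3) P(1)] unfolding P(2) * by simp
  qed
  then show "weyl_left_defined \<alpha> 0 (cutoff c d (\<lambda>_. 1)) x"
    "weyl_left \<alpha> 0 (cutoff c d (\<lambda>_. 1)) x = (power_from \<alpha> c x - power_from \<alpha> d x) / Gamma (1 - \<alpha>)"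
    by auto
qed

text \<open>A numerator of order \<open>\<mu>\<close> leaves the exponent
  \<open>\<mu> - \<alpha> - 1 > -1\<close> in the singular kernel.\<close>

lemma set_integrable_powr_quotient:
  fixes c x :: real
  assumes "c \<le> x" "\<alpha> < \<mu>" and [measurable]: "\<phi> \<in> borel_measurable borel"
    and "\<And>y. y \<in> {c<..<x} \<Longrightarrow> \<bar>\<phi> y\<bar> \<le> K * (x - y) powr \<mu>"
  shows "set_integrable lborel {c<..<x} (\<lambda>y. \<phi> y / (x - y) powr (\<alpha> + 1))"
    "\<bar>LBINT y:{c<..<x}. \<phi> y / (x - y) powr (\<alpha> + 1)\<bar> \<le> K * (x - c) powr (\<mu> - \<alpha>) / (\<mu> - \<alpha>)"
proof -
  have q: "\<mu> - \<alpha> - 1 > -1" using assms by simp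
  note P = power_integral_at_left[OF assms(1) q]
  have bd: "\<bar>\<phi> y / (x - y) powr (\<alpha> + 1)\<bar> \<le> K * (x - y) powr (\<mu> - \<alpha> - 1)" if "y \<in> {c<..<x}" for y
  proof -
    have "\<bar>\<phi> y / (x - y) powr (\<alpha> + 1)\<bar> \<le> K * (x - y) powr \<mu> / (x - y) powr (\<alpha> + 1)"
      using assms(4)[OF that] by (simp add: abs_divide divide_right_mono)
    also have "\<dots> = K * (x - y) powr (\<mu> - \<alpha> - 1)"
      using powr_diff[of "x - y" \<mu> "\<alpha> + 1"] by (simp add: algebra_simps)
    finally show ?thesis .
  qed
  have i: "set_integrable lborel {c<..<x} (\<lambda>y. K * (x - y) powr (\<mu> - \<alpha> - 1))"
    using P(1) by simp
  show i': "set_integrable lborel {c<..<x} (\<lambda>y. \<phi> y / (x - y) powr (\<alpha> + 1))"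
    by (rule set_integrable_bound[OF i]) (use bd in \<open>auto simp: set_borel_measurable_def intro!: AE_I2 order_trans[OF _ abs_ge_self]\<close>)
  have "\<bar>LBINT y:{c<..<x}. \<phi> y / (x - y) powr (\<alpha> + 1)\<bar> \<le> (LBINT y:{c<..<x}. \<bar>\<phi> y / (x - y) powr (\<alpha> + 1)\<bar>)"
    using set_integral_norm_bound[OF i'] by simp
  also have "\<dots> \<le> (LBINT y:{c<..<x}. K * (x - y) powr (\<mu> - \<alpha> - 1))"
    using i' bd by (intro set_integral_mono i set_integrable_abs) auto
  also have "\<dots> = K * (x - c) powr (\<mu> - \<alpha>) / (\<mu> - \<alpha>)"
    using P(2) by simp
  finally show "\<bar>LBINT y:{c<..<x}. \<phi> y / (x - y) powr (\<alpha> + 1)\<bar> \<le> K * (x - c) powr (\<mu> - \<alpha>) / (\<mu> - \<alpha>)" .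
qed

text \<open>\<open>\<phi>\<close> is normalised to be small near \<open>s\<close>, so inside the
  interval both parts of the derivative have order (x - s)^(\<mu> - \<alpha>). Beyond
  \<open>t\<close> there remains a tail: (t - s)^\<mu> times the size of the tail of the
  indicator.\<close>

lemma weyl_left_cutoff_bounds:
  assumes st: "0 \<le> s" "s < t" and \<alpha>: "0 < \<alpha>" "\<alpha> < 1" "\<alpha> < \<mu>" and K: "K \<ge> 0"
    and [measurable]: "\<phi> \<in> borel_measurable borel"
    and b: "\<And>y. y \<in> {s<..<t} \<Longrightarrow> \<bar>\<phi> y\<bar> \<le> K * (y - s) powr \<mu>"
    and l: "\<And>x y. y \<in> {s<..<t} \<Longrightarrow> x \<in> {s<..<t} \<Longrightarrow> \<bar>\<phi> x - \<phi> y\<bar> \<le> K * \<bar>x - y\<bar> powr \<mu>"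
    and "x \<noteq> t"
  shows "weyl_left_defined \<alpha> 0 (cutoff s t \<phi>) x"
    "\<bar>weyl_left \<alpha> 0 (cutoff s t \<phi>) x\<bar> \<le> K / Gamma (1 - \<alpha>) *
      ((1 + \<alpha> / (\<mu> - \<alpha>)) * (indicator {s<..<t} x * (x - s) powr (\<mu> - \<alpha>)) +
       (t - s) powr \<mu> * (indicator {t<..} x * (power_from \<alpha> t x - power_from \<alpha> s x)))"
proof -
  have G: "Gamma (1 - \<alpha>) > 0" using \<alpha> by (intro Gamma_real_pos) simp
  consider "x \<le> s" | "s < x" "x < t" | "t < x" using assms(10) by linarith
  then have "weyl_left_defined \<alpha> 0 (cutoff s t \<phi>) x \<and>
    \<bar>weyl_left \<alpha> 0 (cutoff s t \<phi>) x\<bar> \<le> K / Gamma (1 - \<alpha>) *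
      ((1 + \<alpha> / (\<mu> - \<alpha>)) * (indicator {s<..<t} x * (x - s) powr (\<mu> - \<alpha>)) +
       (t - s) powr \<mu> * (indicator {t<..} x * (power_from \<alpha> t x - power_from \<alpha> s x)))"
  proof cases
    case 1
    then show ?thesis
      using weyl_left_cutoff_before[OF 1] st by simp
  next
    case 2
    note I = set_integrable_powr_quotient[of s x \<alpha> \<mu> "\<lambda>y. \<phi> x - \<phi> y" K]
    have l': "\<bar>\<phi> x - \<phi> y\<bar> \<le> K * (x - y) powr \<mu>" if "y \<in> {s<..<x}" for y
      using l[of y x] that 2 by simp
    have I1: "set_integrable lborel {s<..<x} (\<lambda>y. (\<phi> x - \<phi> y) / (x - y) powr (\<alpha> + 1))"
      by (rule I(1)) (use 2 \<alpha> l' in auto)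
    have I2: "\<bar>LBINT y:{s<..<x}. (\<phi> x - \<phi> y) / (x - y) powr (\<alpha> + 1)\<bar> \<le> K * (x - s) powr (\<mu> - \<alpha>) / (\<mu> - \<alpha>)"
      by (rule I(2)) (use 2 \<alpha> l' in auto)
    have "\<bar>\<phi> x * (x - s) powr -\<alpha>\<bar> \<le> K * (x - s) powr \<mu> * (x - s) powr -\<alpha>"
      unfolding abs_mult using b[of x] 2 by (intro mult_mono) auto
    also have "\<dots> = K * (x - s) powr (\<mu> - \<alpha>)"
      by (simp flip: powr_add add: mult.assoc)
    finally have J: "\<bar>\<phi> x * (x - s) powr -\<alpha>\<bar> \<le> K * (x - s) powr (\<mu> - \<alpha>)" .
    have "\<bar>\<phi> x * (x - s) powr -\<alpha> + \<alpha> * (LBINT y:{s<..<x}. (\<phi> x - \<phi> y) / (x - y) powr (\<alpha> + 1))\<bar>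
       \<le> K * (x - s) powr (\<mu> - \<alpha>) + \<alpha> * (K * (x - s) powr (\<mu> - \<alpha>) / (\<mu> - \<alpha>))"
    proof (intro order_trans[OF abs_triangle_ineq] add_mono J)
      have "\<bar>\<alpha> * z\<bar> = \<alpha> * \<bar>z\<bar>" for z using \<alpha> by (simp add: abs_mult)
      then show "\<bar>\<alpha> * (LBINT y:{s<..<x}. (\<phi> x - \<phi> y) / (x - y) powr (\<alpha> + 1))\<bar>
        \<le> \<alpha> * (K * (x - s) powr (\<mu> - \<alpha>) / (\<mu> - \<alpha>))"
        using mult_left_mono[OF I2, of \<alpha>] \<alpha> by simp
    qed
    also have "\<dots> = K * ((1 + \<alpha> / (\<mu> - \<alpha>)) * (x - s) powr (\<mu> - \<alpha>))"
      by (simp add: algebra_simps)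
    finally have "\<bar>weyl_left \<alpha> 0 (cutoff s t \<phi>) x\<bar> \<le>
        1 / Gamma (1 - \<alpha>) * (K * ((1 + \<alpha> / (\<mu> - \<alpha>)) * (x - s) powr (\<mu> - \<alpha>)))"
      unfolding weyl_left_cutoff_inside(2)[OF st(1) 2 \<alpha>(1) I1] abs_mult using G
      by (intro mult_mono) auto
    then show ?thesis using weyl_left_cutoff_inside(1)[OF st(1) 2 \<alpha>(1) I1] 2 by simp
  next
    case 3
    note P = power_integral_left_of[of s t x \<alpha> "{s<..<t}"]
    let ?q = "\<lambda>y. 1 / (x - y) powr (\<alpha> + 1)"
    have q: "set_integrable lborel {s<..<t} ?q"
      by (rule P(1)) (use st 3 \<alpha> in auto)
    have q': "(LBINT y:{s<..<t}. ?q y) = ((x - t) powr -\<alpha> - (x - s) powr -\<alpha>) / \<alpha>"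
      by (rule P(2)) (use st 3 \<alpha> in auto)
    have i: "set_integrable lborel {s<..<t} (\<lambda>y. K * (t - s) powr \<mu> * ?q y)"
      using q by (intro set_integrable_mult_right) auto
    have bd: "\<bar>\<phi> y / (x - y) powr (\<alpha> + 1)\<bar> \<le> K * (t - s) powr \<mu> * ?q y" if "y \<in> {s<..<t}" for y
    proof -
      have "\<bar>\<phi> y\<bar> \<le> K * (y - s) powr \<mu>" using b that by auto
      also have "\<dots> \<le> K * (t - s) powr \<mu>"
        using that K \<alpha> by (intro mult_left_mono powr_mono2) auto
      finally show ?thesis by (simp add: abs_divide divide_right_mono)
    qed
    have K': "\<bar>K * (t - s) powr \<mu>\<bar> = K * (t - s) powr \<mu>" using K by simp
    have i': "set_integrable lborel {s<..<t} (\<lambda>y. \<phi> y / (x - y) powr (\<alpha> + 1))"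
      by (rule set_integrable_bound[OF i]) (use bd K' in \<open>auto simp: set_borel_measurable_def intro!: AE_I2 order_trans[OF _ abs_ge_self]\<close>)
    have "\<bar>LBINT y:{s<..<t}. \<phi> y / (x - y) powr (\<alpha> + 1)\<bar> \<le> (LBINT y:{s<..<t}. \<bar>\<phi> y / (x - y) powr (\<alpha> + 1)\<bar>)"
      using set_integral_norm_bound[OF i'] by simp
    also have "\<dots> \<le> (LBINT y:{s<..<t}. K * (t - s) powr \<mu> * ?q y)"
      using i' bd by (intro set_integral_mono i set_integrable_abs) auto
    also have "\<dots> = K * (t - s) powr \<mu> * (LBINT y:{s<..<t}. ?q y)"
      by (rule set_integral_mult_right)
    also have "\<dots> = K * (t - s) powr \<mu> * (((x - t) powr -\<alpha> - (x - s) powr -\<alpha>) / \<alpha>)"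
      unfolding q' ..
    finally have "\<alpha> * \<bar>LBINT y:{s<..<t}. \<phi> y / (x - y) powr (\<alpha> + 1)\<bar>
      \<le> \<alpha> * (K * (t - s) powr \<mu> * (((x - t) powr -\<alpha> - (x - s) powr -\<alpha>) / \<alpha>))"
      using \<alpha> by (intro mult_left_mono) auto
    also have "\<dots> = K * ((t - s) powr \<mu> * ((x - t) powr -\<alpha> - (x - s) powr -\<alpha>))"
      using \<alpha> by simp
    finally have "\<bar>weyl_left \<alpha> 0 (cutoff s t \<phi>) x\<bar> \<le>
      K / Gamma (1 - \<alpha>) * ((t - s) powr \<mu> * ((x - t) powr -\<alpha> - (x - s) powr -\<alpha>))"
      unfolding weyl_left_cutoff_outside(2)[OF st(1) 3 \<alpha>(1) i'] using G \<alpha>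
      by (simp add: abs_mult abs_divide divide_right_mono)
    then show ?thesis
      using weyl_left_cutoff_outside(1)[OF st(1) 3 \<alpha>(1) i'] 3 st by (simp add: power_from_def)
  qed
  then show "weyl_left_defined \<alpha> 0 (cutoff s t \<phi>) x"
    "\<bar>weyl_left \<alpha> 0 (cutoff s t \<phi>) x\<bar> \<le> K / Gamma (1 - \<alpha>) *
      ((1 + \<alpha> / (\<mu> - \<alpha>)) * (indicator {s<..<t} x * (x - s) powr (\<mu> - \<alpha>)) +
       (t - s) powr \<mu> * (indicator {t<..} x * (power_from \<alpha> t x - power_from \<alpha> s x)))"
    by blast+
qed

section \<open>Right Weyl derivatives\<close>

definition weyl_right_real :: "real \<Rightarrow> real \<Rightarrow> (real \<Rightarrow> real) \<Rightarrow> real \<Rightarrow> real" where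
  "weyl_right_real \<delta> b f x = 1 / Gamma (1 - \<delta>) *
     (f x / (b - x) powr \<delta> + \<delta> * (LBINT y:{x<..<b}. (f x - f y) / (y - x) powr (\<delta> + 1)))"

lemma weyl_right_eq_real:
  "weyl_right \<delta> b f x = (-1) powr complex_of_real \<delta> * complex_of_real (weyl_right_real \<delta> b f x)"
  by (simp add: weyl_right_def weyl_right_real_def)

text \<open>The prefactor and the phase of the right derivative multiply to -1. From here on only
  real integrals and this sign occur.\<close>

lemma gls_integral_eq_real:
  "gls_integral \<alpha> a b f g =
     - (LBINT x:{a<..<b}. weyl_left \<alpha> a f x * weyl_right_real (1 - \<alpha>) b (left_limit_shift b g) x)"
proof -
  let ?h = "left_limit_shift b g"
  have "(LBINT x:{a<..<b}. complex_of_real (weyl_left \<alpha> a f x) * weyl_right (1 - \<alpha>) b ?h x)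
    = (LBINT x:{a<..<b}. (-1) powr complex_of_real (1 - \<alpha>) *
        complex_of_real (weyl_left \<alpha> a f x * weyl_right_real (1 - \<alpha>) b ?h x))"
    by (simp add: weyl_right_eq_real mult_ac)
  also have "\<dots> = (-1) powr complex_of_real (1 - \<alpha>) *
      complex_of_real (LBINT x:{a<..<b}. weyl_left \<alpha> a f x * weyl_right_real (1 - \<alpha>) b ?h x)"
    by (simp only: set_integral_mult_right set_integral_complex_of_real)
  finally have "(-1) powr complex_of_real \<alpha> *
      (LBINT x:{a<..<b}. complex_of_real (weyl_left \<alpha> a f x) * weyl_right (1 - \<alpha>) b ?h x)
    = ((-1) powr complex_of_real \<alpha> * (-1) powr complex_of_real (1 - \<alpha>)) *
      complex_of_real (LBINT x:{a<..<b}. weyl_left \<alpha> a f x * weyl_right_real (1 - \<alpha>) b ?h x)"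
    by simp
  also have "(-1) powr complex_of_real \<alpha> * (-1) powr complex_of_real (1 - \<alpha>) = -1"
    by (simp flip: powr_add)
  finally show ?thesis unfolding gls_integral_def by simp
qed

text \<open>The domain of integration depends on \<open>x\<close>; moved into the integrand, it
  leaves a parameter integral over the whole line of a jointly measurable function.\<close>

lemma borel_measurable_weyl_right_real [measurable]:
  assumes [measurable]: "f \<in> borel_measurable borel"
  shows "weyl_right_real \<delta> b f \<in> borel_measurable borel"
proof -
  have [measurable]: "(\<lambda>x. \<integral>y. (if x < y \<and> y < b then (f x - f y) / (y - x) powr (\<delta> + 1) else 0) \<partial>lborel)
      \<in> borel_measurable borel"
    by measurable
  have "weyl_right_real \<delta> b f = (\<lambda>x. 1 / Gamma (1 - \<delta>) * (f x / (b - x) powr \<delta> + \<delta> *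
     (\<integral>y. (if x < y \<and> y < b then (f x - f y) / (y - x) powr (\<delta> + 1) else 0) \<partial>lborel)))"
    unfolding weyl_right_real_def set_lebesgue_integral_def
    by (intro ext arg_cong2[where f = "(*)"] arg_cong2[where f = "(+)"] Bochner_Integration.integral_cong refl)
       (auto simp: indicator_def)
  then show ?thesis by simp
qed

lemma weyl_right_linear:
  assumes "weyl_right_defined \<delta> b f x" "weyl_right_defined \<delta> b g x"
  shows "weyl_right_defined \<delta> b (\<lambda>y. u * f y + v * g y) x"
    "weyl_right_real \<delta> b (\<lambda>y. u * f y + v * g y) x = u * weyl_right_real \<delta> b f x + v * weyl_right_real \<delta> b g x"
proof -
  let ?I = "\<lambda>f y. (f x - f y) / (y - x) powr (\<delta> + 1)"
  have eq: "?I (\<lambda>y. u * f y + v * g y) = (\<lambda>y. u * ?I f y + v * ?I g y)"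
    by (auto simp: fun_eq_iff field_simps simp flip: add_divide_distrib diff_divide_distrib)
  have i: "set_integrable lborel {x<..<b} (\<lambda>y. u * ?I f y)" "set_integrable lborel {x<..<b} (\<lambda>y. v * ?I g y)"
    using assms unfolding weyl_right_defined_def by - (rule set_integrable_mult_right, assumption)+
  show "weyl_right_defined \<delta> b (\<lambda>y. u * f y + v * g y) x"
    unfolding weyl_right_defined_def eq by (intro set_integral_add i)
  have "(LBINT y:{x<..<b}. ?I (\<lambda>y. u * f y + v * g y) y)
      = u * (LBINT y:{x<..<b}. ?I f y) + v * (LBINT y:{x<..<b}. ?I g y)"
    unfolding eq by (subst set_integral_add(2)[OF i]) (simp only: set_integral_mult_right)
  then show "weyl_right_real \<delta> b (\<lambda>y. u * f y + v * g y) x = u * weyl_right_real \<delta> b f x + v * weyl_right_real \<delta> b g x"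
    unfolding weyl_right_real_def by (simp add: algebra_simps add_divide_distrib)
qed

lemma weyl_right_cong:
  assumes "\<And>y. y \<in> {x..<b} \<Longrightarrow> f y = g y" "x < b"
  shows "weyl_right_defined \<delta> b f x \<longleftrightarrow> weyl_right_defined \<delta> b g x"
    "weyl_right_real \<delta> b f x = weyl_right_real \<delta> b g x"
proof -
  have fx: "f x = g x" using assms by simp
  have eq: "indicator {x<..<b} y *\<^sub>R ((f x - f y) / (y - x) powr (\<delta> + 1)) =
      indicator {x<..<b} y *\<^sub>R ((g x - g y) / (y - x) powr (\<delta> + 1))" for y
    using assms(1)[of y] fx by (auto simp: indicator_def)
  show "weyl_right_defined \<delta> b f x \<longleftrightarrow> weyl_right_defined \<delta> b g x"
    unfolding weyl_right_defined_def set_integrable_def eq ..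
  show "weyl_right_real \<delta> b f x = weyl_right_real \<delta> b g x"
    unfolding weyl_right_real_def set_lebesgue_integral_def eq unfolding fx ..
qed

text \<open>The last two conclusions are the integrable majorant for dominated convergence in
  \<open>weyl_inversion_holder\<close>.\<close>

lemma set_integrable_powr_quotient_right:
  fixes x b :: real
  assumes "x \<le> b" "\<delta> < \<mu>" and [measurable]: "\<phi> \<in> borel_measurable borel"
    and "\<And>y. y \<in> {x<..<b} \<Longrightarrow> \<bar>\<phi> y\<bar> \<le> K * (y - x) powr \<mu>"
  shows "set_integrable lborel {x<..<b} (\<lambda>y. \<phi> y / (y - x) powr (\<delta> + 1))"
    "\<bar>LBINT y:{x<..<b}. \<phi> y / (y - x) powr (\<delta> + 1)\<bar> \<le> K * (b - x) powr (\<mu> - \<delta>) / (\<mu> - \<delta>)"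
    "set_integrable lborel {x<..<b} (\<lambda>y. K * (y - x) powr (\<mu> - \<delta> - 1))"
    "\<And>y. y \<in> {x<..<b} \<Longrightarrow> \<bar>\<phi> y / (y - x) powr (\<delta> + 1)\<bar> \<le> K * (y - x) powr (\<mu> - \<delta> - 1)"
proof -
  have q: "\<mu> - \<delta> - 1 > -1" using assms by simp
  note P = power_integral_at_right[OF assms(1) q]
  show bd: "\<bar>\<phi> y / (y - x) powr (\<delta> + 1)\<bar> \<le> K * (y - x) powr (\<mu> - \<delta> - 1)" if "y \<in> {x<..<b}" for y
  proof -
    have "\<bar>\<phi> y / (y - x) powr (\<delta> + 1)\<bar> \<le> K * (y - x) powr \<mu> / (y - x) powr (\<delta> + 1)"
      using assms(4)[OF that] by (simp add: abs_divide divide_right_mono)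
    also have "\<dots> = K * (y - x) powr (\<mu> - \<delta> - 1)"
      using powr_diff[of "y - x" \<mu> "\<delta> + 1"] by (simp add: algebra_simps)
    finally show ?thesis .
  qed
  show i: "set_integrable lborel {x<..<b} (\<lambda>y. K * (y - x) powr (\<mu> - \<delta> - 1))"
    using P(1) by simp
  show i': "set_integrable lborel {x<..<b} (\<lambda>y. \<phi> y / (y - x) powr (\<delta> + 1))"
    by (rule set_integrable_bound[OF i]) (use bd in \<open>auto simp: set_borel_measurable_def intro!: AE_I2 order_trans[OF _ abs_ge_self]\<close>)
  have "\<bar>LBINT y:{x<..<b}. \<phi> y / (y - x) powr (\<delta> + 1)\<bar> \<le> (LBINT y:{x<..<b}. \<bar>\<phi> y / (y - x) powr (\<delta> + 1)\<bar>)"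
    using set_integral_norm_bound[OF i'] by simp
  also have "\<dots> \<le> (LBINT y:{x<..<b}. K * (y - x) powr (\<mu> - \<delta> - 1))"
    using i' bd by (intro set_integral_mono i set_integrable_abs) auto
  also have "\<dots> = K * (b - x) powr (\<mu> - \<delta>) / (\<mu> - \<delta>)"
    using P(2) by simp
  finally show "\<bar>LBINT y:{x<..<b}. \<phi> y / (y - x) powr (\<delta> + 1)\<bar> \<le> K * (b - x) powr (\<mu> - \<delta>) / (\<mu> - \<delta>)" .
qed

text \<open>As \<open>h\<close> vanishes at \<open>T\<close>, the boundary term also carries a
  factor (T - x)^\<gamma>, so the derivative stays bounded up to \<open>T\<close>. With
  \<open>\<delta>\<close> equal to 1 - \<alpha>, this is where the condition \<gamma> > 1 - \<alpha>
  on the integrator enters.\<close>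

lemma weyl_right_bound:
  assumes \<delta>: "0 < \<delta>" "\<delta> < 1" "\<delta> < \<gamma>" and K: "K \<ge> 0" and [measurable]: "h \<in> borel_measurable borel"
    and h: "holder_with K \<gamma> {0..T} h" "h T = 0" and x: "x \<in> {0<..<T}"
  shows "weyl_right_defined \<delta> T h x"
    "\<bar>weyl_right_real \<delta> T h x\<bar> \<le> 1 / Gamma (1 - \<delta>) * (K * (1 + \<delta> / (\<gamma> - \<delta>)) * T powr (\<gamma> - \<delta>))"
proof -
  have G: "Gamma (1 - \<delta>) > 0" using \<delta> by (intro Gamma_real_pos) simp
  have b: "\<bar>h x - h y\<bar> \<le> K * (y - x) powr \<gamma>" if "y \<in> {x<..<T}" for y
    using holder_withD[OF h(1), of x y] x that by (auto simp: abs_minus_commute)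
  have I: "set_integrable lborel {x<..<T} (\<lambda>y. (h x - h y) / (y - x) powr (\<delta> + 1))"
    "\<bar>LBINT y:{x<..<T}. (h x - h y) / (y - x) powr (\<delta> + 1)\<bar> \<le> K * (T - x) powr (\<gamma> - \<delta>) / (\<gamma> - \<delta>)"
    using set_integrable_powr_quotient_right[of x T \<delta> \<gamma> "\<lambda>y. h x - h y" K] x \<delta> b by auto
  show "weyl_right_defined \<delta> T h x"
    unfolding weyl_right_defined_def by (fact I(1))
  have Tp: "(T - x) powr (\<gamma> - \<delta>) \<le> T powr (\<gamma> - \<delta>)"
    using x \<delta> by (intro powr_mono2) auto
  have "\<bar>h x / (T - x) powr \<delta>\<bar> \<le> K * (T - x) powr \<gamma> / (T - x) powr \<delta>"
    using holder_withD[OF h(1), of x T] x h(2) by (simp add: divide_right_mono)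
  also have "\<dots> = K * (T - x) powr (\<gamma> - \<delta>)" by (simp add: powr_diff)
  finally have 1: "\<bar>h x / (T - x) powr \<delta>\<bar> \<le> K * (T - x) powr (\<gamma> - \<delta>)" .
  have 2: "\<bar>\<delta> * (LBINT y:{x<..<T}. (h x - h y) / (y - x) powr (\<delta> + 1))\<bar> \<le> \<delta> * (K * (T - x) powr (\<gamma> - \<delta>) / (\<gamma> - \<delta>))"
    unfolding abs_mult using I(2) \<delta> by (intro mult_mono) auto
  have "\<bar>h x / (T - x) powr \<delta> + \<delta> * (LBINT y:{x<..<T}. (h x - h y) / (y - x) powr (\<delta> + 1))\<bar>
      \<le> K * (1 + \<delta> / (\<gamma> - \<delta>)) * (T - x) powr (\<gamma> - \<delta>)"
    using order_trans[OF abs_triangle_ineq add_mono[OF 1 2]] by (simp add: algebra_simps)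
  also have "\<dots> \<le> K * (1 + \<delta> / (\<gamma> - \<delta>)) * T powr (\<gamma> - \<delta>)"
    using K \<delta> Tp by (intro mult_left_mono) auto
  finally show "\<bar>weyl_right_real \<delta> T h x\<bar> \<le> 1 / Gamma (1 - \<delta>) * (K * (1 + \<delta> / (\<gamma> - \<delta>)) * T powr (\<gamma> - \<delta>))"
    unfolding weyl_right_real_def abs_mult using G by (intro mult_mono) auto
qed

section \<open>Inversion on ramps, interpolants and Hoelder functions\<close>

definition ramp :: "real \<Rightarrow> real \<Rightarrow> real" where
  "ramp a x = max 0 (a - x)"

lemma borel_measurable_ramp [measurable]: "ramp a \<in> borel_measurable borel"
  unfolding ramp_def by measurable

text \<open>A truncated linear function differentiates to a truncated power; the denominator is
  Gamma(2 - \<delta>).\<close>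

lemma weyl_right_ramp:
  assumes \<delta>: "0 < \<delta>" "\<delta> < 1" and a: "a \<le> T" and x: "x < T"
  shows "weyl_right_defined \<delta> T (ramp a) x"
    "weyl_right_real \<delta> T (ramp a) x = ramp a x powr (1 - \<delta>) / ((1 - \<delta>) * Gamma (1 - \<delta>))"
proof -
  let ?I = "\<lambda>y. (ramp a x - ramp a y) / (y - x) powr (\<delta> + 1)"
  have I: "set_integrable lborel {x<..<T} ?I"
    by (rule set_integrable_powr_quotient_right[where \<mu> = 1 and K = 1]) (use x \<delta> in \<open>auto simp: ramp_def\<close>)
  show "weyl_right_defined \<delta> T (ramp a) x"
    unfolding weyl_right_defined_def by (fact I)
  show "weyl_right_real \<delta> T (ramp a) x = ramp a x powr (1 - \<delta>) / ((1 - \<delta>) * Gamma (1 - \<delta>))"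
  proof (cases "x < a")
    case False
    then have 0: "ramp a x = 0" by (simp add: ramp_def)
    have eq: "indicator {x<..<T} y *\<^sub>R ?I y = 0" for y
      using False by (auto simp: ramp_def indicator_def)
    have "(LBINT y:{x<..<T}. ?I y) = 0"
      unfolding set_lebesgue_integral_def eq by simp
    then show ?thesis unfolding weyl_right_real_def 0 by simp
  next
    case True
    have S: "{x<..<T} = {x<..<a} \<union> {a..<T}" "{x<..<a} \<inter> {a..<T} = {}" using True a by auto
    have rx: "ramp a x = a - x" using True by (simp add: ramp_def)
    have I1: "set_integrable lborel {x<..<a} ?I" "set_integrable lborel {a..<T} ?I"
      by (rule set_integrable_subset[OF I]; use S in auto)+
    have e1: "indicator {x<..<a} y *\<^sub>R ?I y = indicator {x<..<a} y *\<^sub>R ((y - x) powr -\<delta>)" for y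
    proof (cases "y \<in> {x<..<a}")
      case True
      then have "(y - x) powr (\<delta> + 1) = (y - x) * (y - x) powr \<delta>"
        using powr_mult_base[of "y - x" \<delta>] by (simp add: add.commute)
      then show ?thesis using True by (simp add: ramp_def powr_minus_divide)
    qed simp
    have v1: "(LBINT y:{x<..<a}. ?I y) = (a - x) powr (1 - \<delta>) / (1 - \<delta>)"
      unfolding set_lebesgue_integral_def e1
      using power_integral_at_right(2)[of x a "-\<delta>"] True \<delta> by (simp add: set_lebesgue_integral_def)
    have e2: "indicator {a..<T} y *\<^sub>R ?I y = indicator {a..<T} y *\<^sub>R ((a - x) * (1 / (y - x) powr (\<delta> + 1)))" for y
      using True by (auto simp: ramp_def indicator_def)
    have P: "(LBINT y:{a..<T}. 1 / (y - x) powr (\<delta> + 1)) = ((a - x) powr -\<delta> - (T - x) powr -\<delta>) / \<delta>"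
      using power_integral_right_of(2)[of a T x \<delta> "{a..<T}"] True a \<delta> by force
    have v2: "(LBINT y:{a..<T}. ?I y) = (a - x) * (((a - x) powr -\<delta> - (T - x) powr -\<delta>) / \<delta>)"
      unfolding set_lebesgue_integral_def e2
      unfolding set_lebesgue_integral_def[symmetric] set_integral_mult_right P ..
    have v: "(LBINT y:{x<..<T}. ?I y) = (a - x) powr (1 - \<delta>) / (1 - \<delta>)
       + (a - x) * (((a - x) powr -\<delta> - (T - x) powr -\<delta>) / \<delta>)"
      unfolding S(1) set_integral_Un[OF S(2) I1] v1 v2 ..
    \<comment> \<open>The integral over the part where the ramp is 0 cancels the boundary term at
      \<open>T\<close>, so the result does not depend on \<open>T\<close>.\<close>
    have gen: "r * q + \<delta> * (z / (1 - \<delta>) + r * ((p - q) / \<delta>)) = r * p + \<delta> * z / (1 - \<delta>)" for r p q z :: real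
      using \<delta> by (simp add: distrib_left) (simp add: right_diff_distrib)
    have "ramp a x / (T - x) powr \<delta> + \<delta> * (LBINT y:{x<..<T}. ?I y)
       = (a - x) * (a - x) powr -\<delta> + \<delta> * (a - x) powr (1 - \<delta>) / (1 - \<delta>)"
    proof -
      have "(a - x) / (T - x) powr \<delta> = (a - x) * (T - x) powr -\<delta>" by (simp add: powr_minus_divide)
      then show ?thesis unfolding v unfolding rx by (simp only: gen)
    qed
    also have "(a - x) * (a - x) powr -\<delta> = (a - x) powr (1 - \<delta>)"
      using powr_mult_base[of "a - x" "-\<delta>"] True by simp
    also have "(a - x) powr (1 - \<delta>) + \<delta> * (a - x) powr (1 - \<delta>) / (1 - \<delta>) = (a - x) powr (1 - \<delta>) / (1 - \<delta>)"
      using \<delta> by (simp add: field_simps)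
    finally show ?thesis unfolding weyl_right_real_def rx by simp
  qed
qed

text \<open>Fractional integration inverts fractional differentiation: on ramps this is a Beta integral,
  and piecewise linear interpolation extends it to Hoelder functions.\<close>

definition weyl_inversion :: "real \<Rightarrow> real \<Rightarrow> real \<Rightarrow> (real \<Rightarrow> real) \<Rightarrow> bool" where
  "weyl_inversion \<alpha> T c h \<longleftrightarrow>
     (\<forall>x\<in>{0<..<T}. weyl_right_defined (1 - \<alpha>) T h x) \<and>
     set_integrable lborel {0<..<T} (\<lambda>x. power_from \<alpha> c x * weyl_right_real (1 - \<alpha>) T h x) \<and>
     (LBINT x:{0<..<T}. power_from \<alpha> c x * weyl_right_real (1 - \<alpha>) T h x) = Gamma (1 - \<alpha>) * h c"

lemma weyl_inversion_linear:
  assumes "weyl_inversion \<alpha> T c f" "weyl_inversion \<alpha> T c g"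
  shows "weyl_inversion \<alpha> T c (\<lambda>x. u * f x + v * g x)"
proof -
  let ?W = "\<lambda>h x. power_from \<alpha> c x * weyl_right_real (1 - \<alpha>) T h x"
  let ?h = "\<lambda>x. u * f x + v * g x"
  have d: "weyl_right_defined (1 - \<alpha>) T ?h x"
    "weyl_right_real (1 - \<alpha>) T ?h x = u * weyl_right_real (1 - \<alpha>) T f x + v * weyl_right_real (1 - \<alpha>) T g x"
    if "x \<in> {0<..<T}" for x
    using weyl_right_linear[of "1 - \<alpha>" T f x g u v] assms that by (auto simp: weyl_inversion_def)
  have eq: "indicator {0<..<T} x *\<^sub>R ?W ?h x = indicator {0<..<T} x *\<^sub>R (u * ?W f x + v * ?W g x)" for x
    using d(2)[of x] by (auto simp: indicator_def algebra_simps)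
  have i: "set_integrable lborel {0<..<T} (\<lambda>x. u * ?W f x)" "set_integrable lborel {0<..<T} (\<lambda>x. v * ?W g x)"
    using assms unfolding weyl_inversion_def by - (rule set_integrable_mult_right, blast)+
  have "set_integrable lborel {0<..<T} (?W ?h)"
    unfolding set_integrable_def eq
    using set_integral_add(1)[OF i] unfolding set_integrable_def .
  moreover have "(LBINT x:{0<..<T}. ?W ?h x) = u * (LBINT x:{0<..<T}. ?W f x) + v * (LBINT x:{0<..<T}. ?W g x)"
    unfolding set_lebesgue_integral_def eq
    using set_integral_add(2)[OF i] unfolding set_integral_mult_right unfolding set_lebesgue_integral_def .
  ultimately show ?thesis
    using d(1) assms unfolding weyl_inversion_def by (auto simp: algebra_simps)
qed

lemma weyl_inversion_zero: "weyl_inversion \<alpha> T c (\<lambda>_. 0)"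
  by (simp add: weyl_inversion_def weyl_right_real_def weyl_right_defined_def set_integrable_def
      set_lebesgue_integral_def)

lemma weyl_inversion_sum:
  fixes n :: nat
  assumes "\<And>k. k < n \<Longrightarrow> weyl_inversion \<alpha> T c (f k)"
  shows "weyl_inversion \<alpha> T c (\<lambda>x. \<Sum>k<n. u k * f k x)"
  using assms
proof (induction n)
  case 0
  then show ?case by (simp add: weyl_inversion_zero)
next
  case (Suc n)
  then have "weyl_inversion \<alpha> T c (\<lambda>x. 1 * (\<Sum>k<n. u k * f k x) + u n * f n x)"
    by (intro weyl_inversion_linear) auto
  then show ?case by simp
qed

text \<open>Integration against \<open>power_from \<alpha> c\<close>, divided by Gamma(1 -
  \<alpha>), is the right fractional integral of order 1 - \<alpha> at \<open>c\<close>. The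
  derivative of a ramp is a power, and Beta(1 - \<alpha>, 1 + \<alpha>) = Gamma(1 - \<alpha>)
  Gamma(1 + \<alpha>) / Gamma(2). For \<open>a \<le> c\<close> the two supports are
  disjoint.\<close>

lemma weyl_inversion_ramp:
  assumes \<alpha>: "0 < \<alpha>" "\<alpha> < 1" and a: "a \<le> T" and c: "0 \<le> c"
  shows "weyl_inversion \<alpha> T c (ramp a)"
proof -
  let ?C = "1 / (\<alpha> * Gamma \<alpha>)"
  have G: "Gamma \<alpha> > 0" using \<alpha> by (intro Gamma_real_pos) simp
  have W: "weyl_right_real (1 - \<alpha>) T (ramp a) x = ?C * ramp a x powr \<alpha>" if "x < T" for x
    using weyl_right_ramp(2)[of "1 - \<alpha>" a T x] \<alpha> a that by simp
  have d: "weyl_right_defined (1 - \<alpha>) T (ramp a) x" if "x < T" for x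
    using weyl_right_ramp(1)[of "1 - \<alpha>" a T x] \<alpha> a that by simp
  let ?W = "\<lambda>x. power_from \<alpha> c x * weyl_right_real (1 - \<alpha>) T (ramp a) x"
  have eq: "indicator {0<..<T} x *\<^sub>R ?W x =
      indicator {c<..<a} x *\<^sub>R (?C * ((x - c) powr (1 - \<alpha> - 1) * (a - x) powr (1 + \<alpha> - 1)))" for x
    using W[of x] a c by (auto simp: indicator_def power_from_def ramp_def)
  show ?thesis
  proof (cases "c < a")
    case True
    note B = beta_integral_Ioo[OF True, of "1 - \<alpha>" "1 + \<alpha>"]
    have "set_integrable lborel {0<..<T} ?W"
      unfolding set_integrable_def eq unfolding set_integrable_def[symmetric]
      using B(1) \<alpha> by (intro set_integrable_mult_right) simp
    moreover have "(LBINT x:{0<..<T}. ?W x) = ?C * (Beta (1 - \<alpha>) (1 + \<alpha>) * (a - c))"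
    proof -
      have "(LBINT x:{0<..<T}. ?W x) = ?C * (LBINT x:{c<..<a}. (x - c) powr (1 - \<alpha> - 1) * (a - x) powr (1 + \<alpha> - 1))"
        unfolding set_lebesgue_integral_def eq
        unfolding set_lebesgue_integral_def[symmetric] by (rule set_integral_mult_right)
      also have "(LBINT x:{c<..<a}. (x - c) powr (1 - \<alpha> - 1) * (a - x) powr (1 + \<alpha> - 1)) = Beta (1 - \<alpha>) (1 + \<alpha>) * (a - c)"
        using B(2) \<alpha> True by simp
      finally show ?thesis .
    qed
    moreover have "?C * (Beta (1 - \<alpha>) (1 + \<alpha>) * (a - c)) = Gamma (1 - \<alpha>) * ramp a c"
    proof -
      have "\<alpha> \<notin> \<int>\<^sub>\<le>\<^sub>0"
        using \<alpha> by (auto elim!: nonpos_Ints_cases)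
      then have "Gamma (1 + \<alpha>) = \<alpha> * Gamma \<alpha>"
        using Gamma_plus1[of \<alpha>] by (simp add: add.commute)
      then have "Beta (1 - \<alpha>) (1 + \<alpha>) = Gamma (1 - \<alpha>) * (\<alpha> * Gamma \<alpha>)"
        using Gamma_fact[of 1, where ?'a = real] by (simp add: Beta_def)
      moreover have "Gamma \<alpha> \<noteq> 0" using G by linarith
      ultimately show ?thesis using \<alpha> True by (simp add: ramp_def)
    qed
    ultimately show ?thesis using d unfolding weyl_inversion_def by auto
  next
    case False
    then have 0: "indicator {0<..<T} x *\<^sub>R ?W x = 0" for x
      unfolding eq by simp
    have "set_integrable lborel {0<..<T} ?W" "(LBINT x:{0<..<T}. ?W x) = 0"
      unfolding set_integrable_def set_lebesgue_integral_def 0 by simp_all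
    then show ?thesis using d False unfolding weyl_inversion_def by (auto simp: ramp_def)
  qed
qed

text \<open>Each clamp in \<open>lin_interp\<close> is 1 minus a difference quotient of two ramps.
  When the last node value is 0 only ramps remain, and inversion extends to interpolants by
  linearity.\<close>

lemma lin_interp_ramp:
  assumes "h > 0"
  shows "lin_interp n h \<phi> x = \<phi> (real n * h) - (\<Sum>k<n. (\<phi> (real (Suc k) * h) - \<phi> (real k * h)) *
    ((1/h) * ramp (real (Suc k) * h) x + (- 1/h) * ramp (real k * h) x))"
proof -
  define d where "d = (\<lambda>k. \<phi> (real (Suc k) * h) - \<phi> (real k * h))"
  have *: "max 0 (min 1 (x / h - real k)) = 1 - ((1/h) * ramp (real (Suc k) * h) x + (- 1/h) * ramp (real k * h) x)" for k
  proof -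
    consider "x \<le> real k * h" | "real k * h < x" "x < real (Suc k) * h" | "real (Suc k) * h \<le> x" by linarith
    then show ?thesis
    proof cases
      case 1
      then have "x / h \<le> real k" using assms by (simp add: field_simps)
      moreover have "x \<le> real (Suc k) * h" using 1 assms by (simp add: distrib_right)
      ultimately show ?thesis using 1 assms by (simp add: ramp_def field_simps)
    next
      case 2
      then have "real k < x / h" "x / h < real k + 1" using assms by (auto simp: field_simps)
      then show ?thesis using 2 assms by (simp add: ramp_def field_simps)
    next
      case 3
      then have "x / h \<ge> real k + 1" using assms by (simp add: field_simps)
      moreover have "x \<ge> real k * h" using 3 assms by (simp add: distrib_right)
      ultimately show ?thesis using 3 assms by (simp add: ramp_def)
    qed
  qed
  have "lin_interp n h \<phi> x = \<phi> 0 + (\<Sum>k<n. d k * (1 - ((1/h) * ramp (real (Suc k) * h) x + (- 1/h) * ramp (real k * h) x)))"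
    unfolding lin_interp_def * d_def ..
  also have "\<dots> = \<phi> 0 + (\<Sum>k<n. d k) - (\<Sum>k<n. d k * ((1/h) * ramp (real (Suc k) * h) x + (- 1/h) * ramp (real k * h) x))"
    by (simp only: right_diff_distrib sum_subtractf mult_1_right add_diff_eq)
  also have "(\<Sum>k<n. d k) = \<phi> (real n * h) - \<phi> 0"
    unfolding d_def using sum_lessThan_telescope[of "\<lambda>k. \<phi> (real k * h)" n] by simp
  finally show ?thesis unfolding d_def by simp
qed

lemma weyl_inversion_lin_interp:
  assumes "0 < \<alpha>" "\<alpha> < 1" "h > 0" "0 \<le> c" "T = real n * h" "\<phi> T = 0"
  shows "weyl_inversion \<alpha> T c (lin_interp n h \<phi>)"
proof -
  have R: "weyl_inversion \<alpha> T c (ramp (real k * h))" if "k \<le> n" for k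
    using assms that by (intro weyl_inversion_ramp) auto
  have "weyl_inversion \<alpha> T c (\<lambda>x. \<Sum>k<n. - (\<phi> (real (Suc k) * h) - \<phi> (real k * h)) *
    ((1/h) * ramp (real (Suc k) * h) x + (- 1/h) * ramp (real k * h) x))"
    by (intro weyl_inversion_sum weyl_inversion_linear R) auto
  also have "(\<lambda>x. \<Sum>k<n. - (\<phi> (real (Suc k) * h) - \<phi> (real k * h)) *
    ((1/h) * ramp (real (Suc k) * h) x + (- 1/h) * ramp (real k * h) x)) = lin_interp n h \<phi>"
    unfolding lin_interp_ramp[OF assms(3)] using assms(5,6) by (simp only: minus_mult_left[symmetric] sum_negf) simp
  finally show ?thesis .
qed

lemma borel_measurable_lin_interp [measurable]: "lin_interp n h \<phi> \<in> borel_measurable borel"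
  unfolding lin_interp_def by measurable

text \<open>All interpolants share the Hoelder constant \<open>3 * K\<close>. For fixed
  \<open>x\<close> it dominates the singular kernel; it also bounds the derivatives uniformly, so a
  multiple of \<open>power_from\<close> dominates the outer integrand. Dominated convergence is thus
  used twice.\<close>

lemma weyl_inversion_holder:
  assumes \<alpha>: "0 < \<alpha>" "\<alpha> < 1" and T: "T > 0" and \<gamma>: "1 - \<alpha> < \<gamma>" "\<gamma> \<le> 1"
    and h: "holder_with K \<gamma> {0..T} h" "h T = 0" "K \<ge> 0" and [measurable]: "h \<in> borel_measurable borel"
    and c: "c \<in> {0..T}"
  shows "weyl_inversion \<alpha> T c h"
proof -
  define \<tau> where "\<tau> = (\<lambda>n. T / real (Suc n))"
  define H where "H = (\<lambda>n. lin_interp (Suc n) (\<tau> n) h)"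
  let ?\<delta> = "1 - \<alpha>" and ?W = "weyl_right_real (1 - \<alpha>) T"
  have \<tau>: "\<tau> n > 0" "real (Suc n) * \<tau> n = T" for n using T by (auto simp: \<tau>_def)
  have grid: "\<bar>h (real j * \<tau> n) - h (real i * \<tau> n)\<bar> \<le> K * (real j * \<tau> n - real i * \<tau> n) powr \<gamma>"
    if "i < j" "j \<le> Suc n" for i j n
  proof -
    have "real j * \<tau> n \<le> real (Suc n) * \<tau> n" "real i * \<tau> n < real j * \<tau> n"
      using that \<tau>(1)[of n] by (auto simp del: of_nat_Suc)
    then show ?thesis
      using holder_withD[OF h(1), of "real j * \<tau> n" "real i * \<tau> n"] \<tau>[of n] by auto
  qed
  have Hh: "holder_with (3 * K) \<gamma> {0..T} (H n)" for n
    using holder_with_lin_interp[of "\<tau> n" K \<gamma> "Suc n" h] grid h \<gamma> \<alpha> \<tau> unfolding H_def by simp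
  have HT: "H n T = 0" for n
    using lin_interp_grid[of "\<tau> n" "Suc n" "Suc n" h] \<tau> h unfolding H_def by simp
  have Hconv: "(\<lambda>n. H n t) \<longlonglongrightarrow> h t" if t: "t \<in> {0..T}" for t
  proof -
    have "\<bar>H n t - h t\<bar> \<le> (3 * K + K) * \<tau> n powr \<gamma> + 0" for n
      unfolding H_def
      by (rule lin_interp_dist[where n = "Suc n"]) (use \<tau>[of n] Hh[of n] h \<gamma> \<alpha> t in \<open>auto simp: H_def\<close>)
    moreover have "(\<lambda>n. (3 * K + K) * \<tau> n powr \<gamma> + 0) \<longlonglongrightarrow> (3 * K + K) * 0 + 0"
    proof (intro tendsto_intros tendsto_zero_powrI)
      show "\<tau> \<longlonglongrightarrow> 0"
        unfolding \<tau>_def by (intro tendsto_divide_0[OF tendsto_const] filterlim_at_top_imp_at_infinity filterlim_compose[OF filterlim_real_sequentially filterlim_Suc])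
    qed (use \<tau> \<gamma> \<alpha> in \<open>auto simp: less_imp_le\<close>)
    ultimately have "(\<lambda>n. H n t - h t) \<longlonglongrightarrow> 0"
      by (intro Lim_null_comparison[of "\<lambda>n. H n t - h t" "\<lambda>n. (3 * K + K) * \<tau> n powr \<gamma> + 0"]) auto
    then show ?thesis by (simp add: LIM_zero_iff)
  qed
  have Hm [measurable]: "H n \<in> borel_measurable borel" for n unfolding H_def by measurable
  have WH: "(\<lambda>n. ?W (H n) x) \<longlonglongrightarrow> ?W h x" if x: "x \<in> {0<..<T}" for x
  proof -
    have "(\<lambda>n. LBINT y:{x<..<T}. (H n x - H n y) / (y - x) powr (?\<delta> + 1))
       \<longlonglongrightarrow> (LBINT y:{x<..<T}. (h x - h y) / (y - x) powr (?\<delta> + 1))"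
      unfolding set_lebesgue_integral_def
    proof (rule integral_dominated_convergence)
      have b: "\<bar>H n x - H n y\<bar> \<le> 3 * K * (y - x) powr \<gamma>" if "y \<in> {x<..<T}" for n y
        using holder_withD[OF Hh, of x y n] x that by (auto simp: abs_minus_commute)
      note Q = set_integrable_powr_quotient_right[of x T ?\<delta> \<gamma> "\<lambda>y. H n x - H n y" "3 * K" for n]
      show "integrable lborel (\<lambda>y. indicator {x<..<T} y *\<^sub>R (3 * K * (y - x) powr (\<gamma> - ?\<delta> - 1)))"
        using Q(3)[of 0] b x \<gamma> unfolding set_integrable_def by auto
      show "AE y in lborel. norm (indicator {x<..<T} y *\<^sub>R ((H n x - H n y) / (y - x) powr (?\<delta> + 1)))
         \<le> indicator {x<..<T} y *\<^sub>R (3 * K * (y - x) powr (\<gamma> - ?\<delta> - 1))" for n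
        using Q(4)[of n] b x \<gamma> by (intro AE_I2) (auto simp: indicator_def)
      show "AE y in lborel. (\<lambda>n. indicator {x<..<T} y *\<^sub>R ((H n x - H n y) / (y - x) powr (?\<delta> + 1)))
         \<longlonglongrightarrow> indicator {x<..<T} y *\<^sub>R ((h x - h y) / (y - x) powr (?\<delta> + 1))"
      proof (rule AE_I2)
        fix y
        show "(\<lambda>n. indicator {x<..<T} y *\<^sub>R ((H n x - H n y) / (y - x) powr (?\<delta> + 1)))
         \<longlonglongrightarrow> indicator {x<..<T} y *\<^sub>R ((h x - h y) / (y - x) powr (?\<delta> + 1))"
        proof (cases "y \<in> {x<..<T}")
          case True
          then show ?thesis using x by (auto simp: divide_inverse intro!: tendsto_intros Hconv)
        qed simp
      qed
    qed measurable
    then show ?thesis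
      unfolding weyl_right_real_def using x by (auto simp: divide_inverse intro!: tendsto_intros Hconv)
  qed
  define C where "C = 1 / Gamma \<alpha> * (3 * K * (1 + ?\<delta> / (\<gamma> - ?\<delta>)) * T powr (\<gamma> - ?\<delta>))"
  have WB: "\<bar>?W (H n) x\<bar> \<le> C" if "x \<in> {0<..<T}" for n x
    using weyl_right_bound(2)[of ?\<delta> \<gamma> "3 * K" "H n" T x] Hh[of n] HT[of n] \<alpha> \<gamma> h that unfolding C_def by simp
  have Wb: "\<bar>?W h x\<bar> \<le> C" if "x \<in> {0<..<T}" for x
    by (rule LIMSEQ_le_const2[OF tendsto_rabs[OF WH[OF that]]]) (use WB that in auto)
  have P: "set_integrable lborel {0<..<T} (power_from \<alpha> c)"
    using power_from_integral(1)[of c T \<alpha>] c \<alpha> by auto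
  then have PC: "integrable lborel (\<lambda>x. indicator {0<..<T} x *\<^sub>R (power_from \<alpha> c x * C))"
    unfolding set_integrable_def by (simp add: mult.assoc[symmetric])
  have p0: "power_from \<alpha> c x \<ge> 0" for x by (simp add: power_from_def)
  have dom: "norm (indicator {0<..<T} x *\<^sub>R (power_from \<alpha> c x * w)) \<le> indicator {0<..<T} x *\<^sub>R (power_from \<alpha> c x * C)"
    if "x \<in> {0<..<T} \<Longrightarrow> \<bar>w\<bar> \<le> C" for x w
    using that p0[of x] by (auto simp: indicator_def abs_mult intro!: mult_left_mono)
  have "(\<lambda>n. LBINT x:{0<..<T}. power_from \<alpha> c x * ?W (H n) x) \<longlonglongrightarrow>
      (LBINT x:{0<..<T}. power_from \<alpha> c x * ?W h x)"
    unfolding set_lebesgue_integral_def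
  proof (rule integral_dominated_convergence[OF _ _ PC])
    show "AE x in lborel. (\<lambda>n. indicator {0<..<T} x *\<^sub>R (power_from \<alpha> c x * ?W (H n) x))
       \<longlonglongrightarrow> indicator {0<..<T} x *\<^sub>R (power_from \<alpha> c x * ?W h x)"
    proof (rule AE_I2)
      fix x
      show "(\<lambda>n. indicator {0<..<T} x *\<^sub>R (power_from \<alpha> c x * ?W (H n) x))
       \<longlonglongrightarrow> indicator {0<..<T} x *\<^sub>R (power_from \<alpha> c x * ?W h x)"
        by (cases "x \<in> {0<..<T}") (auto intro!: tendsto_intros WH)
    qed
    show "AE x in lborel. norm (indicator {0<..<T} x *\<^sub>R (power_from \<alpha> c x * ?W (H n) x))
       \<le> indicator {0<..<T} x *\<^sub>R (power_from \<alpha> c x * C)" for n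
      by (intro AE_I2 dom WB)
  qed measurable
  moreover have "(LBINT x:{0<..<T}. power_from \<alpha> c x * ?W (H n) x) = Gamma (1 - \<alpha>) * H n c" for n
    using weyl_inversion_lin_interp[of \<alpha> "\<tau> n" c T "Suc n" h] \<alpha> \<tau>[of n] c h
    unfolding H_def weyl_inversion_def by auto
  moreover have "(\<lambda>n. Gamma (1 - \<alpha>) * H n c) \<longlonglongrightarrow> Gamma (1 - \<alpha>) * h c"
    using c by (intro tendsto_intros Hconv)
  ultimately have "(LBINT x:{0<..<T}. power_from \<alpha> c x * ?W h x) = Gamma (1 - \<alpha>) * h c"
    using LIMSEQ_unique by simp
  moreover have "set_integrable lborel {0<..<T} (\<lambda>x. power_from \<alpha> c x * ?W h x)"
    unfolding set_integrable_def
    by (rule Bochner_Integration.integrable_bound[OF PC])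
       (auto intro!: AE_I2 order_trans[OF dom[OF Wb] abs_ge_self, simplified])
  moreover have "weyl_right_defined (1 - \<alpha>) T h x" if "x \<in> {0<..<T}" for x
    using weyl_right_bound(1)[of ?\<delta> \<gamma> K h T x] h \<alpha> \<gamma> that by simp
  ultimately show ?thesis unfolding weyl_inversion_def by blast
qed

section \<open>Integration against a fixed Hoelder path\<close>

locale holder_integrator =
  fixes \<alpha> T \<gamma> K :: real and g :: "real \<Rightarrow> real"
  assumes \<alpha>: "0 < \<alpha>" "\<alpha> < 1" and T: "T > 0" and \<gamma>: "1 - \<alpha> < \<gamma>" "\<gamma> \<le> 1"
    and g: "holder_with K \<gamma> {0..T} g"
begin

lemma K_nonneg: "K \<ge> 0"
  by (rule holder_with_const_nonneg[OF g T])

lemma left_limit: "(g \<longlongrightarrow> g T) (at_left T)"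
proof -
  have "continuous_on {0..T} g"
    using holder_with_imp_continuous_on[OF g] \<gamma> \<alpha> by simp
  then have "(g \<longlongrightarrow> g T) (at T within {0..T})"
    using T by (auto simp: continuous_on_def)
  then show ?thesis using T by (simp add: at_within_Icc_at_left)
qed

text \<open>Freezing \<open>g\<close> outside [0,T] gives a Borel function on the line, as the
  measurability of the parameter integrals requires; on [0,T] it equals
  \<open>left_limit_shift T g\<close>.\<close>

definition shifted :: "real \<Rightarrow> real" where
  "shifted x = g (max 0 (min T x)) - g T"

definition V :: "real \<Rightarrow> real" where
  "V = weyl_right_real (1 - \<alpha>) T shifted"

definition M :: real where
  "M = 1 / Gamma (1 - (1 - \<alpha>)) * (K * (1 + (1 - \<alpha>) / (\<gamma> - (1 - \<alpha>))) * T powr (\<gamma> - (1 - \<alpha>)))"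

lemma borel_measurable_shifted [measurable]: "shifted \<in> borel_measurable borel"
proof -
  have "continuous_on UNIV (\<lambda>x. g (max 0 (min T x)))"
    using T by (intro continuous_on_compose2[OF holder_with_imp_continuous_on[OF g]] continuous_intros)
      (use \<gamma> \<alpha> in auto)
  from borel_measurable_continuous_onI[OF this] show ?thesis
    unfolding shifted_def by measurable
qed

lemma shifted_holder: "holder_with K \<gamma> {0..T} shifted" "shifted T = 0"
  using g T by (auto simp: holder_with_def shifted_def)

lemma borel_measurable_V [measurable]: "V \<in> borel_measurable borel"
  unfolding V_def by measurable

lemma shifted_eq: "x \<in> {0..T} \<Longrightarrow> left_limit_shift T g x = shifted x"
  using tendsto_Lim[OF _ left_limit] by (simp add: left_limit_shift_def shifted_def)

lemma right_eq:
  assumes "x \<in> {0<..<T}"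
  shows "weyl_right_defined (1 - \<alpha>) T (left_limit_shift T g) x"
    "weyl_right_real (1 - \<alpha>) T (left_limit_shift T g) x = V x" "\<bar>V x\<bar> \<le> M"
proof -
  have c: "weyl_right_defined (1 - \<alpha>) T (left_limit_shift T g) x \<longleftrightarrow> weyl_right_defined (1 - \<alpha>) T shifted x"
    "weyl_right_real (1 - \<alpha>) T (left_limit_shift T g) x = weyl_right_real (1 - \<alpha>) T shifted x"
    using weyl_right_cong[of x T "left_limit_shift T g" shifted "1 - \<alpha>"] assms shifted_eq by auto
  have b: "weyl_right_defined (1 - \<alpha>) T shifted x" "\<bar>weyl_right_real (1 - \<alpha>) T shifted x\<bar> \<le> M"
    unfolding M_def
    using weyl_right_bound[of "1 - \<alpha>" \<gamma> K shifted T x] shifted_holder assms \<alpha> \<gamma> K_nonneg by auto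
  show "weyl_right_defined (1 - \<alpha>) T (left_limit_shift T g) x"
    "weyl_right_real (1 - \<alpha>) T (left_limit_shift T g) x = V x" "\<bar>V x\<bar> \<le> M"
    using b c by (auto simp: V_def)
qed

lemma M_nonneg: "M \<ge> 0"
  using right_eq(3)[of "T / 2"] T by auto

text \<open>The conditions of \<open>gls_integrable\<close> on the integrand; those on
  \<open>g\<close> hold once and for all. Borel measurability on the line is added to make the
  derivatives measurable.\<close>

definition weyl_integrable :: "(real \<Rightarrow> real) \<Rightarrow> bool" where
  "weyl_integrable f \<longleftrightarrow> f \<in> borel_measurable borel \<and> (AE x\<in>{0<..<T} in lborel. weyl_left_defined \<alpha> 0 f x) \<and>
     set_integrable lborel {0<..<T} (weyl_left \<alpha> 0 f)"

lemma weyl_integrable_imp_integrable: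
  assumes "weyl_integrable f"
  shows "gls_integrable \<alpha> 0 T f g"
proof -
  have eq: "indicator {0<..<T} x *\<^sub>R weyl_right (1 - \<alpha>) T (left_limit_shift T g) x =
     indicator {0<..<T} x *\<^sub>R ((-1) powr complex_of_real (1 - \<alpha>) * complex_of_real (V x))" for x
    using right_eq(2)[of x] by (auto simp: indicator_def weyl_right_eq_real)
  have "set_borel_measurable lborel {0<..<T} (weyl_right (1 - \<alpha>) T (left_limit_shift T g))"
    unfolding set_borel_measurable_def eq by measurable
  moreover have "cmod (weyl_right (1 - \<alpha>) T (left_limit_shift T g) x) \<le> cmod ((-1) powr complex_of_real (1 - \<alpha>)) * M"
    if "x \<in> {0<..<T}" for x
    using right_eq(2,3)[OF that] by (auto simp: weyl_right_eq_real norm_mult intro!: mult_left_mono)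
  ultimately show ?thesis
    using assms left_limit right_eq(1) unfolding gls_integrable_def weyl_integrable_def by blast
qed

lemma integral_eq:
  "gls_integral \<alpha> 0 T f g = - (LBINT x:{0<..<T}. weyl_left \<alpha> 0 f x * V x)"
proof -
  have eq: "indicator {0<..<T} x *\<^sub>R (weyl_left \<alpha> 0 f x * weyl_right_real (1 - \<alpha>) T (left_limit_shift T g) x) =
     indicator {0<..<T} x *\<^sub>R (weyl_left \<alpha> 0 f x * V x)" for x
    using right_eq(2)[of x] by (auto simp: indicator_def)
  show ?thesis
    unfolding gls_integral_eq_real set_lebesgue_integral_def eq ..
qed

lemma integrable_mult_V:
  assumes D: "set_integrable lborel {0<..<T} D" and [measurable]: "D \<in> borel_measurable borel"
  shows "set_integrable lborel {0<..<T} (\<lambda>x. D x * V x)"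
proof -
  have "set_integrable lborel {0<..<T} (\<lambda>x. M * D x)"
    using D by (rule set_integrable_mult_right)
  then show ?thesis
  proof (rule set_integrable_bound)
    show "set_borel_measurable lborel {0<..<T} (\<lambda>x. D x * V x)"
      unfolding set_borel_measurable_def by measurable
    have "\<bar>D x * V x\<bar> \<le> \<bar>M * D x\<bar>" if "x \<in> {0<..<T}" for x
      using right_eq(3)[OF that] M_nonneg by (simp add: abs_mult mult.commute[of M] mult_left_mono)
    then show "AE x in lborel. x \<in> {0<..<T} \<longrightarrow> norm (D x * V x) \<le> norm (M * D x)"
      by (intro AE_I2) auto
  qed
qed

text \<open>Cut-offs to adjacent intervals both miss the common endpoint, so their sum is the
  cut-off to the union only up to a null set.\<close>

lemma weyl_integrable_cong_AE:
  assumes f: "weyl_integrable f" and [measurable]: "f' \<in> borel_measurable borel" and "AE x in lborel. f x = f' x"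
  shows "weyl_integrable f'" "gls_integral \<alpha> 0 T f' g = gls_integral \<alpha> 0 T f g"
proof -
  have [measurable]: "f \<in> borel_measurable borel" using f by (simp add: weyl_integrable_def)
  have *: "AE x in lborel. (weyl_left_defined \<alpha> 0 f x \<longleftrightarrow> weyl_left_defined \<alpha> 0 f' x) \<and>
     weyl_left \<alpha> 0 f x = weyl_left \<alpha> 0 f' x"
    using assms(3) by eventually_elim (use weyl_left_cong_AE[of f f'] assms(3) in auto)
  have "AE x\<in>{0<..<T} in lborel. weyl_left_defined \<alpha> 0 f x"
    using f by (simp add: weyl_integrable_def)
  with * have 1: "AE x\<in>{0<..<T} in lborel. weyl_left_defined \<alpha> 0 f' x"
    by eventually_elim auto
  have 2: "set_integrable lborel {0<..<T} (weyl_left \<alpha> 0 f')"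
  proof -
    have "integrable lborel (\<lambda>x. indicator {0<..<T} x *\<^sub>R weyl_left \<alpha> 0 f x)"
      using f by (simp add: weyl_integrable_def set_integrable_def)
    then have "integrable lborel (\<lambda>x. indicator {0<..<T} x *\<^sub>R weyl_left \<alpha> 0 f' x)"
    proof (rule integrable_cong_AE_imp)
      show "AE x in lborel. indicator {0<..<T} x *\<^sub>R weyl_left \<alpha> 0 f x = indicator {0<..<T} x *\<^sub>R weyl_left \<alpha> 0 f' x"
        using * by eventually_elim simp
    qed measurable
    then show ?thesis by (simp add: set_integrable_def)
  qed
  show "weyl_integrable f'" unfolding weyl_integrable_def using 1 2 by simp
  have "AE x in lborel. indicator {0<..<T} x *\<^sub>R (weyl_left \<alpha> 0 f' x * V x) =
      indicator {0<..<T} x *\<^sub>R (weyl_left \<alpha> 0 f x * V x)"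
    using * by eventually_elim simp
  then show "gls_integral \<alpha> 0 T f' g = gls_integral \<alpha> 0 T f g"
    unfolding integral_eq set_lebesgue_integral_def
    by (intro arg_cong[where f = uminus] integral_cong_AE) measurable
qed

lemma weyl_integrable_linear:
  assumes f: "weyl_integrable f" and f': "weyl_integrable f'"
  shows "weyl_integrable (\<lambda>x. u * f x + v * f' x)"
    "gls_integral \<alpha> 0 T (\<lambda>x. u * f x + v * f' x) g = u * gls_integral \<alpha> 0 T f g + v * gls_integral \<alpha> 0 T f' g"
proof -
  let ?h = "\<lambda>x. u * f x + v * f' x"
  have [measurable]: "f \<in> borel_measurable borel" "f' \<in> borel_measurable borel"
    using f f' by (auto simp: weyl_integrable_def)
  have "AE x in lborel. x \<in> {0<..<T} \<longrightarrow> weyl_left_defined \<alpha> 0 f x"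
    "AE x in lborel. x \<in> {0<..<T} \<longrightarrow> weyl_left_defined \<alpha> 0 f' x"
    using f f' by (auto simp: weyl_integrable_def)
  then have *: "AE x in lborel. x \<in> {0<..<T} \<longrightarrow> weyl_left_defined \<alpha> 0 ?h x \<and>
     weyl_left \<alpha> 0 ?h x = u * weyl_left \<alpha> 0 f x + v * weyl_left \<alpha> 0 f' x"
    by eventually_elim (use weyl_left_linear[of \<alpha> 0 f _ f' u v] in auto)
  have i: "set_integrable lborel {0<..<T} (\<lambda>x. u * weyl_left \<alpha> 0 f x)" "set_integrable lborel {0<..<T} (\<lambda>x. v * weyl_left \<alpha> 0 f' x)"
    using f f' unfolding weyl_integrable_def by - (rule set_integrable_mult_right, blast)+
  have "integrable lborel (\<lambda>x. indicator {0<..<T} x *\<^sub>R (u * weyl_left \<alpha> 0 f x + v * weyl_left \<alpha> 0 f' x))"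
    using set_integral_add(1)[OF i] by (simp add: set_integrable_def)
  then have "set_integrable lborel {0<..<T} (weyl_left \<alpha> 0 ?h)"
    unfolding set_integrable_def
  proof (rule integrable_cong_AE_imp)
    show "AE x in lborel. indicator {0<..<T} x *\<^sub>R (u * weyl_left \<alpha> 0 f x + v * weyl_left \<alpha> 0 f' x) =
        indicator {0<..<T} x *\<^sub>R weyl_left \<alpha> 0 ?h x"
      using * by eventually_elim (auto simp: indicator_def)
  qed measurable
  moreover have "AE x in lborel. x \<in> {0<..<T} \<longrightarrow> weyl_left_defined \<alpha> 0 ?h x"
    using * by eventually_elim auto
  ultimately show "weyl_integrable ?h" unfolding weyl_integrable_def by simp
  have j: "set_integrable lborel {0<..<T} (\<lambda>x. u * (weyl_left \<alpha> 0 f x * V x))"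
     "set_integrable lborel {0<..<T} (\<lambda>x. v * (weyl_left \<alpha> 0 f' x * V x))"
    using f f' integrable_mult_V unfolding weyl_integrable_def by - (rule set_integrable_mult_right, simp)+
  have "AE x in lborel. indicator {0<..<T} x *\<^sub>R (weyl_left \<alpha> 0 ?h x * V x) =
      indicator {0<..<T} x *\<^sub>R (u * (weyl_left \<alpha> 0 f x * V x) + v * (weyl_left \<alpha> 0 f' x * V x))"
    using * by eventually_elim (auto simp: indicator_def algebra_simps)
  then have "(LBINT x:{0<..<T}. weyl_left \<alpha> 0 ?h x * V x) =
     (LBINT x:{0<..<T}. u * (weyl_left \<alpha> 0 f x * V x) + v * (weyl_left \<alpha> 0 f' x * V x))"
    unfolding set_lebesgue_integral_def by (intro integral_cong_AE) measurable
  also have "\<dots> = u * (LBINT x:{0<..<T}. weyl_left \<alpha> 0 f x * V x) + v * (LBINT x:{0<..<T}. weyl_left \<alpha> 0 f' x * V x)"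
    by (subst set_integral_add(2)[OF j]) (simp only: set_integral_mult_right)
  finally show "gls_integral \<alpha> 0 T ?h g = u * gls_integral \<alpha> 0 T f g + v * gls_integral \<alpha> 0 T f' g"
    unfolding integral_eq by simp
qed

text \<open>The derivative is a difference of two \<open>power_from\<close> terms, and inversion
  recovers \<open>shifted\<close> at \<open>c\<close> and at \<open>d\<close>. The sign in
  \<open>integral_eq\<close> turns g c - g d into the increment.\<close>

lemma weyl_integrable_indicator:
  assumes cd: "0 \<le> c" "c \<le> d" "d \<le> T"
  shows "weyl_integrable (cutoff c d (\<lambda>_. 1))" "gls_integral \<alpha> 0 T (cutoff c d (\<lambda>_. 1)) g = g d - g c"
proof -
  let ?F = "cutoff c d (\<lambda>_. 1)" and ?G = "Gamma (1 - \<alpha>)"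
  have G: "?G > 0" using \<alpha> by (intro Gamma_real_pos) simp
  have *: "AE x in lborel. weyl_left_defined \<alpha> 0 ?F x \<and>
    weyl_left \<alpha> 0 ?F x = (power_from \<alpha> c x - power_from \<alpha> d x) / ?G"
  proof (cases "c = d")
    case True
    then show ?thesis
      by (simp add: weyl_left_defined_def weyl_left_def set_integrable_def set_lebesgue_integral_def)
  next
    case False
    then show ?thesis
      using AE_lborel_singleton[of d] weyl_left_indicator[of c d \<alpha>] cd \<alpha>
      by (auto elim!: eventually_mono)
  qed
  have pi: "set_integrable lborel {0<..<T} (power_from \<alpha> c)" "set_integrable lborel {0<..<T} (power_from \<alpha> d)"
    using power_from_integral(1) cd \<alpha> by auto
  have "set_integrable lborel {0<..<T} (\<lambda>x. (power_from \<alpha> c x - power_from \<alpha> d x) / ?G)"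
    by (rule set_integrable_divide) (intro set_integral_diff pi)
  then have "set_integrable lborel {0<..<T} (weyl_left \<alpha> 0 ?F)"
    unfolding set_integrable_def
  proof (rule integrable_cong_AE_imp)
    show "AE x in lborel. indicator {0<..<T} x *\<^sub>R ((power_from \<alpha> c x - power_from \<alpha> d x) / ?G) =
        indicator {0<..<T} x *\<^sub>R weyl_left \<alpha> 0 ?F x"
      using * by eventually_elim (auto simp: indicator_def)
  qed measurable
  moreover have "AE x in lborel. x \<in> {0<..<T} \<longrightarrow> weyl_left_defined \<alpha> 0 ?F x"
    using * by eventually_elim auto
  ultimately show "weyl_integrable ?F" unfolding weyl_integrable_def by simp
  have inv: "weyl_inversion \<alpha> T c shifted" "weyl_inversion \<alpha> T d shifted"
    using weyl_inversion_holder[OF \<alpha> T \<gamma> shifted_holder K_nonneg] cd by auto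
  then have i: "set_integrable lborel {0<..<T} (\<lambda>x. 1 / ?G * (power_from \<alpha> c x * V x))"
    "set_integrable lborel {0<..<T} (\<lambda>x. 1 / ?G * (power_from \<alpha> d x * V x))"
    unfolding weyl_inversion_def V_def by - (rule set_integrable_mult_right, blast)+
  have "AE x in lborel. indicator {0<..<T} x *\<^sub>R (weyl_left \<alpha> 0 ?F x * V x) =
     indicator {0<..<T} x *\<^sub>R (1 / ?G * (power_from \<alpha> c x * V x) - 1 / ?G * (power_from \<alpha> d x * V x))"
    using *
  proof eventually_elim
    case (elim x)
    have "(p - q) / G * v = 1 / G * (p * v) - 1 / G * (q * v)" for p q G v :: real
      by (simp add: left_diff_distrib diff_divide_distrib)
    then show ?case unfolding conjunct2[OF elim] by simp
  qed
  then have "(LBINT x:{0<..<T}. weyl_left \<alpha> 0 ?F x * V x) =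
     (LBINT x:{0<..<T}. 1 / ?G * (power_from \<alpha> c x * V x) - 1 / ?G * (power_from \<alpha> d x * V x))"
    unfolding set_lebesgue_integral_def by (intro integral_cong_AE) measurable
  also have "\<dots> = 1 / ?G * (?G * shifted c) - 1 / ?G * (?G * shifted d)"
    using inv unfolding weyl_inversion_def V_def[symmetric]
    by (subst set_integral_diff(2)[OF i]) (simp only: set_integral_mult_right)
  also have "\<dots> = g c - g d"
    using G cd by (simp add: shifted_def)
  finally show "gls_integral \<alpha> 0 T ?F g = g d - g c"
    unfolding integral_eq by simp
qed

text \<open>The first summand is the interior part of the derivative, integrated from (x - s)^(\<mu>
  - \<alpha>); the second is the tail beyond \<open>t\<close>.\<close>

definition local_const :: "real \<Rightarrow> real" where
  "local_const \<mu> = M / Gamma (1 - \<alpha>) * ((1 + \<alpha> / (\<mu> - \<alpha>)) / (\<mu> - \<alpha> + 1) + 1 / (1 - \<alpha>))"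

lemma local_const_nonneg: "\<alpha> < \<mu> \<Longrightarrow> local_const \<mu> \<ge> 0"
  unfolding local_const_def using M_nonneg \<alpha> by (simp add: Gamma_real_pos less_imp_le)

text \<open>The exponent \<open>1 + \<mu> - \<alpha>\<close> exceeds 1, so these remainders sum to
  something that vanishes along refining partitions.\<close>

lemma weyl_integrable_cutoff_small:
  assumes st: "0 \<le> s" "s < t" "t \<le> T" and \<mu>: "\<alpha> < \<mu>" and F: "F \<ge> 0"
    and \<phi>m [measurable]: "\<phi> \<in> borel_measurable borel"
    and b: "\<And>y. y \<in> {s<..<t} \<Longrightarrow> \<bar>\<phi> y\<bar> \<le> F * (y - s) powr \<mu>"
    and l: "\<And>x y. y \<in> {s<..<t} \<Longrightarrow> x \<in> {s<..<t} \<Longrightarrow> \<bar>\<phi> x - \<phi> y\<bar> \<le> F * \<bar>x - y\<bar> powr \<mu>"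
  shows "weyl_integrable (cutoff s t \<phi>)"
    "\<bar>gls_integral \<alpha> 0 T (cutoff s t \<phi>) g\<bar> \<le> local_const \<mu> * F * (t - s) powr (1 + \<mu> - \<alpha>)"
proof -
  let ?D = "weyl_left \<alpha> 0 (cutoff s t \<phi>)" and ?G = "Gamma (1 - \<alpha>)"
  have G: "?G > 0" using \<alpha> by (intro Gamma_real_pos) simp
  define A where "A = (\<lambda>x. indicator {s<..<t} x * (x - s) powr (\<mu> - \<alpha>))"
  \<comment> \<open>The tail difference is wanted only beyond \<open>t\<close>; adding
    \<open>P\<close> cancels its part before \<open>t\<close>, so that all integrals run over the
    whole of (0,T).\<close>
  define P where "P = (\<lambda>x. indicator {..<t} x * power_from \<alpha> s x)"
  define Bd where "Bd = (\<lambda>x. F / ?G * ((1 + \<alpha> / (\<mu> - \<alpha>)) * A x + (t - s) powr \<mu> * (power_from \<alpha> t x - power_from \<alpha> s x + P x)))"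
  note C = weyl_left_cutoff_bounds[OF st(1,2) \<alpha> \<mu> F \<phi>m b l]
  have *: "AE x in lborel. weyl_left_defined \<alpha> 0 (cutoff s t \<phi>) x \<and> \<bar>?D x\<bar> \<le> Bd x"
    using AE_lborel_singleton[of t]
  proof eventually_elim
    case (elim x)
    have "indicator {t<..} x * (power_from \<alpha> t x - power_from \<alpha> s x) = power_from \<alpha> t x - power_from \<alpha> s x + P x"
      using elim by (auto simp: P_def power_from_def indicator_def)
    then show ?case
      using C[OF _ _ _ elim] unfolding Bd_def A_def by simp
  qed
  have Aeq: "indicator {0<..<T} x *\<^sub>R A x = indicator {s<..<t} x *\<^sub>R ((x - s) powr (\<mu> - \<alpha>))" for x
    using st by (auto simp: A_def indicator_def)
  have Ai: "set_integrable lborel {0<..<T} A" "(LBINT x:{0<..<T}. A x) = (t - s) powr (\<mu> - \<alpha> + 1) / (\<mu> - \<alpha> + 1)"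
    unfolding set_integrable_def set_lebesgue_integral_def Aeq
    using power_integral_at_right[of s t "\<mu> - \<alpha>"] st \<mu> by (auto simp: set_integrable_def set_lebesgue_integral_def)
  have Peq: "indicator {0<..<T} x *\<^sub>R P x = indicator {s<..<t} x *\<^sub>R ((x - s) powr -\<alpha>)" for x
    using st by (auto simp: P_def power_from_def indicator_def)
  have Pi: "set_integrable lborel {0<..<T} P" "(LBINT x:{0<..<T}. P x) = (t - s) powr (1 - \<alpha>) / (1 - \<alpha>)"
    unfolding set_integrable_def set_lebesgue_integral_def Peq
    using power_integral_at_right[of s t "- \<alpha>"] st \<alpha> by (auto simp: set_integrable_def set_lebesgue_integral_def)
  have pi: "set_integrable lborel {0<..<T} (power_from \<alpha> t)" "set_integrable lborel {0<..<T} (power_from \<alpha> s)"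
    "(LBINT x:{0<..<T}. power_from \<alpha> t x) = (T - t) powr (1 - \<alpha>) / (1 - \<alpha>)"
    "(LBINT x:{0<..<T}. power_from \<alpha> s x) = (T - s) powr (1 - \<alpha>) / (1 - \<alpha>)"
    using power_from_integral st \<alpha> by auto
  have i1: "set_integrable lborel {0<..<T} (\<lambda>x. power_from \<alpha> t x - power_from \<alpha> s x)"
    by (intro set_integral_diff pi)
  have i2: "set_integrable lborel {0<..<T} (\<lambda>x. (1 + \<alpha> / (\<mu> - \<alpha>)) * A x)"
    "set_integrable lborel {0<..<T} (\<lambda>x. (t - s) powr \<mu> * (power_from \<alpha> t x - power_from \<alpha> s x + P x))"
    by (intro set_integrable_mult_right set_integral_add Ai i1 Pi)+
  have Bdi: "set_integrable lborel {0<..<T} Bd"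
    unfolding Bd_def by (intro set_integrable_mult_right set_integral_add i2)
  have "(LBINT x:{0<..<T}. Bd x) = F / ?G * ((1 + \<alpha> / (\<mu> - \<alpha>)) * ((t - s) powr (\<mu> - \<alpha> + 1) / (\<mu> - \<alpha> + 1)) +
      (t - s) powr \<mu> * ((T - t) powr (1 - \<alpha>) / (1 - \<alpha>) - (T - s) powr (1 - \<alpha>) / (1 - \<alpha>) + (t - s) powr (1 - \<alpha>) / (1 - \<alpha>)))"
    unfolding Bd_def set_integral_mult_right set_integral_add(2)[OF i2]
      set_integral_add(2)[OF i1 Pi(1)] set_integral_diff(2)[OF pi(1,2)] Ai(2) Pi(2) pi(3,4) ..
  also have "\<dots> \<le> F / ?G * ((1 + \<alpha> / (\<mu> - \<alpha>)) * ((t - s) powr (\<mu> - \<alpha> + 1) / (\<mu> - \<alpha> + 1)) +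
      (t - s) powr \<mu> * ((t - s) powr (1 - \<alpha>) / (1 - \<alpha>)))"
  proof -
    \<comment> \<open>The contributions at the far end T have a nonpositive difference, so only (t -
      s)^(1 - \<alpha>) survives.\<close>
    have "(T - t) powr (1 - \<alpha>) / (1 - \<alpha>) \<le> (T - s) powr (1 - \<alpha>) / (1 - \<alpha>)"
      using st \<alpha> by (intro divide_right_mono powr_mono2) auto
    then show ?thesis using F G by (intro mult_left_mono add_left_mono) auto
  qed
  also have "\<dots> = F / ?G * ((1 + \<alpha> / (\<mu> - \<alpha>)) / (\<mu> - \<alpha> + 1) + 1 / (1 - \<alpha>)) * (t - s) powr (1 + \<mu> - \<alpha>)"
  proof -
    have "(t - s) powr \<mu> * (t - s) powr (1 - \<alpha>) = (t - s) powr (1 + \<mu> - \<alpha>)"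
      by (simp add: powr_add[symmetric] algebra_simps)
    then have 1: "(t - s) powr \<mu> * ((t - s) powr (1 - \<alpha>) / (1 - \<alpha>)) = 1 / (1 - \<alpha>) * (t - s) powr (1 + \<mu> - \<alpha>)"
      by (simp only: times_divide_eq_right) simp
    have 2: "\<mu> - \<alpha> + 1 = 1 + \<mu> - \<alpha>" by simp
    show ?thesis unfolding 1 2 by (simp add: distrib_right)
  qed
  finally have Bdle: "(LBINT x:{0<..<T}. Bd x) \<le> F / ?G * ((1 + \<alpha> / (\<mu> - \<alpha>)) / (\<mu> - \<alpha> + 1) + 1 / (1 - \<alpha>)) * (t - s) powr (1 + \<mu> - \<alpha>)" .
  have Di: "set_integrable lborel {0<..<T} ?D"
  proof (rule set_integrable_bound[OF Bdi])
    show "set_borel_measurable lborel {0<..<T} ?D" unfolding set_borel_measurable_def by measurable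
    show "AE x in lborel. x \<in> {0<..<T} \<longrightarrow> norm (?D x) \<le> norm (Bd x)"
      using * by eventually_elim auto
  qed
  moreover have "AE x in lborel. x \<in> {0<..<T} \<longrightarrow> weyl_left_defined \<alpha> 0 (cutoff s t \<phi>) x"
    using * by eventually_elim auto
  ultimately show "weyl_integrable (cutoff s t \<phi>)" unfolding weyl_integrable_def by simp
  have DV: "set_integrable lborel {0<..<T} (\<lambda>x. ?D x * V x)"
    by (rule integrable_mult_V[OF Di]) measurable
  have "\<bar>gls_integral \<alpha> 0 T (cutoff s t \<phi>) g\<bar> \<le> (LBINT x:{0<..<T}. \<bar>?D x * V x\<bar>)"
    unfolding integral_eq using set_integral_norm_bound[OF DV] by simp
  also have "\<dots> \<le> (LBINT x:{0<..<T}. M * Bd x)"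
    unfolding set_lebesgue_integral_def
  proof (rule integral_mono_AE)
    show "integrable lborel (\<lambda>x. indicator {0<..<T} x *\<^sub>R \<bar>?D x * V x\<bar>)"
      using set_integrable_abs[OF DV] by (simp add: set_integrable_def)
    show "integrable lborel (\<lambda>x. indicator {0<..<T} x *\<^sub>R (M * Bd x))"
      using Bdi set_integrable_mult_right[of M lborel "{0<..<T}" Bd] by (simp add: set_integrable_def)
    show "AE x in lborel. indicator {0<..<T} x *\<^sub>R \<bar>?D x * V x\<bar> \<le> indicator {0<..<T} x *\<^sub>R (M * Bd x)"
      using *
    proof eventually_elim
      case (elim x)
      have "\<bar>?D x * V x\<bar> \<le> M * Bd x" if "x \<in> {0<..<T}"
        unfolding abs_mult mult.commute[of "\<bar>?D x\<bar>"]
        using elim right_eq(3)[OF that] M_nonneg by (intro mult_mono) auto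
      then show ?case by (auto simp: indicator_def)
    qed
  qed
  also have "\<dots> = M * (LBINT x:{0<..<T}. Bd x)"
    by (rule set_integral_mult_right)
  also have "\<dots> \<le> M * (F / ?G * ((1 + \<alpha> / (\<mu> - \<alpha>)) / (\<mu> - \<alpha> + 1) + 1 / (1 - \<alpha>)) * (t - s) powr (1 + \<mu> - \<alpha>))"
    using Bdle M_nonneg by (intro mult_left_mono)
  also have "\<dots> = local_const \<mu> * F * (t - s) powr (1 + \<mu> - \<alpha>)"
    by (simp add: local_const_def)
  finally show "\<bar>gls_integral \<alpha> 0 T (cutoff s t \<phi>) g\<bar> \<le> local_const \<mu> * F * (t - s) powr (1 + \<mu> - \<alpha>)" .
qed

text \<open>The restriction to \<open>[0,T]\<close> is extended by constants because only its values inside the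
  interval matter, while \<^const>\<open>weyl_integrable\<close> asks for a Borel function on the whole line.\<close>

lemma holder_gls_integral_on:
  assumes f: "holder_with F \<mu> {0..T} f" and \<mu>: "\<alpha> < \<mu>" and st: "0 \<le> s" "s \<le> t" "t \<le> T"
  shows "gls_integrable_on \<alpha> 0 T s t f g"
    "\<bar>gls_integral_on \<alpha> 0 T s t f g - f s * (g t - g s)\<bar> \<le> local_const \<mu> * F * (t - s) powr (1 + \<mu> - \<alpha>)"
    "weyl_integrable (cutoff s t f)"
proof -
  have F: "F \<ge> 0" by (rule holder_with_const_nonneg[OF f T])
  let ?f = "\<lambda>x. f (max 0 (min T x))"
  have "continuous_on UNIV ?f"
    using T by (intro continuous_on_compose2[OF holder_with_imp_continuous_on[OF f]] continuous_intros)
      (use \<mu> \<alpha> in auto)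
  from borel_measurable_continuous_onI[OF this] have fm [measurable]: "?f \<in> borel_measurable borel" .
  have 1: "weyl_integrable (cutoff s t f) \<and>
    \<bar>gls_integral \<alpha> 0 T (cutoff s t f) g - f s * (g t - g s)\<bar> \<le> local_const \<mu> * F * (t - s) powr (1 + \<mu> - \<alpha>)"
  proof (cases "s = t")
    case True
    have z: "cutoff s t f = (\<lambda>x. 0 * cutoff s t (\<lambda>_. 1) x + 0 * cutoff s t (\<lambda>_. 1) x)"
      using True by (auto simp: fun_eq_iff)
    have i: "weyl_integrable (cutoff s t (\<lambda>_. 1))" using weyl_integrable_indicator st by blast
    show ?thesis
      unfolding z using weyl_integrable_linear[OF i i, of 0 0] True by simp
  next
    case False
    then have lt: "s < t" using st by simp
    let ?\<phi> = "\<lambda>x. ?f x - f s"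
    have in_T: "y \<in> {0..T} \<and> max 0 (min T y) = y" if "y \<in> {s<..<t}" for y
      using that st by auto
    have S: "weyl_integrable (cutoff s t ?\<phi>)"
      "\<bar>gls_integral \<alpha> 0 T (cutoff s t ?\<phi>) g\<bar> \<le> local_const \<mu> * F * (t - s) powr (1 + \<mu> - \<alpha>)"
    proof -
      have b: "\<bar>?\<phi> y\<bar> \<le> F * (y - s) powr \<mu>" if "y \<in> {s<..<t}" for y
        using holder_withD[OF f, of y s] in_T[OF that] that st by auto
      have l: "\<bar>?\<phi> x - ?\<phi> y\<bar> \<le> F * \<bar>x - y\<bar> powr \<mu>" if "y \<in> {s<..<t}" "x \<in> {s<..<t}" for x y
        using holder_withD[OF f, of x y] in_T[of x] in_T[of y] that by auto
      have m: "?\<phi> \<in> borel_measurable borel" by measurable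
      show "weyl_integrable (cutoff s t ?\<phi>)"
        "\<bar>gls_integral \<alpha> 0 T (cutoff s t ?\<phi>) g\<bar> \<le> local_const \<mu> * F * (t - s) powr (1 + \<mu> - \<alpha>)"
        by (rule weyl_integrable_cutoff_small[OF st(1) lt st(3) \<mu> F m b l]; assumption)+
    qed
    \<comment> \<open>Freezing at the left endpoint: the constant part integrates to the Riemann
      summand, and the rest vanishes at \<open>s\<close> as the small-interval bound
      requires.\<close>
    have z: "cutoff s t f = (\<lambda>x. f s * cutoff s t (\<lambda>_. 1) x + 1 * cutoff s t ?\<phi> x)"
    proof
      fix x show "cutoff s t f x = f s * cutoff s t (\<lambda>_. 1) x + 1 * cutoff s t ?\<phi> x"
        using in_T[of x] by (cases "x \<in> {s<..<t}") (auto simp del: greaterThanLessThan_iff)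
    qed
    have i: "weyl_integrable (cutoff s t (\<lambda>_. 1))" using weyl_integrable_indicator st by blast
    show ?thesis
      unfolding z using weyl_integrable_linear[OF i S(1), of "f s" 1] S(2) weyl_integrable_indicator(2)[of s t] st by simp
  qed
  then show "gls_integrable_on \<alpha> 0 T s t f g" "weyl_integrable (cutoff s t f)"
    "\<bar>gls_integral_on \<alpha> 0 T s t f g - f s * (g t - g s)\<bar> \<le> local_const \<mu> * F * (t - s) powr (1 + \<mu> - \<alpha>)"
    using weyl_integrable_imp_integrable by (auto simp: gls_integrable_on_def gls_integral_on_def)
qed

lemma gls_integral_on_combine:
  assumes f: "holder_with F \<mu> {0..T} f" and \<mu>: "\<alpha> < \<mu>" and st: "0 \<le> s" "s \<le> u" "u \<le> t" "t \<le> T"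
  shows "gls_integral_on \<alpha> 0 T s t f g = gls_integral_on \<alpha> 0 T s u f g + gls_integral_on \<alpha> 0 T u t f g"
proof -
  have gs: "weyl_integrable (cutoff s u f)" "weyl_integrable (cutoff u t f)" "weyl_integrable (cutoff s t f)"
    using holder_gls_integral_on(3)[OF f \<mu>] st by auto
  note L = weyl_integrable_linear[OF gs(1,2), of 1 1]
  have "AE x in lborel. cutoff s t f x = 1 * cutoff s u f x + 1 * cutoff u t f x"
    using AE_lborel_singleton[of u] by eventually_elim (use st in \<open>auto simp: indicator_def\<close>)
  then have "gls_integral \<alpha> 0 T (\<lambda>x. 1 * cutoff s u f x + 1 * cutoff u t f x) g = gls_integral \<alpha> 0 T (cutoff s t f) g"
    using L(1) by (intro weyl_integrable_cong_AE(2)[OF gs(3)]) (auto simp: weyl_integrable_def)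
  then show ?thesis using L(2) unfolding gls_integral_on_def by simp
qed

end

section \<open>Hoelder continuity of fractional Brownian motion\<close>

lemma dyadic_scale:
  fixes z :: real
  assumes "z \<ge> 1"
  obtains n :: nat where "2 ^ n \<le> z" "z < 2 ^ Suc n"
proof -
  have ex: "\<exists>N. z < 2 ^ N" using real_arch_pow[of 2 z] by simp
  define N where "N = (LEAST N. z < 2 ^ N)"
  have N: "z < 2 ^ N" unfolding N_def using ex by (rule LeastI_ex)
  then obtain n where n: "N = Suc n" using assms by (cases N) auto
  have "\<not> z < 2 ^ n"
    using not_less_Least[of n "\<lambda>N. z < 2 ^ N"] n unfolding N_def by simp
  then show ?thesis using that[of n] N n by auto
qed

text \<open>Chaining for a fixed path: \<open>\<pi> n t\<close> is the dyadic point of level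
  \<open>n\<close> below \<open>t\<close>. Successive levels differ by at most one increment,
  continuity identifies \<open>g t\<close> as the limit, and the errors sum geometrically. Points at
  distance about T / 2^n are compared at level \<open>n\<close>.\<close>

lemma dyadic_increments_imp_holder:
  fixes g :: "real \<Rightarrow> real"
  assumes T: "T > 0" and \<gamma>: "\<gamma> > 0" and g: "continuous_on {0..T} g"
    and inc: "\<And>n k. k < 2 ^ n \<Longrightarrow>
      \<bar>g (real (Suc k) * (T / 2 ^ n)) - g (real k * (T / 2 ^ n))\<bar> \<le> C * (2 powr - \<gamma>) ^ n"
  shows "\<exists>K. holder_with K \<gamma> {0..T} g"
proof -
  define \<rho> :: real where "\<rho> = 2 powr - \<gamma>"
  have \<rho>: "0 < \<rho>" "\<rho> < 1" using \<gamma> by (auto simp: \<rho>_def powr_minus field_simps)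
  have C: "C \<ge> 0" using inc[of 0 0] by (simp add: order_trans[OF abs_ge_zero])
  define fl where "fl = (\<lambda>n t. nat \<lfloor>t * 2 ^ n / T\<rfloor>)"
  define \<pi> where "\<pi> = (\<lambda>n t. real (fl n t) * (T / 2 ^ n))"
  have fl: "real (fl n t) = of_int \<lfloor>t * 2 ^ n / T\<rfloor>" "fl n t \<le> 2 ^ n" if "t \<in> {0..T}" for n t
  proof -
    have "0 \<le> t * 2 ^ n / T" using that T by simp
    then show "real (fl n t) = of_int \<lfloor>t * 2 ^ n / T\<rfloor>" by (simp add: fl_def)
    moreover have "t * 2 ^ n / T \<le> 2 ^ n" using that T by (simp add: field_simps)
    ultimately have "real (fl n t) \<le> 2 ^ n" by (metis of_int_floor_le order_trans)
    then show "fl n t \<le> 2 ^ n" by (metis of_nat_le_iff of_nat_numeral of_nat_power)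
  qed
  have \<pi>_le: "\<pi> n t \<le> t" "t < \<pi> n t + T / 2 ^ n" "0 \<le> \<pi> n t" if "t \<in> {0..T}" for n t
  proof -
    have a: "real (fl n t) \<le> t * 2 ^ n / T" "t * 2 ^ n / T < real (fl n t) + 1"
      unfolding fl(1)[OF that] by linarith+
    then show "\<pi> n t \<le> t" "t < \<pi> n t + T / 2 ^ n"
      using T by (simp_all add: \<pi>_def field_simps)
    show "0 \<le> \<pi> n t" using T by (simp add: \<pi>_def)
  qed
  have near: "\<bar>g (\<pi> n t) - g (\<pi> n s)\<bar> \<le> C * \<rho> ^ n"
    if st: "s \<in> {0..T}" "t \<in> {0..T}" "s \<le> t" "t - s \<le> T / 2 ^ n" for n s t
  proof -
    have "t * 2 ^ n / T \<le> s * 2 ^ n / T + 1"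
      using st T by (simp add: field_simps)
    then have "\<lfloor>t * 2 ^ n / T\<rfloor> \<le> \<lfloor>s * 2 ^ n / T\<rfloor> + 1" by linarith
    moreover have "s * 2 ^ n / T \<le> t * 2 ^ n / T" using st T by (simp add: divide_right_mono)
    then have "\<lfloor>s * 2 ^ n / T\<rfloor> \<le> \<lfloor>t * 2 ^ n / T\<rfloor>" by (rule floor_mono)
    ultimately have "fl n t = fl n s \<or> fl n t = Suc (fl n s)"
      using fl(1)[OF st(1), of n] fl(1)[OF st(2), of n] by linarith
    then show ?thesis
    proof
      assume "fl n t = fl n s"
      then show ?thesis using C \<rho> by (simp add: \<pi>_def)
    next
      assume e: "fl n t = Suc (fl n s)"
      then have "fl n s < 2 ^ n" using fl(2)[OF st(2), of n] by simp
      from inc[OF this] show ?thesis using e unfolding \<pi>_def \<rho>_def by simp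
    qed
  qed
  have refine: "\<bar>g (\<pi> (Suc n) t) - g (\<pi> n t)\<bar> \<le> C * \<rho> ^ Suc n" if t: "t \<in> {0..T}" for n t
  proof -
    \<comment> \<open>A point of level \<open>n\<close> is its own approximation of level
      \<open>n + 1\<close>. Hence \<open>near\<close> at that level applies when \<open>t\<close>
      lies in the left half of its cell.\<close>
    have e: "\<pi> (Suc n) (\<pi> n t) = \<pi> n t"
    proof -
      have "\<pi> n t * 2 ^ Suc n / T = of_int (int (2 * fl n t))" using T by (simp add: \<pi>_def)
      then have "fl (Suc n) (\<pi> n t) = 2 * fl n t"
      proof -
        assume *: "\<pi> n t * 2 ^ Suc n / T = of_int (int (2 * fl n t))"
        have "fl (Suc n) (\<pi> n t) = nat \<lfloor>\<pi> n t * 2 ^ Suc n / T\<rfloor>" unfolding fl_def ..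
        then show ?thesis unfolding * by (simp only: floor_of_int nat_int)
      qed
      then show ?thesis by (simp add: \<pi>_def)
    qed
    show ?thesis
    proof (cases "t - \<pi> n t \<le> T / 2 ^ Suc n")
      case True
      have "\<bar>g (\<pi> (Suc n) t) - g (\<pi> (Suc n) (\<pi> n t))\<bar> \<le> C * \<rho> ^ Suc n"
        by (rule near) (use True \<pi>_le[OF t, of n] t in auto)
      then show ?thesis unfolding e .
    next
      case False
      let ?x = "\<lfloor>t * 2 ^ n / T\<rfloor>"
      have "\<lfloor>t * 2 ^ Suc n / T\<rfloor> = 2 * ?x + 1"
      proof (rule floor_unique)
        have "t * 2 ^ n / T < of_int ?x + 1" by linarith
        moreover have e: "t * 2 ^ Suc n / T = 2 * (t * 2 ^ n / T)" by simp
        ultimately show "t * 2 ^ Suc n / T < of_int (2 * ?x + 1) + 1"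
          unfolding e of_int_add of_int_mult of_int_1 of_int_numeral by linarith
        have "real (fl n t) * (T / 2 ^ n) + T / 2 ^ Suc n < t" using False by (simp add: \<pi>_def)
        then have "2 * real (fl n t) + 1 < t * 2 ^ Suc n / T" using T by (simp add: field_simps)
        then show "of_int (2 * ?x + 1) \<le> t * 2 ^ Suc n / T" using fl(1)[OF t, of n] by simp
      qed
      then have f: "fl (Suc n) t = Suc (2 * fl n t)"
        using fl(1)[OF t, of "Suc n"] fl(1)[OF t, of n] by linarith
      then have "2 * fl n t < 2 ^ Suc n" using fl(2)[OF t, of "Suc n"] by simp
      from inc[OF this] show ?thesis using f unfolding \<pi>_def \<rho>_def by simp
    qed
  qed
  \<comment> \<open>\<open>C' * \<rho> ^ n\<close> is the tail of the series of
    \<open>C * \<rho> ^ k\<close> over k > n.\<close>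
  define C' where "C' = C * \<rho> / (1 - \<rho>)"
  have C': "C' \<ge> 0" using C \<rho> by (simp add: C'_def)
  have C'1: "C' * (1 - \<rho>) = C * \<rho>" using \<rho> by (simp add: C'_def)
  have chain: "\<bar>g (\<pi> (n + j) t) - g (\<pi> n t)\<bar> \<le> C' * (\<rho> ^ n - \<rho> ^ (n + j))" if t: "t \<in> {0..T}" for n j t
  proof (induction j)
    case (Suc j)
    have "C * \<rho> ^ Suc (n + j) = C' * (\<rho> ^ (n + j) - \<rho> ^ Suc (n + j))"
    proof -
      have "C' * (\<rho> ^ (n + j) - \<rho> ^ Suc (n + j)) = (C' * (1 - \<rho>)) * \<rho> ^ (n + j)"
        by (simp add: algebra_simps)
      then show ?thesis unfolding C'1 by simp
    qed
    then show ?case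
      using Suc refine[OF t, of "n + j"] by (simp add: right_diff_distrib)
  qed simp
  have approx: "\<bar>g t - g (\<pi> n t)\<bar> \<le> C' * \<rho> ^ n" if t: "t \<in> {0..T}" for n t
  proof -
    have "(\<lambda>j. \<pi> (n + j) t) \<longlonglongrightarrow> t"
    proof (rule tendsto_sandwich[of "\<lambda>j. t - T / 2 ^ (n + j)" _ _ "\<lambda>j. t"])
      have "(\<lambda>j. t - T / 2 ^ n * (1 / 2) ^ j) \<longlonglongrightarrow> t - T / 2 ^ n * 0"
        by (intro tendsto_intros LIMSEQ_power_zero) auto
      moreover have "(\<lambda>j. t - T / 2 ^ (n + j)) = (\<lambda>j. t - T / 2 ^ n * (1 / 2) ^ j)"
        by (simp add: power_add power_one_over)
      ultimately show "(\<lambda>j. t - T / 2 ^ (n + j)) \<longlonglongrightarrow> t" by simp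
    qed (use \<pi>_le[OF t] in \<open>auto simp: less_imp_le diff_le_eq intro!: always_eventually\<close>)
    then have "(\<lambda>j. g (\<pi> (n + j) t)) \<longlonglongrightarrow> g t"
      using \<pi>_le[OF t] t
      by (intro continuous_on_tendsto_compose[OF g]) (auto intro!: always_eventually intro: order_trans)
    then have "(\<lambda>j. \<bar>g (\<pi> (n + j) t) - g (\<pi> n t)\<bar>) \<longlonglongrightarrow> \<bar>g t - g (\<pi> n t)\<bar>"
      by (intro tendsto_intros)
    moreover have "\<bar>g (\<pi> (n + j) t) - g (\<pi> n t)\<bar> \<le> C' * \<rho> ^ n" for j
      using chain[OF t, of n j] mult_nonneg_nonneg[OF C' zero_le_power[of \<rho> "n + j"]] \<rho>(1)
      unfolding right_diff_distrib by linarith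
    ultimately show ?thesis by (intro LIMSEQ_le_const2) auto
  qed
  \<comment> \<open>Two approximation errors and one step between neighbouring dyadic points; the
    factor 2^\<gamma> is lost in rounding the distance to a dyadic scale.\<close>
  have "holder_with ((2 * C' + C) * (2 powr \<gamma> * T powr -\<gamma>)) \<gamma> {0..T} g"
  proof (rule holder_withI)
    fix s t assume st: "s \<in> {0..T}" "t \<in> {0..T}" "s < t"
    have "T / (t - s) \<ge> 1" using st by (simp add: field_simps)
    then obtain n :: nat where n: "2 ^ n \<le> T / (t - s)" "T / (t - s) < 2 ^ Suc n"
      by (rule dyadic_scale)
    have ts: "t - s \<le> T / 2 ^ n" using n(1) st by (simp add: field_simps)
    have "\<bar>g t - g s\<bar> \<le> (2 * C' + C) * \<rho> ^ n"
      using approx[OF st(1), of n] approx[OF st(2), of n] near[OF st(1,2) _ ts] st(3)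
      unfolding distrib_right by linarith
    also have "\<rho> ^ n \<le> 2 powr \<gamma> * T powr -\<gamma> * (t - s) powr \<gamma>"
    proof -
      have "\<rho> ^ Suc n = (2 ^ Suc n) powr -\<gamma>"
      proof -
        have "\<rho> ^ Suc n = \<rho> powr real (Suc n)" "(2::real) ^ Suc n = 2 powr real (Suc n)"
          using \<rho> by (simp_all only: powr_realpow zero_less_numeral)
        then show ?thesis unfolding \<rho>_def by (simp only: powr_powr mult.commute)
      qed
      also have "\<dots> \<le> (T / (t - s)) powr -\<gamma>"
        using n(2) st T \<gamma> by (intro powr_mono2') auto
      also have "\<dots> = T powr -\<gamma> * (t - s) powr \<gamma>"
        using st T by (simp add: powr_divide powr_minus_divide)
      finally have "\<rho> ^ n * \<rho> \<le> T powr -\<gamma> * (t - s) powr \<gamma>"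
        by (simp only: power_Suc2)
      then have "\<rho> ^ n \<le> T powr -\<gamma> * (t - s) powr \<gamma> / \<rho>"
        using \<rho>(1) by (simp only: pos_le_divide_eq)
      also have "\<dots> = 2 powr \<gamma> * T powr -\<gamma> * (t - s) powr \<gamma>"
        by (simp add: \<rho>_def powr_minus_divide)
      finally show ?thesis .
    qed
    finally show "\<bar>g t - g s\<bar> \<le> (2 * C' + C) * (2 powr \<gamma> * T powr -\<gamma>) * (t - s) powr \<gamma>"
      using C' C by (simp add: mult.assoc mult_left_mono)
  qed
  then show ?thesis by blast
qed

text \<open>This is (2q - 1)!!, the moment of order 2q of the standard normal law.\<close>

definition gaussian_moment :: "nat \<Rightarrow> real" where
  "gaussian_moment q = fact (2 * q) / (2 ^ q * fact q)"

text \<open>A centred degenerate variable is almost surely 0 and both sides vanish; otherwise these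
  are the even moments of a centred normal law.\<close>

lemma (in prob_space) gaussian_rv_moments:
  assumes "gaussian_rv M Z"
  shows "integrable M Z" "integrable M (\<lambda>\<omega>. (Z \<omega>)\<^sup>2)"
    "expectation Z = 0 \<Longrightarrow> q > 0 \<Longrightarrow> integrable M (\<lambda>\<omega>. Z \<omega> ^ (2 * q)) \<and>
      (\<integral>\<omega>. Z \<omega> ^ (2 * q) \<partial>M) = gaussian_moment q * (\<integral>\<omega>. (Z \<omega>)\<^sup>2 \<partial>M) ^ q"
proof -
  have [measurable]: "Z \<in> borel_measurable M" using assms by (simp add: gaussian_rv_def)
  consider m where "AE \<omega> in M. Z \<omega> = m" | m s where "s > 0" "distributed M lborel Z (normal_density m s)"
    using assms by (auto simp: gaussian_rv_def)
  then have "integrable M Z \<and> integrable M (\<lambda>\<omega>. (Z \<omega>)\<^sup>2) \<and> (expectation Z = 0 \<longrightarrow> q > 0 \<longrightarrow>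
      integrable M (\<lambda>\<omega>. Z \<omega> ^ (2 * q)) \<and>
      (\<integral>\<omega>. Z \<omega> ^ (2 * q) \<partial>M) = gaussian_moment q * (\<integral>\<omega>. (Z \<omega>)\<^sup>2 \<partial>M) ^ q)"
  proof cases
    case 1
    have i: "integrable M (\<lambda>\<omega>. Z \<omega> ^ k)" for k
      by (rule integrable_cong_AE_imp[of _ "\<lambda>_. m ^ k"]) (use 1 in \<open>auto elim!: eventually_mono\<close>)
    have v: "(\<integral>\<omega>. Z \<omega> ^ k \<partial>M) = m ^ k" for k
    proof -
      have "(\<integral>\<omega>. Z \<omega> ^ k \<partial>M) = (\<integral>\<omega>. m ^ k \<partial>M)"
        by (rule integral_cong_AE) (use 1 in \<open>auto elim!: eventually_mono\<close>)
      then show ?thesis by (simp add: prob_space)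
    qed
    show ?thesis using i[of 1] i[of 2] i[of "2 * q"] v[of 1] v[of 2] v[of "2 * q"] by (auto simp: power_0_left)
  next
    case (2 m s)
    have int: "integrable M (\<lambda>\<omega>. f (Z \<omega>))" "(\<integral>\<omega>. f (Z \<omega>) \<partial>M) = (\<integral>x. normal_density m s x * f x \<partial>lborel)"
      if "f \<in> borel_measurable borel" "integrable lborel (\<lambda>x. normal_density m s x * f x)" for f
      using distributed_integrable[OF 2(2), of f] distributed_integral[OF 2(2), of f] that by auto
    have e: "expectation Z = m"
      using normal_distributed_expectation[OF 2(1)] 2 by simp
    have iZ: "integrable M Z"
      using int(1)[of "\<lambda>x. x"] integrable_normal_moment_nz_1[OF 2(1)] by simp
    have c: "integrable M (\<lambda>\<omega>. (Z \<omega> - m) ^ k)" for k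
      by (rule int) (use integrable_normal_moment[OF 2(1)] in auto)
    have "(\<lambda>\<omega>. (Z \<omega>)\<^sup>2) = (\<lambda>\<omega>. (Z \<omega> - m)\<^sup>2 + 2 * m * Z \<omega> - m\<^sup>2)"
      by (auto simp: fun_eq_iff power2_eq_square algebra_simps)
    then have i2: "integrable M (\<lambda>\<omega>. (Z \<omega>)\<^sup>2)"
      using c[of 2] iZ by simp
    have mom: "integrable M (\<lambda>\<omega>. Z \<omega> ^ (2 * k)) \<and>
      (\<integral>\<omega>. Z \<omega> ^ (2 * k) \<partial>M) = gaussian_moment k * (s\<^sup>2) ^ k" if m: "m = 0" for k
    proof -
      note hb = normal_moment_even[OF 2(1), of m k]
      have "(\<integral>\<omega>. Z \<omega> ^ (2 * k) \<partial>M) = fact (2 * k) / ((2 / s\<^sup>2) ^ k * fact k)"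
        using int(2)[of "\<lambda>x. x ^ (2 * k)"] hb unfolding m by (auto simp: has_bochner_integral_iff)
      also have "\<dots> = gaussian_moment k * (s\<^sup>2) ^ k"
        using 2(1) by (simp add: gaussian_moment_def power_divide)
      finally show ?thesis using c[of "2 * k"] m by simp
    qed
    have "gaussian_moment 1 = 1" by (simp add: gaussian_moment_def)
    then show ?thesis
      using iZ i2 e mom[of 1] mom[of q] by (auto simp: numeral_2_eq_2)
  qed
  then show "integrable M Z" "integrable M (\<lambda>\<omega>. (Z \<omega>)\<^sup>2)"
    "expectation Z = 0 \<Longrightarrow> q > 0 \<Longrightarrow> integrable M (\<lambda>\<omega>. Z \<omega> ^ (2 * q)) \<and>
      (\<integral>\<omega>. Z \<omega> ^ (2 * q) \<partial>M) = gaussian_moment q * (\<integral>\<omega>. (Z \<omega>)\<^sup>2 \<partial>M) ^ q"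
    by auto
qed

section \<open>Increments of fractional Brownian motion\<close>

lemma fractional_brownian_motion_linear_combination:
  assumes "fractional_brownian_motion M T H B" "finite F" "F \<subseteq> {0..T}"
  shows "gaussian_rv M (\<lambda>\<omega>. \<Sum>t\<in>F. c t * B t \<omega>)"
proof -
  have "\<forall>F c. finite F \<and> F \<subseteq> {0..T} \<longrightarrow> gaussian_rv M (\<lambda>\<omega>. \<Sum>t\<in>F. c t * B t \<omega>)"
    using assms(1) unfolding fractional_brownian_motion_def gaussian_process_def by (rule conjunct1)
  then show ?thesis using assms(2,3) by simp
qed

lemma fractional_brownian_motion_measurable:
  assumes "fractional_brownian_motion M T H B" "t \<in> {0..T}"
  shows "B t \<in> borel_measurable M" "gaussian_rv M (B t)"
proof -
  show "gaussian_rv M (B t)"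
    using fractional_brownian_motion_linear_combination[OF assms(1), of "{t}" "\<lambda>_. 1"] assms(2) by simp
  then show "B t \<in> borel_measurable M" by (simp add: gaussian_rv_def)
qed

text \<open>The covariance makes the variance of the increment (t - s)^(2H), and a centred Gaussian
  law is determined by its variance.\<close>

lemma fractional_brownian_motion_increment_moments:
  assumes M: "prob_space M" and B: "fractional_brownian_motion M T H B"
    and st: "s \<in> {0..T}" "t \<in> {0..T}" "s < t" and q: "q > 0"
  shows "integrable M (\<lambda>\<omega>. (B t \<omega> - B s \<omega>) ^ (2 * q))"
    "(\<integral>\<omega>. (B t \<omega> - B s \<omega>) ^ (2 * q) \<partial>M) = gaussian_moment q * ((t - s) powr (2 * H)) ^ q"
proof -
  interpret prob_space M by (fact M)
  note G = fractional_brownian_motion_measurable(2)[OF B]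
  have [measurable]: "B s \<in> borel_measurable M" "B t \<in> borel_measurable M"
    using fractional_brownian_motion_measurable(1)[OF B] st by auto
  have cov: "(\<integral>\<omega>. B v \<omega> * B u \<omega> \<partial>M) = (v powr (2 * H) + u powr (2 * H) - \<bar>v - u\<bar> powr (2 * H)) / 2"
    if "u \<in> {0..T}" "v \<in> {0..T}" for u v
    using B that unfolding fractional_brownian_motion_def by blast
  have mean: "(\<integral>\<omega>. B u \<omega> \<partial>M) = 0" if "u \<in> {0..T}" for u
    using B that unfolding fractional_brownian_motion_def by blast
  have "gaussian_rv M (\<lambda>\<omega>. \<Sum>u\<in>{s, t}. (if u = t then 1 else -1) * B u \<omega>)"
    by (rule fractional_brownian_motion_linear_combination[OF B]) (use st in auto)
  also have "(\<lambda>\<omega>. \<Sum>u\<in>{s, t}. (if u = t then 1 else -1) * B u \<omega>) = (\<lambda>\<omega>. B t \<omega> - B s \<omega>)"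
    using st by auto
  finally have D: "gaussian_rv M (\<lambda>\<omega>. B t \<omega> - B s \<omega>)" .
  have iB: "integrable M (B s)" "integrable M (B t)" "integrable M (\<lambda>\<omega>. (B s \<omega>)\<^sup>2)" "integrable M (\<lambda>\<omega>. (B t \<omega>)\<^sup>2)"
    using gaussian_rv_moments(1,2)[OF G] st by auto
  have eD: "expectation (\<lambda>\<omega>. B t \<omega> - B s \<omega>) = 0"
    using iB mean st by simp
  have iP: "integrable M (\<lambda>\<omega>. B t \<omega> * B s \<omega>)"
  proof (rule Bochner_Integration.integrable_bound)
    show "integrable M (\<lambda>\<omega>. (B s \<omega>)\<^sup>2 + (B t \<omega>)\<^sup>2)" using iB by simp
    have "\<bar>x * y\<bar> \<le> y\<^sup>2 + x\<^sup>2" for x y :: real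
    proof -
      have "2 * (\<bar>x\<bar> * \<bar>y\<bar>) \<le> \<bar>x\<bar>\<^sup>2 + \<bar>y\<bar>\<^sup>2"
        using sum_squares_bound[of "\<bar>x\<bar>" "\<bar>y\<bar>"] by (simp add: mult.assoc)
      moreover have "0 \<le> \<bar>x\<bar> * \<bar>y\<bar>" by simp
      ultimately show ?thesis unfolding abs_mult power2_abs by linarith
    qed
    then show "AE \<omega> in M. norm (B t \<omega> * B s \<omega>) \<le> norm ((B s \<omega>)\<^sup>2 + (B t \<omega>)\<^sup>2)"
      by (intro AE_I2) (simp add: order_trans[OF _ abs_ge_self])
  qed measurable
  have "(\<lambda>\<omega>. (B t \<omega> - B s \<omega>)\<^sup>2) = (\<lambda>\<omega>. (B t \<omega>)\<^sup>2 - 2 * (B t \<omega> * B s \<omega>) + (B s \<omega>)\<^sup>2)"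
    by (auto simp: fun_eq_iff power2_eq_square algebra_simps)
  then have "(\<integral>\<omega>. (B t \<omega> - B s \<omega>)\<^sup>2 \<partial>M) = (\<integral>\<omega>. (B t \<omega>)\<^sup>2 \<partial>M) - 2 * (\<integral>\<omega>. B t \<omega> * B s \<omega> \<partial>M) + (\<integral>\<omega>. (B s \<omega>)\<^sup>2 \<partial>M)"
    using iB iP by simp
  also have "\<dots> = (t - s) powr (2 * H)"
    using cov[of t t] cov[of s s] cov[of s t] st by (simp add: power2_eq_square)
  finally have var: "(\<integral>\<omega>. (B t \<omega> - B s \<omega>)\<^sup>2 \<partial>M) = (t - s) powr (2 * H)" .
  show "integrable M (\<lambda>\<omega>. (B t \<omega> - B s \<omega>) ^ (2 * q))"
    "(\<integral>\<omega>. (B t \<omega> - B s \<omega>) ^ (2 * q) \<partial>M) = gaussian_moment q * ((t - s) powr (2 * H)) ^ q"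
    using gaussian_rv_moments(3)[OF D eD q] unfolding var by auto
qed

text \<open>High moments of all rescaled dyadic increments are summed. The sum has finite
  expectation, so almost surely all these increments share one bound, which is the hypothesis of the
  chaining lemma.\<close>

lemma fractional_brownian_motion_holder:
  assumes M: "prob_space M" and B: "fractional_brownian_motion M T H B" and T: "T > 0"
    and \<gamma>: "0 < \<gamma>" "\<gamma> < H"
  shows "AE \<omega> in M. \<exists>K. holder_with K \<gamma> {0..T} (\<lambda>t. B t \<omega>)"
proof -
  interpret prob_space M by (fact M)
  \<comment> \<open>The order makes 2q(H - \<gamma>) > 1: the decay of a single moment has to beat
    the 2^n increments of level n.\<close>
  obtain q :: nat where q: "1 / (2 * (H - \<gamma>)) < real q" using reals_Archimedean2 by blast
  moreover have "0 < 1 / (2 * (H - \<gamma>))" using \<gamma> by simp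
  ultimately have q0: "q > 0" by (cases q) auto
  have q1: "1 < real q * (2 * (H - \<gamma>))" using q \<gamma> by (simp add: field_simps)
  define h where "h = (\<lambda>n::nat. T / 2 ^ n)"
  define D where "D = (\<lambda>n k \<omega>. B (real (Suc k) * h n) \<omega> - B (real k * h n) \<omega>)"
  define \<rho> :: real where "\<rho> = 2 powr - \<gamma>"
  define S where "S = (\<lambda>n \<omega>. \<Sum>k<2 ^ n. (D n k \<omega> / \<rho> ^ n) ^ (2 * q))"
  have \<rho>: "\<rho> > 0" by (simp add: \<rho>_def)
  have h: "h n > 0" for n using T by (simp add: h_def)
  have pt: "real k * h n \<in> {0..T}" if "k \<le> 2 ^ n" for k n
  proof -
    have "real k \<le> real (2 ^ n)" using that by (simp only: of_nat_le_iff)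
    then have "real k * h n \<le> 2 ^ n * h n" using h[of n] by (intro mult_right_mono) auto
    moreover have "2 ^ n * h n = T" by (simp add: h_def)
    ultimately show ?thesis using h[of n] by (simp add: less_imp_le)
  qed
  have [measurable]: "D n k \<in> borel_measurable M" if "k < 2 ^ n" for n k
    unfolding D_def using fractional_brownian_motion_measurable(1)[OF B] pt[of k n] pt[of "Suc k" n] that
    by (intro borel_measurable_diff) auto
  have mom: "integrable M (\<lambda>\<omega>. D n k \<omega> ^ (2 * q))"
    "(\<integral>\<omega>. D n k \<omega> ^ (2 * q) \<partial>M) = gaussian_moment q * (h n powr (2 * H)) ^ q" if "k < 2 ^ n" for n k
  proof -
    have "real (Suc k) * h n - real k * h n = h n" by (simp add: distrib_right)
    then show "integrable M (\<lambda>\<omega>. D n k \<omega> ^ (2 * q))"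
      "(\<integral>\<omega>. D n k \<omega> ^ (2 * q) \<partial>M) = gaussian_moment q * (h n powr (2 * H)) ^ q"
      using fractional_brownian_motion_increment_moments[OF M B pt[of k n] pt[of "Suc k" n] _ q0] that h[of n]
      unfolding D_def by auto
  qed
  define a :: real where "a = 2 powr (1 - real q * (2 * (H - \<gamma>)))"
  have a: "0 \<le> a" "a < 1"
    using q1 powr_less_mono[of "1 - real q * (2 * (H - \<gamma>))" 0 2] by (auto simp: a_def)
  define c where "c = gaussian_moment q * (T powr (2 * H)) ^ q"
  have c: "c \<ge> 0" by (simp add: c_def gaussian_moment_def)
  have iS: "integrable M (S n)" "(\<integral>\<omega>. S n \<omega> \<partial>M) = c * a ^ n" for n
  proof -
    have i: "integrable M (\<lambda>\<omega>. (D n k \<omega> / \<rho> ^ n) ^ (2 * q))" if "k < 2 ^ n" for k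
      using mom(1)[OF that] by (simp add: power_divide)
    then show "integrable M (S n)" unfolding S_def by (intro Bochner_Integration.integrable_sum) auto
    have "(\<integral>\<omega>. S n \<omega> \<partial>M) = (\<Sum>k<2 ^ n. (\<integral>\<omega>. (D n k \<omega> / \<rho> ^ n) ^ (2 * q) \<partial>M))"
      unfolding S_def using i by (intro Bochner_Integration.integral_sum) auto
    also have "\<dots> = (\<Sum>k<(2::nat) ^ n. gaussian_moment q * (h n powr (2 * H)) ^ q / (\<rho> ^ n) ^ (2 * q))"
      using mom(2) by (intro sum.cong) (auto simp: power_divide)
    also have "\<dots> = c * (2 ^ n * (((2 ^ n) powr - (2 * H)) ^ q / (\<rho> ^ n) ^ (2 * q)))"
    proof -
      have "h n powr (2 * H) = T powr (2 * H) * (2 ^ n) powr - (2 * H)"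
        using T by (simp add: h_def powr_divide powr_minus_divide)
      then show ?thesis by (simp add: c_def power_mult_distrib)
    qed
    also have "2 ^ n * (((2 ^ n) powr - (2 * H)) ^ q / (\<rho> ^ n) ^ (2 * q)) = a ^ n"
    proof -
      have p: "x ^ m = x powr real m" if "x > 0" for x :: real and m
        using that by (rule powr_realpow[symmetric])
      have 1: "(((2::real) ^ n) powr - (2 * H)) ^ q = 2 powr (real n * - (2 * H) * real q)"
        by (subst p, simp, subst p, simp, simp only: powr_powr)
      have 2: "(\<rho> ^ n) ^ (2 * q) = 2 powr (- \<gamma> * real n * real (2 * q))"
        unfolding \<rho>_def by (subst p, simp, subst p, simp, simp only: powr_powr)
      have 3: "a ^ n = 2 powr ((1 - real q * (2 * (H - \<gamma>))) * real n)"
        unfolding a_def by (subst p, simp, simp only: powr_powr)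
      have 4: "(2::real) ^ n = 2 powr real n" by (rule p) simp
      show ?thesis
        unfolding 1 2 3 unfolding 4 powr_diff[symmetric] powr_add[symmetric]
        by (rule arg_cong[where f = "\<lambda>x. 2 powr x"]) (simp add: algebra_simps)
    qed
    finally show "(\<integral>\<omega>. S n \<omega> \<partial>M) = c * a ^ n" .
  qed
  have S0: "S n \<omega> \<ge> 0" for n \<omega> unfolding S_def by (intro sum_nonneg) simp
  have [measurable]: "S n \<in> borel_measurable M" for n using iS(1)[of n] by simp
  have "(\<integral>\<^sup>+\<omega>. (\<Sum>n. ennreal (S n \<omega>)) \<partial>M) = (\<Sum>n. (\<integral>\<^sup>+\<omega>. ennreal (S n \<omega>) \<partial>M))"
    by (rule nn_integral_suminf) measurable
  also have "\<dots> = (\<Sum>n. ennreal (c * a ^ n))"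
    using iS S0 by (intro suminf_cong) (simp add: nn_integral_eq_integral)
  also have "\<dots> = ennreal (\<Sum>n. c * a ^ n)"
    using a c by (intro suminf_ennreal2 summable_mult summable_geometric) auto
  finally have "(\<integral>\<^sup>+\<omega>. (\<Sum>n. ennreal (S n \<omega>)) \<partial>M) \<noteq> \<infinity>" by simp
  then have "AE \<omega> in M. (\<Sum>n. ennreal (S n \<omega>)) \<noteq> \<infinity>"
    by (intro nn_integral_PInf_AE) measurable
  then show ?thesis
  proof (rule AE_mp, intro AE_I2 impI)
    fix \<omega> assume \<omega>: "\<omega> \<in> space M" and fin: "(\<Sum>n. ennreal (S n \<omega>)) \<noteq> \<infinity>"
    define C where "C = enn2real (\<Sum>n. ennreal (S n \<omega>))"
    have SC: "S n \<omega> \<le> C" for n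
    proof -
      have "ennreal (S n \<omega>) \<le> (\<Sum>n. ennreal (S n \<omega>))"
        using sum_le_suminf[of "\<lambda>n. ennreal (S n \<omega>)" "{n}"] by simp
      also have "\<dots> = ennreal C" using fin by (simp add: C_def less_top)
      finally show ?thesis by (simp add: C_def)
    qed
    have C0: "C \<ge> 0" by (simp add: C_def)
    show "\<exists>K. holder_with K \<gamma> {0..T} (\<lambda>t. B t \<omega>)"
    proof (rule dyadic_increments_imp_holder[OF T \<gamma>(1)])
      show "continuous_on {0..T} (\<lambda>t. B t \<omega>)"
        using B \<omega> unfolding fractional_brownian_motion_def by blast
      fix n k :: nat assume k: "k < 2 ^ n"
      have "\<bar>D n k \<omega> / \<rho> ^ n\<bar> ^ (2 * q) = (D n k \<omega> / \<rho> ^ n) ^ (2 * q)"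
        by (rule power_even_abs) simp
      also have "\<dots> \<le> S n \<omega>"
        unfolding S_def by (rule member_le_sum) (use k in auto)
      also have "\<dots> \<le> C" by (rule SC)
      \<comment> \<open>Passing to a power of 1 + C avoids extracting a root of C.\<close>
      also have "\<dots> \<le> (1 + C) ^ 1" by simp
      also have "\<dots> \<le> (1 + C) ^ (2 * q)" using C0 q0 by (intro power_increasing) auto
      finally have "\<bar>D n k \<omega> / \<rho> ^ n\<bar> \<le> 1 + C"
        by (subst (asm) power_mono_iff) (use C0 q0 in auto)
      then show "\<bar>B (real (Suc k) * (T / 2 ^ n)) \<omega> - B (real k * (T / 2 ^ n)) \<omega>\<bar> \<le> (1 + C) * (2 powr - \<gamma>) ^ n"
      proof -
        have "\<bar>x\<bar> \<le> c * r" if "\<bar>x / r\<bar> \<le> c" "r > 0" for x c r :: real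
          using that by (simp add: abs_divide pos_divide_le_eq)
        from this[OF \<open>\<bar>D n k \<omega> / \<rho> ^ n\<bar> \<le> 1 + C\<close>] \<rho> show ?thesis
          unfolding D_def h_def \<rho>_def by simp
      qed
    qed
  qed
qed

section \<open>Measurable convergent subsequences\<close>

text \<open>Two limit points would be separated by a rational, on whose two sides the sequence would
  then lie infinitely often.\<close>

lemma bounded_rat_cut_imp_convergent:
  fixes u :: "nat \<Rightarrow> real"
  assumes b: "bounded (range u)"
    and cut: "\<And>q :: rat. (\<forall>\<^sub>F k in sequentially. u k < of_rat q) \<or> (\<forall>\<^sub>F k in sequentially. \<not> u k < of_rat q)"
  shows "convergent u"
proof -
  obtain l r where r: "strict_mono (r :: nat \<Rightarrow> nat)" "(u \<circ> r) \<longlonglongrightarrow> l"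
    using bounded_imp_convergent_subsequence[OF b] by blast
  have sub: "\<forall>\<^sub>F k in sequentially. P (u (r k))" if "\<forall>\<^sub>F k in sequentially. P (u k)" for P
    using that filterlim_subseq[OF r(1)] by (rule eventually_compose_filterlim)
  have "u \<longlonglongrightarrow> l"
  proof (rule order_tendstoI)
    fix a assume "a < l"
    then obtain q where q: "a < of_rat q" "of_rat q < l" using of_rat_dense by blast
    have "\<not> (\<forall>\<^sub>F k in sequentially. u k < of_rat q)"
    proof
      assume "\<forall>\<^sub>F k in sequentially. u k < of_rat q"
      from sub[OF this] have "\<forall>\<^sub>F k in sequentially. (u \<circ> r) k \<le> of_rat q"
        by (rule eventually_mono) simp
      then have "l \<le> of_rat q" using tendsto_upperbound[OF r(2)] by simp
      then show False using q by simp
    qed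
    then have "\<forall>\<^sub>F k in sequentially. \<not> u k < of_rat q" using cut by blast
    then show "\<forall>\<^sub>F k in sequentially. a < u k" by (rule eventually_mono) (use q in linarith)
  next
    fix a assume "l < a"
    then obtain q where q: "l < of_rat q" "of_rat q < a" using of_rat_dense by blast
    have "\<not> (\<forall>\<^sub>F k in sequentially. \<not> u k < of_rat q)"
    proof
      assume "\<forall>\<^sub>F k in sequentially. \<not> u k < of_rat q"
      from sub[OF this] have "\<forall>\<^sub>F k in sequentially. of_rat q \<le> (u \<circ> r) k"
        by (rule eventually_mono) simp
      then have "of_rat q \<le> l" using tendsto_lowerbound[OF r(2)] by simp
      then show False using q by simp
    qed
    then have "\<forall>\<^sub>F k in sequentially. u k < of_rat q" using cut by blast
    then show "\<forall>\<^sub>F k in sequentially. u k < a" by (rule eventually_mono) (use q in linarith)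
  qed
  then show ?thesis by (rule convergentI)
qed

text \<open>A bisection by questions instead of intervals. The set of remaining indices stays
  infinite, and preferring the answer yes makes the choice canonical.\<close>

primrec refine_indices :: "(nat \<Rightarrow> nat \<Rightarrow> bool) \<Rightarrow> nat \<Rightarrow> nat set" where
  "refine_indices P 0 = UNIV"
| "refine_indices P (Suc j) =
    (if infinite (refine_indices P j \<inter> Collect (P j)) then refine_indices P j \<inter> Collect (P j)
     else refine_indices P j - Collect (P j))"

lemma infinite_refine_indices: "infinite (refine_indices P j)"
proof (induction j)
  case (Suc j)
  have "refine_indices P j = refine_indices P j \<inter> Collect (P j) \<union> (refine_indices P j - Collect (P j))"
    by blast
  with Suc have "infinite (refine_indices P j \<inter> Collect (P j)) \<or> infinite (refine_indices P j - Collect (P j))"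
    by (metis finite_Un)
  then show ?case by auto
qed simp

lemma refine_indices_antimono: "i \<le> j \<Longrightarrow> refine_indices P j \<subseteq> refine_indices P i"
proof (induction j)
  case (Suc j)
  have "refine_indices P (Suc j) \<subseteq> refine_indices P j" by auto
  then show ?case using Suc by (cases "i = Suc j") auto
qed simp

text \<open>Taking the least admissible index keeps the diagonal sequence a measurable function of
  the answers.\<close>

primrec diagonal_index :: "(nat \<Rightarrow> nat \<Rightarrow> bool) \<Rightarrow> nat \<Rightarrow> nat" where
  "diagonal_index P 0 = 0"
| "diagonal_index P (Suc k) = (LEAST n. n \<in> refine_indices P (Suc k) \<and> diagonal_index P k < n)"

lemma diagonal_index_Suc:
  "diagonal_index P (Suc k) \<in> refine_indices P (Suc k)" "diagonal_index P k < diagonal_index P (Suc k)"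
proof -
  have "\<exists>n. n \<in> refine_indices P (Suc k) \<and> diagonal_index P k < n"
    using infinite_refine_indices[of P "Suc k"] unfolding infinite_nat_iff_unbounded by blast
  from LeastI_ex[OF this]
  show "diagonal_index P (Suc k) \<in> refine_indices P (Suc k)" "diagonal_index P k < diagonal_index P (Suc k)"
    by auto
qed

text \<open>From position \<open>j + 1\<close> on, the diagonal sequence lies in
  \<open>refine_indices P (Suc j)\<close>. Question \<open>j\<close> was settled there, up to
  finitely many indices in the negative case by removing them altogether.\<close>

lemma diagonal_index_decides:
  "(\<forall>\<^sub>F k in sequentially. P j (diagonal_index P k)) \<or> (\<forall>\<^sub>F k in sequentially. \<not> P j (diagonal_index P k))"
proof -
  have "diagonal_index P k \<in> refine_indices P (Suc j)" if kj: "k \<ge> Suc j" for k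
  proof -
    obtain m where "k = Suc m" using Suc_le_D[OF kj] by blast
    then show ?thesis
      using diagonal_index_Suc(1)[of P m] refine_indices_antimono[OF kj, of P] by auto
  qed
  then have ev: "\<forall>\<^sub>F k in sequentially. diagonal_index P k \<in> refine_indices P (Suc j)"
    unfolding eventually_sequentially by blast
  show ?thesis
  proof (cases "infinite (refine_indices P j \<inter> Collect (P j))")
    case True
    then have "\<forall>\<^sub>F k in sequentially. P j (diagonal_index P k)"
      using ev by (auto elim!: eventually_mono)
    then show ?thesis ..
  next
    case False
    then have "\<forall>\<^sub>F k in sequentially. \<not> P j (diagonal_index P k)"
      using ev by (auto elim!: eventually_mono)
    then show ?thesis ..
  qed
qed

text \<open>Infinitude of a set of naturals is a countable combination of membership events.\<close>

lemma measurable_refine_indices: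
  assumes [measurable]: "\<And>j n. Measurable.pred M (\<lambda>\<omega>. P \<omega> j n)"
  shows "Measurable.pred M (\<lambda>\<omega>. n \<in> refine_indices (P \<omega>) j)"
proof (induction j arbitrary: n)
  case (Suc j)
  note Suc [measurable]
  show ?case
    unfolding refine_indices.simps infinite_nat_iff_unbounded if_distrib[of "\<lambda>A. n \<in> A"] Int_iff Diff_iff mem_Collect_eq
    by measurable
qed simp

lemma measurable_diagonal_index:
  assumes [measurable]: "\<And>j n. Measurable.pred M (\<lambda>\<omega>. P \<omega> j n)"
  shows "(\<lambda>\<omega>. diagonal_index (P \<omega>) k) \<in> measurable M (count_space UNIV)"
proof (induction k)
  case (Suc k)
  note Suc [measurable] measurable_refine_indices[OF assms, measurable]
  show ?case unfolding diagonal_index.simps by measurable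
qed simp

text \<open>The subsequence depends measurably on \<open>\<omega>\<close>: the countably many questions
  \<open>a n i \<omega> < q\<close> are answered one after the other in favour of an infinite set of indices \<open>n\<close>.\<close>

lemma measurable_convergent_subsequence:
  fixes a :: "nat \<Rightarrow> nat \<Rightarrow> 'a \<Rightarrow> real"
  assumes [measurable]: "\<And>n i. a n i \<in> borel_measurable M"
    and b: "\<And>\<omega> i. \<omega> \<in> space M \<Longrightarrow> bounded (range (\<lambda>n. a n i \<omega>))"
  shows "\<exists>\<rho> :: 'a \<Rightarrow> nat \<Rightarrow> nat. (\<forall>\<omega>. strict_mono (\<rho> \<omega>)) \<and>
    (\<forall>k. (\<lambda>\<omega>. \<rho> \<omega> k) \<in> measurable M (count_space UNIV)) \<and>
    (\<forall>\<omega>\<in>space M. \<forall>i. convergent (\<lambda>k. a (\<rho> \<omega> k) i \<omega>))"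
proof -
  \<comment> \<open>One enumeration runs through all pairs of a coordinate and a rational
    threshold.\<close>
  define P where "P = (\<lambda>\<omega> j n. a n (fst (from_nat j :: nat \<times> rat)) \<omega> < of_rat (snd (from_nat j :: nat \<times> rat)))"
  have [measurable]: "Measurable.pred M (\<lambda>\<omega>. P \<omega> j n)" for j n unfolding P_def by measurable
  show ?thesis
  proof (intro exI conjI allI ballI)
    show "strict_mono (diagonal_index (P \<omega>))" for \<omega>
      unfolding strict_mono_Suc_iff using diagonal_index_Suc(2) by blast
    show "(\<lambda>\<omega>. diagonal_index (P \<omega>) k) \<in> measurable M (count_space UNIV)" for k
      by (rule measurable_diagonal_index) measurable
    show "convergent (\<lambda>k. a (diagonal_index (P \<omega>) k) i \<omega>)" if "\<omega> \<in> space M" for \<omega> i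
    proof (rule bounded_rat_cut_imp_convergent)
      show "bounded (range (\<lambda>k. a (diagonal_index (P \<omega>) k) i \<omega>))"
        by (rule bounded_subset[OF b[OF that, of i]]) auto
      show "(\<forall>\<^sub>F k in sequentially. a (diagonal_index (P \<omega>) k) i \<omega> < of_rat q) \<or>
        (\<forall>\<^sub>F k in sequentially. \<not> a (diagonal_index (P \<omega>) k) i \<omega> < of_rat q)" for q
        using diagonal_index_decides[of "P \<omega>" "to_nat (i, q)"] by (simp add: P_def)
    qed
  qed
qed

section \<open>The reflected Euler scheme\<close>

lemma neg_part_lipschitz: "\<bar>neg_part a - neg_part b\<bar> \<le> \<bar>a - b\<bar>"
  unfolding neg_part_def by linarith

lemma bdd_above_neg_part:
  fixes t :: real
  assumes "continuous_on {0..t} z"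
  shows "bdd_above ((\<lambda>s. neg_part (z s)) ` {0..t})"
proof -
  have "continuous_on {0..t} (\<lambda>s. neg_part (z s))"
    unfolding neg_part_def by (intro continuous_intros assms)
  then have "compact ((\<lambda>s. neg_part (z s)) ` {0..t})"
    by (rule compact_continuous_image) (rule compact_Icc)
  then show ?thesis by (intro bounded_imp_bdd_above compact_imp_bounded)
qed

text \<open>On [s,t] the negative part exceeds its value at \<open>s\<close> by at most the
  oscillation of \<open>z\<close> there. So the running supremum has local increments although it
  remembers the whole past.\<close>

lemma regulator_increment:
  assumes st: "0 \<le> s" "s \<le> t" and bdd: "bdd_above ((\<lambda>s. neg_part (z s)) ` {0..t})"
    and D: "\<And>u. u \<in> {s..t} \<Longrightarrow> \<bar>z u - z s\<bar> \<le> D"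
  shows "\<bar>regulator z t - regulator z s\<bar> \<le> D"
proof -
  have bdds: "bdd_above ((\<lambda>s. neg_part (z s)) ` {0..s})"
    by (rule bdd_above_mono[OF bdd]) (use st in auto)
  have D0: "D \<ge> 0" using D[of s] st by simp
  have up: "neg_part (z u) \<le> regulator z s" if "u \<in> {0..s}" for u
    unfolding regulator_def by (rule cSUP_upper[OF that bdds])
  have "regulator z t \<le> regulator z s + D"
    unfolding regulator_def[of z t]
  proof (rule cSUP_least)
    fix u assume u: "u \<in> {0..t}"
    show "neg_part (z u) \<le> regulator z s + D"
    proof (cases "u \<le> s")
      case True
      then show ?thesis using up[of u] u D0 by auto
    next
      case False
      then have "\<bar>z u - z s\<bar> \<le> D" using D[of u] u by auto
      then show ?thesis using neg_part_lipschitz[of "z u" "z s"] up[of s] st by auto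
    qed
  qed (use st in auto)
  moreover have "regulator z s \<le> regulator z t"
    unfolding regulator_def by (rule cSUP_subset_mono[OF _ bdd]) (use st in auto)
  ultimately show ?thesis by simp
qed

lemma regulator_dist:
  assumes t: "0 \<le> t" and bdd: "bdd_above ((\<lambda>s. neg_part (z s)) ` {0..t})" "bdd_above ((\<lambda>s. neg_part (z' s)) ` {0..t})"
    and D: "\<And>u. u \<in> {0..t} \<Longrightarrow> \<bar>z u - z' u\<bar> \<le> D"
  shows "\<bar>regulator z t - regulator z' t\<bar> \<le> D"
proof -
  have le: "regulator y t \<le> regulator y' t + D"
    if b: "bdd_above ((\<lambda>s. neg_part (y' s)) ` {0..t})" and d: "\<And>u. u \<in> {0..t} \<Longrightarrow> \<bar>y u - y' u\<bar> \<le> D" for y y'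
    unfolding regulator_def[of y]
  proof (rule cSUP_least)
    fix u assume u: "u \<in> {0..t}"
    have "neg_part (y' u) \<le> regulator y' t"
      unfolding regulator_def by (rule cSUP_upper[OF u b])
    then show "neg_part (y u) \<le> regulator y' t + D"
      using neg_part_lipschitz[of "y u" "y' u"] d[OF u] by linarith
  qed (use t in auto)
  have "\<bar>z' u - z u\<bar> \<le> D" if "u \<in> {0..t}" for u using D[OF that] by linarith
  then show ?thesis using le[OF bdd(2), of z] le[OF bdd(1), of z'] D by (simp add: abs_le_iff)
qed

lemma regulator_zero: "z 0 \<ge> 0 \<Longrightarrow> regulator z 0 = 0"
  by (simp add: regulator_def neg_part_def)

lemma regulator_cong:
  assumes "\<And>u. u \<in> {0..t} \<Longrightarrow> z u = z' u"
  shows "regulator z t = regulator z' t"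
  unfolding regulator_def by (intro SUP_cong refl) (simp add: assms)

text \<open>One \<open>A\<close> comes from \<open>z\<close> and one from its regulator.\<close>

lemma holder_with_reflected:
  assumes z: "holder_with A \<gamma> {0..\<tau>} z" and "A \<ge> 0" "\<gamma> > 0"
  shows "holder_with (2 * A) \<gamma> {0..\<tau>} (\<lambda>t. z t + regulator z t)"
proof (rule holder_withI)
  fix s t assume st: "s \<in> {0..\<tau>}" "t \<in> {0..\<tau>}" "s < t"
  have "continuous_on {0..t} z"
    by (rule continuous_on_subset[OF holder_with_imp_continuous_on[OF z \<open>\<gamma> > 0\<close>]]) (use st in auto)
  then have bdd: "bdd_above ((\<lambda>s. neg_part (z s)) ` {0..t})" by (rule bdd_above_neg_part)
  have d: "\<bar>z u - z s\<bar> \<le> A * (t - s) powr \<gamma>" if "u \<in> {s..t}" for u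
  proof -
    have "\<bar>z u - z s\<bar> \<le> A * \<bar>u - s\<bar> powr \<gamma>"
      by (rule holder_withD[OF z]) (use st that in auto)
    also have "\<dots> \<le> A * (t - s) powr \<gamma>"
      using that assms(2,3) by (intro mult_left_mono powr_mono2) auto
    finally show ?thesis .
  qed
  have "\<bar>regulator z t - regulator z s\<bar> \<le> A * (t - s) powr \<gamma>"
    by (rule regulator_increment[OF _ _ bdd d]) (use st in auto)
  then show "\<bar>z t + regulator z t - (z s + regulator z s)\<bar> \<le> 2 * A * (t - s) powr \<gamma>"
    using d[of t] st by simp
qed

lemma segment_in_C_space:
  assumes "continuous_on {-r..T} x" "t \<in> {0..T}"
  shows "segment r x t \<in> mspace (C_space r)"
proof -
  have "continuous_on {-r..0} (\<lambda>s. x (t + s))"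
    by (rule continuous_on_compose2[OF assms(1)]) (use assms(2) in \<open>auto intro!: continuous_intros\<close>)
  then have c: "continuous_on {-r..0} (segment r x t)"
    unfolding segment_def by (rule continuous_on_eq) simp
  then have "compact (segment r x t ` {-r..0})"
    by (rule compact_continuous_image) (rule compact_Icc)
  then have "bounded (segment r x t ` {-r..0})" by (rule compact_imp_bounded)
  then have "Met_TC.mbounded (segment r x t ` {-r..0})"
    by (simp only: mbounded_iff_bounded)
  then show ?thesis
    using c unfolding C_space_def mspace_cfunspace
    by (auto simp: segment_def)
qed

section \<open>Standing assumptions and exponents\<close>

locale delay_equation =
  fixes r T \<theta> \<beta> \<gamma> \<alpha> L E :: real
    and \<eta> :: "real \<Rightarrow> real" and b \<sigma> :: "real \<Rightarrow> (real \<Rightarrow> real) \<Rightarrow> real"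
  assumes T: "T > 0" and r: "r > 0" and \<theta>: "0 < \<theta>" and \<beta>: "0 < \<beta>"
    and \<alpha>: "0 < \<alpha>" "\<alpha> < 1 / 2" "\<alpha> < \<theta>" "\<alpha> < \<beta>" and \<gamma>: "1 - \<alpha> < \<gamma>" "\<gamma> \<le> 1"
    and \<eta>_nonneg: "\<eta> 0 \<ge> 0" and \<eta>: "holder_with E \<theta> {-r..0} \<eta>"
    and b_measurable: "(\<lambda>(t, x). b t x) \<in> borel_measurable (restrict_space borel {0..T} \<Otimes>\<^sub>M C_borel r)"
    and L: "L \<ge> 0"
    and b_growth: "\<And>t x. t \<in> {0..T} \<Longrightarrow> x \<in> mspace (C_space r) \<Longrightarrow> \<bar>b t x\<bar> \<le> L * (1 + C_norm r x)"
    and b_lipschitz: "\<And>t x y. t \<in> {0..T} \<Longrightarrow> x \<in> mspace (C_space r) \<Longrightarrow> y \<in> mspace (C_space r) \<Longrightarrow>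
      \<bar>b t x - b t y\<bar> \<le> L * C_norm r (\<lambda>s. x s - y s)"
    and \<sigma>_growth: "\<And>t x. t \<in> {0..T} \<Longrightarrow> x \<in> mspace (C_space r) \<Longrightarrow> \<bar>\<sigma> t x\<bar> \<le> L * (1 + C_norm r x)"
    and \<sigma>_time: "\<And>s t x. s \<in> {0..T} \<Longrightarrow> t \<in> {0..T} \<Longrightarrow> x \<in> mspace (C_space r) \<Longrightarrow>
      \<bar>\<sigma> t x - \<sigma> s x\<bar> \<le> L * \<bar>t - s\<bar> powr \<beta> * (1 + C_norm r x)"
    and \<sigma>_lipschitz: "\<And>t x y. t \<in> {0..T} \<Longrightarrow> x \<in> mspace (C_space r) \<Longrightarrow> y \<in> mspace (C_space r) \<Longrightarrow>
      \<bar>\<sigma> t x - \<sigma> t y\<bar> \<le> L * C_norm r (\<lambda>s. x s - y s)"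
begin

text \<open>The exponent of the solution. The cap 1/2 keeps it strictly below
  \<open>\<gamma>\<close>, since \<open>\<gamma>\<close> exceeds 1 - \<alpha> > 1/2; this gap pays
  for the short time steps.\<close>

definition \<nu> :: real where "\<nu> = min \<theta> (1 / 2)"

text \<open>The exponent of the integrand: the segment moves with exponent \<open>\<nu>\<close>, the
  time argument of \<open>\<sigma>\<close> with \<open>\<beta>\<close>.\<close>

definition \<mu> :: real where "\<mu> = min \<nu> \<beta>"

lemma exponents: "0 < \<nu>" "\<nu> \<le> \<theta>" "\<nu> < \<gamma>" "0 < \<mu>" "\<mu> \<le> \<nu>" "\<mu> \<le> \<beta>" "\<alpha> < \<mu>" "0 < \<gamma>" "1 < \<mu> + \<gamma>" "\<mu> \<le> 1"
  using \<theta> \<beta> \<alpha> \<gamma> by (auto simp: \<nu>_def \<mu>_def)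

abbreviation path :: "(real \<Rightarrow> real) \<Rightarrow> bool" where
  "path x \<equiv> continuous_on {-r..T} x"

lemma C_norm_segment_le:
  assumes "\<And>u. u \<in> {t - r..t} \<Longrightarrow> \<bar>x u\<bar> \<le> N"
  shows "C_norm r (segment r x t) \<le> N"
  unfolding C_norm_def
proof (rule cSUP_least)
  show "{-r..0} \<noteq> {}" using r by simp
qed (use assms in \<open>auto simp: segment_def\<close>)

lemma C_norm_segment_diff_le:
  assumes "\<And>s. s \<in> {-r..0} \<Longrightarrow> \<bar>x (t + s) - y (t' + s)\<bar> \<le> D"
  shows "C_norm r (\<lambda>s. segment r x t s - segment r y t' s) \<le> D"
  unfolding C_norm_def
proof (rule cSUP_least)
  show "{-r..0} \<noteq> {}" using r by simp
qed (use assms in \<open>auto simp: segment_def\<close>)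

text \<open>The time argument and the time of the segment are kept apart, because the scheme
  evaluates \<open>b\<close> at the running time with a segment from the last node.\<close>

lemma b_bound:
  assumes "path x" "t \<in> {0..T}" "t' \<in> {0..T}" "\<And>u. u \<in> {t' - r..t'} \<Longrightarrow> \<bar>x u\<bar> \<le> N"
  shows "\<bar>b t (segment r x t')\<bar> \<le> L * (1 + N)"
  using b_growth[OF assms(2) segment_in_C_space[OF assms(1,3)]] C_norm_segment_le[OF assms(4)] L
  by (meson add_left_mono mult_left_mono order_trans)

lemma \<sigma>_bound:
  assumes "path x" "t \<in> {0..T}" "t' \<in> {0..T}" "\<And>u. u \<in> {t' - r..t'} \<Longrightarrow> \<bar>x u\<bar> \<le> N"
  shows "\<bar>\<sigma> t (segment r x t')\<bar> \<le> L * (1 + N)"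
  using \<sigma>_growth[OF assms(2) segment_in_C_space[OF assms(1,3)]] C_norm_segment_le[OF assms(4)] L
  by (meson add_left_mono mult_left_mono order_trans)

lemma b_diff:
  assumes "path x" "path y" "t \<in> {0..T}" "t1 \<in> {0..T}" "t2 \<in> {0..T}"
    and "\<And>s. s \<in> {-r..0} \<Longrightarrow> \<bar>x (t1 + s) - y (t2 + s)\<bar> \<le> D"
  shows "\<bar>b t (segment r x t1) - b t (segment r y t2)\<bar> \<le> L * D"
  using b_lipschitz[OF assms(3) segment_in_C_space[OF assms(1,4)] segment_in_C_space[OF assms(2,5)]]
    C_norm_segment_diff_le[of x t1 y t2 D, OF assms(6)] L
  by (meson mult_left_mono order_trans)

lemma \<sigma>_diff:
  assumes "path x" "path y" "t \<in> {0..T}" "t1 \<in> {0..T}" "t2 \<in> {0..T}"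
    and "\<And>s. s \<in> {-r..0} \<Longrightarrow> \<bar>x (t1 + s) - y (t2 + s)\<bar> \<le> D"
  shows "\<bar>\<sigma> t (segment r x t1) - \<sigma> t (segment r y t2)\<bar> \<le> L * D"
  using \<sigma>_lipschitz[OF assms(3) segment_in_C_space[OF assms(1,4)] segment_in_C_space[OF assms(2,5)]]
    C_norm_segment_diff_le[of x t1 y t2 D, OF assms(6)] L
  by (meson mult_left_mono order_trans)

text \<open>Time and segment are moved one after the other; both increments are lowered to the
  exponent \<open>\<mu>\<close> at the price of a power of \<open>T\<close>.\<close>

lemma \<sigma>_holder:
  assumes x: "path x" and st: "0 \<le> s" "s < t" "t \<le> T" and N: "\<And>u. u \<in> {-r..t} \<Longrightarrow> \<bar>x u\<bar> \<le> N"
    and C: "holder_with C \<nu> {-r..t} x" "C \<ge> 0"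
  shows "\<bar>\<sigma> t (segment r x t) - \<sigma> s (segment r x s)\<bar> \<le>
    (L * (1 + N) * T powr (\<beta> - \<mu>) + L * C * T powr (\<nu> - \<mu>)) * (t - s) powr \<mu>"
proof -
  have N0: "N \<ge> 0" using N[of 0] st r by (auto intro: order_trans[OF abs_ge_zero])
  have split: "(t - s) powr q \<le> T powr (q - \<mu>) * (t - s) powr \<mu>" if "\<mu> \<le> q" for q
  proof -
    have "(t - s) powr q = (t - s) powr (q - \<mu>) * (t - s) powr \<mu>" by (simp flip: powr_add)
    also have "\<dots> \<le> T powr (q - \<mu>) * (t - s) powr \<mu>"
      using that st by (intro mult_right_mono powr_mono2) auto
    finally show ?thesis .
  qed
  have "\<bar>\<sigma> t (segment r x t) - \<sigma> s (segment r x t)\<bar> \<le> L * (t - s) powr \<beta> * (1 + C_norm r (segment r x t))"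
    using \<sigma>_time[of s t "segment r x t"] segment_in_C_space[OF x, of t] st by simp
  also have "\<dots> \<le> L * (t - s) powr \<beta> * (1 + N)"
    using C_norm_segment_le[of t x N] N st L by (intro mult_left_mono add_left_mono) auto
  also have "\<dots> = L * (1 + N) * (t - s) powr \<beta>" by simp
  also have "\<dots> \<le> L * (1 + N) * (T powr (\<beta> - \<mu>) * (t - s) powr \<mu>)"
    using split[of \<beta>] exponents L N0 by (intro mult_left_mono) auto
  finally have 1: "\<bar>\<sigma> t (segment r x t) - \<sigma> s (segment r x t)\<bar> \<le> L * (1 + N) * (T powr (\<beta> - \<mu>) * (t - s) powr \<mu>)" .
  have "\<bar>\<sigma> s (segment r x t) - \<sigma> s (segment r x s)\<bar> \<le> L * (C * (t - s) powr \<nu>)"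
  proof (rule \<sigma>_diff[OF x x])
    fix u assume "u \<in> {-r..0}"
    then show "\<bar>x (t + u) - x (s + u)\<bar> \<le> C * (t - s) powr \<nu>"
      using holder_withD[OF C(1), of "t + u" "s + u"] st by auto
  qed (use st in auto)
  also have "\<dots> \<le> L * (C * (T powr (\<nu> - \<mu>) * (t - s) powr \<mu>))"
    using split[of \<nu>] exponents L C by (intro mult_left_mono) auto
  finally have 2: "\<bar>\<sigma> s (segment r x t) - \<sigma> s (segment r x s)\<bar> \<le> L * (C * (T powr (\<nu> - \<mu>) * (t - s) powr \<mu>))" .
  show ?thesis using 1 2 by (simp add: distrib_right mult.assoc)
qed

section \<open>Dyadic meshes and the Euler scheme\<close>

definition mesh :: "nat \<Rightarrow> real" where
  "mesh n = T / 2 ^ n"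

lemma mesh: "mesh n > 0" "2 ^ n * mesh n = T" "real (2 ^ n) * mesh n = T"
  using T by (auto simp: mesh_def)

lemma mesh_tendsto: "mesh \<longlonglongrightarrow> 0"
proof -
  have "(\<lambda>n. T * (1 / 2) ^ n) \<longlonglongrightarrow> T * 0"
    by (intro tendsto_intros LIMSEQ_power_zero) auto
  then show ?thesis by (simp add: mesh_def[abs_def] power_one_over)
qed

lemma mesh_powr_tendsto: "q > 0 \<Longrightarrow> (\<lambda>n. mesh n powr q) \<longlonglongrightarrow> 0"
  by (rule tendsto_zero_powrI[OF mesh_tendsto tendsto_const]) (use mesh in \<open>auto simp: less_imp_le\<close>)

definition grid_floor :: "nat \<Rightarrow> real \<Rightarrow> real" where
  "grid_floor n s = mesh n * real_of_int \<lfloor>s / mesh n\<rfloor>"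

lemma grid_floor:
  assumes "0 \<le> s"
  shows "0 \<le> grid_floor n s" "grid_floor n s \<le> s" "s < grid_floor n s + mesh n"
proof -
  have "0 \<le> s / mesh n" using assms mesh(1)[of n] by simp
  then have "0 \<le> real_of_int \<lfloor>s / mesh n\<rfloor>" by simp
  then show "0 \<le> grid_floor n s" using mesh(1)[of n] by (simp add: grid_floor_def)
  have "mesh n * real_of_int \<lfloor>s / mesh n\<rfloor> \<le> mesh n * (s / mesh n)"
    using mesh(1)[of n] by (intro mult_left_mono) auto
  then show "grid_floor n s \<le> s"
    using mesh(1)[of n] by (simp add: grid_floor_def)
  have "mesh n * (s / mesh n) < mesh n * (real_of_int \<lfloor>s / mesh n\<rfloor> + 1)"
    using mesh(1)[of n] by (intro mult_strict_left_mono) linarith+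
  then show "s < grid_floor n s + mesh n"
    using mesh(1)[of n] by (simp add: grid_floor_def distrib_left)
qed

lemma grid_floor_le:
  assumes "s < real (Suc k) * mesh n"
  shows "grid_floor n s \<le> real k * mesh n"
proof -
  have "s / mesh n < real (Suc k)" using assms mesh(1)[of n] by (simp add: pos_divide_less_eq)
  then have "\<lfloor>s / mesh n\<rfloor> \<le> int k" by linarith
  then have "real_of_int \<lfloor>s / mesh n\<rfloor> \<le> real k" by linarith
  then show ?thesis using mesh(1)[of n] by (simp add: grid_floor_def mult.commute)
qed

text \<open>The segment is frozen at the last node, whereas \<open>b\<close> keeps its running time
  argument, in which it is only measurable. The indicator extends the integrand to the line.\<close>

definition drift_integrand :: "nat \<Rightarrow> (real \<Rightarrow> real) \<Rightarrow> real \<Rightarrow> real" where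
  "drift_integrand n x s = indicator {0..T} s * b s (segment r x (grid_floor n s))"

lemma borel_measurable_drift_integrand:
  assumes x: "path x"
  shows "drift_integrand n x \<in> borel_measurable borel"
proof -
  \<comment> \<open>Clamping gives every integer an admissible time; for times in [0,T] it changes
    nothing.\<close>
  let ?p = "\<lambda>i::int. max 0 (min T (mesh n * real_of_int i))"
  have sec: "(\<lambda>s. indicator {0..T} s * b s y) \<in> borel_measurable borel" if "y \<in> mspace (C_space r)" for y
  proof -
    have "y \<in> space (C_borel r)" unfolding C_borel_def using that by (simp add: space_measure_of_conv)
    then have "(\<lambda>s. (s, y)) \<in> measurable (restrict_space borel {0..T}) (restrict_space borel {0..T} \<Otimes>\<^sub>M C_borel r)"
      by (rule measurable_Pair2')
    from measurable_compose[OF this b_measurable]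
    have "(\<lambda>s. b s y) \<in> borel_measurable (restrict_space borel {0..T})" by simp
    then show ?thesis
      by (subst (asm) borel_measurable_restrict_space_iff) (auto simp: mult.commute)
  qed
  have "(\<lambda>s. indicator {0..T} s * b s (segment r x (?p i))) \<in> borel_measurable borel" for i
    by (rule sec, rule segment_in_C_space[OF x]) (use T in auto)
  moreover have "(\<lambda>s. \<lfloor>s / mesh n\<rfloor>) \<in> measurable borel (count_space UNIV)" by measurable
  ultimately have "(\<lambda>s. indicator {0..T} s * b s (segment r x (?p \<lfloor>s / mesh n\<rfloor>))) \<in> borel_measurable borel"
    by (rule measurable_compose_countable)
  also have "(\<lambda>s. indicator {0..T} s * b s (segment r x (?p \<lfloor>s / mesh n\<rfloor>))) = drift_integrand n x"
  proof
    fix s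
    show "indicator {0..T} s * b s (segment r x (?p \<lfloor>s / mesh n\<rfloor>)) = drift_integrand n x s"
      using grid_floor[of s n] by (cases "s \<in> {0..T}") (auto simp: drift_integrand_def grid_floor_def)
  qed
  finally show ?thesis .
qed

lemma path_bounded: "path x \<Longrightarrow> \<exists>N\<ge>0. \<forall>u\<in>{-r..T}. \<bar>x u\<bar> \<le> N"
proof -
  assume "path x"
  then have "bounded (x ` {-r..T})"
    by (intro compact_imp_bounded compact_continuous_image) auto
  then obtain N where "\<forall>u\<in>{-r..T}. norm (x u) \<le> N" unfolding bounded_iff by auto
  then show ?thesis using T r by (intro exI[of _ "max N 0"]) auto
qed

lemma bounded_set_integrable:
  fixes f :: "real \<Rightarrow> real"
  assumes [measurable]: "f \<in> borel_measurable borel" "S \<in> sets borel" and "S \<subseteq> {0..T}"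
    and b: "\<And>s. s \<in> S \<Longrightarrow> \<bar>f s\<bar> \<le> c"
  shows "set_integrable lborel S f"
proof -
  have "emeasure lborel S \<le> emeasure lborel {0..T}" by (rule emeasure_mono) (use assms in auto)
  then have "emeasure lborel S < \<infinity>" using T by (simp add: order_le_less_trans)
  then have "set_integrable lborel S (\<lambda>_. c)"
    unfolding set_integrable_def by (simp add: integrable_real_indicator)
  then show ?thesis
    by (rule set_integrable_bound)
      (use b in \<open>auto simp: set_borel_measurable_def intro!: AE_I2 order_trans[OF _ abs_ge_self]\<close>)
qed

text \<open>The right endpoint is excluded so that at the end of a cell the integrand has not yet
  used the segment at the next node; \<open>Z_causal\<close> relies on this.\<close>

definition drift :: "nat \<Rightarrow> (real \<Rightarrow> real) \<Rightarrow> real \<Rightarrow> real" where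
  "drift n x t = (LBINT s:{0..<t}. drift_integrand n x s)"

lemma drift_integrand_bound:
  assumes x: "path x" and N: "\<And>u. u \<in> {-r..t} \<Longrightarrow> \<bar>x u\<bar> \<le> N" and s: "0 \<le> s" "s \<le> t" "t \<le> T"
  shows "\<bar>drift_integrand n x s\<bar> \<le> L * (1 + N)"
proof -
  have "\<bar>b s (segment r x (grid_floor n s))\<bar> \<le> L * (1 + N)"
    by (rule b_bound[OF x]) (use grid_floor[of s n] s N in auto)
  then show ?thesis using s by (simp add: drift_integrand_def)
qed

lemma drift_lipschitz:
  assumes x: "path x" and N: "\<And>u. u \<in> {-r..t} \<Longrightarrow> \<bar>x u\<bar> \<le> N" and st: "0 \<le> s" "s \<le> t" "t \<le> T"
  shows "\<bar>drift n x t - drift n x s\<bar> \<le> L * (1 + N) * (t - s)"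
proof -
  let ?f = "drift_integrand n x"
  have [measurable]: "?f \<in> borel_measurable borel" by (rule borel_measurable_drift_integrand[OF x])
  have bd: "\<bar>?f u\<bar> \<le> L * (1 + N)" if "0 \<le> u" "u \<le> t" for u
    using drift_integrand_bound[OF x N that] st by simp
  have i: "set_integrable lborel {0..<s} ?f" "set_integrable lborel {s..<t} ?f"
    by (rule bounded_set_integrable[where c = "L * (1 + N)"]; use bd st in force)+
  have "{0..<t} = {0..<s} \<union> {s..<t}" "{0..<s} \<inter> {s..<t} = {}" using st by auto
  then have "drift n x t - drift n x s = (LBINT u:{s..<t}. ?f u)"
    unfolding drift_def using set_integral_Un[OF _ i] by simp
  also have "\<bar>\<dots>\<bar> \<le> (LBINT u:{s..<t}. \<bar>?f u\<bar>)"
    using set_integral_norm_bound[OF i(2)] by simp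
  also have "\<dots> \<le> (LBINT u:{s..<t}. L * (1 + N))"
    using i(2) bd st by (intro set_integral_mono set_integrable_abs) (auto intro: bounded_set_integrable)
  also have "\<dots> = L * (1 + N) * (t - s)"
    using st by (simp add: set_lebesgue_integral_def)
  finally show ?thesis .
qed

definition node :: "nat \<Rightarrow> nat \<Rightarrow> real" where
  "node n k = real k * mesh n"

lemma node: "0 \<le> node n k" "node n 0 = 0" "node n (2 ^ n) = T" "k \<le> l \<Longrightarrow> node n k \<le> node n l"
    "k < l \<Longrightarrow> node n k < node n l"
  using mesh[of n] by (auto simp: node_def)

lemma node_le_T: "k \<le> 2 ^ n \<Longrightarrow> node n k \<le> T"
  using node(4)[of k "2 ^ n" n] node(3) by simp

definition coeff :: "(real \<Rightarrow> real) \<Rightarrow> real \<Rightarrow> real" where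
  "coeff x s = \<sigma> s (segment r x s)"

text \<open>A left-point Riemann sum against \<open>g\<close> stopped at \<open>t\<close>: completed
  cells count fully, the current one partially, later ones not at all.\<close>

definition noise :: "nat \<Rightarrow> (real \<Rightarrow> real) \<Rightarrow> (real \<Rightarrow> real) \<Rightarrow> real \<Rightarrow> real" where
  "noise n x g t = (\<Sum>k<2 ^ n. coeff x (node n k) * (g (min t (node n (Suc k))) - g (min t (node n k))))"

definition Z :: "nat \<Rightarrow> (real \<Rightarrow> real) \<Rightarrow> (real \<Rightarrow> real) \<Rightarrow> real \<Rightarrow> real" where
  "Z n x g t = \<eta> 0 + drift n x t + noise n x g t"

text \<open>A fixed point equation in form but an explicit recursion in content, since
  \<open>Z\<close> on a cell uses \<open>x\<close> only up to its left node.\<close>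

definition euler :: "nat \<Rightarrow> (real \<Rightarrow> real) \<Rightarrow> (real \<Rightarrow> real) \<Rightarrow> bool" where
  "euler n g x \<longleftrightarrow> path x \<and> (\<forall>t\<in>{-r..0}. x t = \<eta> t) \<and>
     (\<forall>t\<in>{0..T}. x t = Z n x g t + regulator (Z n x g) t)"

lemma Z_zero: "Z n x g 0 = \<eta> 0"
proof -
  have "noise n x g 0 = 0"
    unfolding noise_def using node(1)[of n] by (simp add: min_def del: of_nat_Suc)
  then show ?thesis by (simp add: Z_def drift_def set_lebesgue_integral_def)
qed

lemma E_nonneg: "E \<ge> 0"
  by (rule holder_with_const_nonneg[OF \<eta>]) (use r in simp)

definition E' :: real where "E' = E * r powr (\<theta> - \<nu>)"

lemma \<eta>_holder: "holder_with E' \<nu> {-r..0} \<eta>" "E' \<ge> 0"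
  unfolding E'_def using exponents E_nonneg
  by (auto intro!: holder_with_exponent_mono[OF \<eta>])

text \<open>The constant depends on the mesh; it is used only to know beforehand that a Hoelder
  constant exists.\<close>

lemma Z_holder_qualitative:
  assumes x: "path x" and g: "holder_with K \<gamma> {0..T} g"
  shows "\<exists>A\<ge>0. holder_with A \<gamma> {0..T} (Z n x g)"
proof -
  obtain N where N: "N \<ge> 0" "\<And>u. u \<in> {-r..T} \<Longrightarrow> \<bar>x u\<bar> \<le> N" using path_bounded[OF x] by auto
  have K: "K \<ge> 0" by (rule holder_with_const_nonneg[OF g T])
  let ?F = "L * (1 + N)"
  have F: "?F \<ge> 0" using L N by simp
  let ?A = "?F * T powr (1 - \<gamma>) + (\<Sum>k<(2::nat) ^ n. ?F * (2 * K))"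
  have "holder_with ?A \<gamma> {0..T} (Z n x g)"
  proof (rule holder_withI)
    fix s t assume st: "s \<in> {0..T}" "t \<in> {0..T}" "s < t"
    have "\<bar>drift n x t - drift n x s\<bar> \<le> ?F * (t - s)"
      by (rule drift_lipschitz[OF x]) (use N st in auto)
    also have "t - s = (t - s) powr (1 - \<gamma>) * (t - s) powr \<gamma>" using st by (simp flip: powr_add)
    also have "?F * ((t - s) powr (1 - \<gamma>) * (t - s) powr \<gamma>) \<le> ?F * (T powr (1 - \<gamma>) * (t - s) powr \<gamma>)"
      using F st \<gamma> by (intro mult_left_mono mult_right_mono powr_mono2) auto
    finally have 1: "\<bar>drift n x t - drift n x s\<bar> \<le> ?F * T powr (1 - \<gamma>) * (t - s) powr \<gamma>" by simp
    have gm: "\<bar>g (min t u) - g (min s u)\<bar> \<le> K * (t - s) powr \<gamma>" if "0 \<le> u" for u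
    proof -
      have "\<bar>g (min t u) - g (min s u)\<bar> \<le> K * \<bar>min t u - min s u\<bar> powr \<gamma>"
        by (rule holder_withD[OF g]) (use st that in auto)
      also have "\<dots> \<le> K * (t - s) powr \<gamma>"
        using K st \<gamma> exponents by (intro mult_left_mono powr_mono2) auto
      finally show ?thesis .
    qed
    have "\<bar>noise n x g t - noise n x g s\<bar> \<le> (\<Sum>k<(2::nat) ^ n. ?F * (2 * K) * (t - s) powr \<gamma>)"
      unfolding noise_def sum_subtractf[symmetric]
    proof (rule order_trans[OF sum_abs sum_mono])
      fix k assume k: "k \<in> {..<(2::nat) ^ n}"
      have c: "\<bar>coeff x (node n k)\<bar> \<le> ?F"
        unfolding coeff_def by (rule \<sigma>_bound[OF x]) (use N node(1)[of n k] node_le_T[of k n] k in auto)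
      have d: "\<bar>(g (min t (node n (Suc k))) - g (min s (node n (Suc k)))) - (g (min t (node n k)) - g (min s (node n k)))\<bar>
         \<le> 2 * K * (t - s) powr \<gamma>"
        using gm[OF node(1), of n "Suc k"] gm[OF node(1), of n k] by linarith
      have "\<bar>coeff x (node n k) * (g (min t (node n (Suc k))) - g (min t (node n k))) -
         coeff x (node n k) * (g (min s (node n (Suc k))) - g (min s (node n k)))\<bar>
         = \<bar>coeff x (node n k)\<bar> * \<bar>(g (min t (node n (Suc k))) - g (min s (node n (Suc k)))) - (g (min t (node n k)) - g (min s (node n k)))\<bar>"
        by (simp add: abs_mult[symmetric] algebra_simps)
      also have "\<dots> \<le> ?F * (2 * K * (t - s) powr \<gamma>)"
        using c d F by (intro mult_mono) auto
      finally show "\<bar>coeff x (node n k) * (g (min t (node n (Suc k))) - g (min t (node n k))) -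
         coeff x (node n k) * (g (min s (node n (Suc k))) - g (min s (node n k)))\<bar> \<le> ?F * (2 * K) * (t - s) powr \<gamma>"
        by simp
    qed
    then have 2: "\<bar>noise n x g t - noise n x g s\<bar> \<le> (\<Sum>k<(2::nat) ^ n. ?F * (2 * K)) * (t - s) powr \<gamma>"
      by (simp add: sum_distrib_right mult.assoc)
    have "Z n x g t - Z n x g s = (drift n x t - drift n x s) + (noise n x g t - noise n x g s)"
      by (simp add: Z_def)
    then show "\<bar>Z n x g t - Z n x g s\<bar> \<le> ?A * (t - s) powr \<gamma>"
      unfolding distrib_right using 1 2 by linarith
  qed
  moreover have "?A \<ge> 0" using L N(1) K by (intro add_nonneg_nonneg sum_nonneg mult_nonneg_nonneg) auto
  ultimately show ?thesis by blast
qed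

end

lemma holder_with_cong: "(\<And>x. x \<in> S \<Longrightarrow> f x = g x) \<Longrightarrow> holder_with K \<mu> S f \<longleftrightarrow> holder_with K \<mu> S g"
  by (simp add: holder_with_def)

text \<open>Iterating the implication halves the initial constant each time, so in the limit only
  \<open>2 * a\<close> is left. A finite constant has to be known at the outset, but its size leaves
  no trace.\<close>

lemma holder_with_absorb:
  assumes imp: "\<And>C. C \<ge> 0 \<Longrightarrow> holder_with C \<mu> S f \<Longrightarrow> holder_with (a + C / 2) \<mu> S f"
    and C0: "holder_with C0 \<mu> S f" "C0 \<ge> 0" and a: "a \<ge> 0"
  shows "holder_with (2 * a) \<mu> S f"
proof -
  have P: "holder_with (2 * a + C0 / 2 ^ k) \<mu> S f" for k
  proof (induction k)
    case 0
    then show ?case using a by (auto intro: holder_with_mono[OF C0(1)])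
  next
    case (Suc k)
    have "holder_with (a + (2 * a + C0 / 2 ^ k) / 2) \<mu> S f"
      by (rule imp) (use Suc a C0 in auto)
    then show ?case by (simp add: add_divide_distrib mult.commute)
  qed
  show ?thesis
    unfolding holder_with_def
  proof (intro ballI)
    fix x y assume xy: "x \<in> S" "y \<in> S"
    have "(\<lambda>k. (2 * a + C0 * (1 / 2) ^ k) * \<bar>x - y\<bar> powr \<mu>) \<longlonglongrightarrow> (2 * a + C0 * 0) * \<bar>x - y\<bar> powr \<mu>"
      by (intro tendsto_intros LIMSEQ_power_zero) auto
    then have "(\<lambda>k. (2 * a + C0 / 2 ^ k) * \<bar>x - y\<bar> powr \<mu>) \<longlonglongrightarrow> 2 * a * \<bar>x - y\<bar> powr \<mu>"
      by (simp add: power_one_over)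
    then show "\<bar>f x - f y\<bar> \<le> 2 * a * \<bar>x - y\<bar> powr \<mu>"
      by (rule LIMSEQ_le_const) (use holder_withD[OF P xy] in auto)
  qed
qed

lemma segment_cong:
  assumes "\<And>u. u \<in> {t - r..t} \<Longrightarrow> x u = y u"
  shows "segment r x t = segment r y t"
  unfolding segment_def using assms by (intro restrict_ext) auto

context delay_equation
begin

section \<open>Existence of the scheme\<close>

lemma index_le: "node n j \<le> T \<Longrightarrow> j \<le> 2 ^ n"
  using node(5)[of "2 ^ n" j n] node(3)[of n] by (cases "j \<le> 2 ^ n") auto

text \<open>Up to node \<open>k + 1\<close> the drift uses segments at nodes up to \<open>k\<close>,
  and noise terms of later cells have zero increment.\<close>

lemma Z_causal:
  assumes xy: "\<And>u. u \<in> {-r..node n k} \<Longrightarrow> x u = y u"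
    and t: "t \<in> {0..T}" "t \<le> node n (Suc k)"
  shows "Z n x g t = Z n y g t"
proof -
  have seg: "segment r x v = segment r y v" if "0 \<le> v" "v \<le> node n k" for v
    by (rule segment_cong) (use that xy in auto)
  have "indicator {0..<t} s *\<^sub>R drift_integrand n x s = indicator {0..<t} s *\<^sub>R drift_integrand n y s" for s
  proof (cases "s \<in> {0..<t}")
    case True
    then have "grid_floor n s \<le> node n k" "0 \<le> grid_floor n s"
      using grid_floor_le[of s k n] grid_floor(1)[of s n] t(2) by (auto simp: node_def)
    then show ?thesis using seg by (simp add: drift_integrand_def)
  qed simp
  then have "drift n x t = drift n y t"
    unfolding drift_def set_lebesgue_integral_def by presburger
  moreover have "noise n x g t = noise n y g t"
    unfolding noise_def
  proof (rule sum.cong)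
    fix i assume "i \<in> {..<(2::nat) ^ n}"
    show "coeff x (node n i) * (g (min t (node n (Suc i))) - g (min t (node n i))) =
        coeff y (node n i) * (g (min t (node n (Suc i))) - g (min t (node n i)))"
    proof (cases "i \<le> k")
      case True
      then show ?thesis using seg[OF node(1) node(4)] by (simp add: coeff_def)
    next
      case False
      then have "t \<le> node n i" "t \<le> node n (Suc i)"
        using t(2) node(4)[of "Suc k" i n] node(4)[of "Suc k" "Suc i" n] by auto
      then show ?thesis by simp
    qed
  qed simp
  ultimately show ?thesis by (simp add: Z_def)
qed

text \<open>One Picard iteration. At t = 0 the two branches agree because \<open>Z\<close> starts at
  \<open>\<eta> 0\<close>, which is nonnegative, so the regulator starts at 0.\<close>

definition step :: "nat \<Rightarrow> (real \<Rightarrow> real) \<Rightarrow> (real \<Rightarrow> real) \<Rightarrow> real \<Rightarrow> real" where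
  "step n g x t = (if t \<le> 0 then \<eta> t else Z n x g t + regulator (Z n x g) t)"

lemma step_eq: "t \<in> {0..T} \<Longrightarrow> step n g x t = Z n x g t + regulator (Z n x g) t"
  using regulator_zero[of "Z n x g"] Z_zero[of n x g] \<eta>_nonneg by (auto simp: step_def)

lemma step_holder:
  assumes x: "path x" and g: "holder_with K \<gamma> {0..T} g"
  shows "\<exists>C\<ge>0. holder_with C \<nu> {-r..T} (step n g x)"
proof -
  obtain A where A: "A \<ge> 0" "holder_with A \<gamma> {0..T} (Z n x g)"
    using Z_holder_qualitative[OF x g] by blast
  have "holder_with (2 * A) \<gamma> {0..T} (step n g x)"
    using holder_with_reflected[OF A(2,1) exponents(8)] step_eq
    by (subst holder_with_cong) auto
  then have "holder_with (2 * A * T powr (\<gamma> - \<nu>)) \<nu> {0..T} (step n g x)"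
    by (rule holder_with_exponent_mono) (use A exponents in auto)
  moreover have "holder_with E' \<nu> {-r..0} (step n g x)"
    using \<eta>_holder(1) by (subst holder_with_cong[of _ _ \<eta>]) (auto simp: step_def)
  ultimately have "holder_with (E' + 2 * A * T powr (\<gamma> - \<nu>)) \<nu> {-r..T} (step n g x)"
    using A \<eta>_holder exponents T r by (intro holder_with_concat[where c = 0]) auto
  then show ?thesis using A \<eta>_holder by (intro exI[of _ "E' + 2 * A * T powr (\<gamma> - \<nu>)"]) auto
qed

text \<open>Each application of \<^const>\<open>step\<close> makes the path correct on one more cell of the mesh.\<close>

lemma euler_exists:
  assumes g: "holder_with K \<gamma> {0..T} g"
  shows "\<exists>x. euler n g x"
proof -
  define X where "X = rec_nat (\<lambda>t. \<eta> (min t 0)) (\<lambda>_. step n g)"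
  have X0: "X 0 = (\<lambda>t. \<eta> (min t 0))" and XS: "X (Suc m) = step n g (X m)" for m
    by (simp_all add: X_def)
  have path: "path (X m)" for m
  proof (induction m)
    case 0
    have "continuous_on {-r..0} \<eta>" using holder_with_imp_continuous_on[OF \<eta>_holder(1)] exponents by simp
    then have "path (\<lambda>t. \<eta> (min t 0))"
      by (rule continuous_on_compose2) (use r in \<open>auto intro!: continuous_intros\<close>)
    then show ?case by (simp add: X0)
  next
    case (Suc m)
    then show ?case
      using step_holder[OF _ g, of "X m" n] holder_with_imp_continuous_on exponents(1) unfolding XS by blast
  qed
  \<comment> \<open>Agreement up to node \<open>m\<close> makes \<open>Z\<close>, and with it the
    regulator, agree up to node \<open>m + 1\<close>. Since node 2^n is \<open>T\<close>, iterate
    number 2^n is a fixed point on the whole interval.\<close>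
  have agree: "\<forall>u\<in>{-r..node n m}. X (Suc m) u = X m u" if "m \<le> 2 ^ n" for m
    using that
  proof (induction m)
    case 0
    then show ?case using node(2)[of n] by (auto simp: XS X0 step_def min_def)
  next
    case (Suc m)
    then have IH: "X (Suc m) u = X m u" if "u \<in> {-r..node n m}" for u using that by simp
    have Zeq: "Z n (X (Suc m)) g t = Z n (X m) g t" if "t \<in> {0..node n (Suc m)}" for t
      by (rule Z_causal[OF IH]) (use that node_le_T[OF Suc.prems] in auto)
    show ?case
    proof
      fix u assume u: "u \<in> {-r..node n (Suc m)}"
      have "regulator (Z n (X (Suc m)) g) u = regulator (Z n (X m) g) u" if "0 < u"
        by (rule regulator_cong, rule Zeq) (use u that in auto)
      then show "X (Suc (Suc m)) u = X (Suc m) u"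
        using Zeq[of u] u by (simp add: XS[of "Suc m"] XS[of m] step_def)
    qed
  qed
  let ?x = "X (2 ^ n)"
  have fixp: "?x t = step n g ?x t" if "t \<in> {-r..T}" for t
    using agree[of "2 ^ n"] that node(3)[of n] unfolding XS by auto
  have "?x t = \<eta> t" if "t \<in> {-r..0}" for t
    using fixp[of t] that T by (simp add: step_def)
  moreover have "?x t = Z n ?x g t + regulator (Z n ?x g) t" if "t \<in> {0..T}" for t
    using fixp[of t] step_eq[OF that, of n g ?x] that r by simp
  ultimately show ?thesis using path unfolding euler_def by blast
qed

section \<open>Hoelder bounds uniform in the mesh\<close>

definition c1 :: real where "c1 = 1 + \<bar>\<eta> 0\<bar> + (r + T) powr \<nu>"

text \<open>Per unit of 1 + C: the time increment of \<open>\<sigma>\<close>, whose growth factor is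
  bounded through \<open>c1\<close>, plus the increment of the segment.\<close>

definition cH :: real where "cH = L * c1 * T powr (\<beta> - \<mu>) + L * T powr (\<nu> - \<mu>)"

text \<open>The first term is the drift. The noise contributes its size on one cell and the Young
  remainder, with the factor 3 of \<open>holder_with_grid\<close>.\<close>

definition Q :: "real \<Rightarrow> real" where
  "Q K = L * c1 * T powr (1 - \<gamma>) + 3 * (K * (L * c1 + young_const (\<mu> + \<gamma>) * cH * T powr \<mu>))"

lemma c1: "c1 \<ge> 1" by (simp add: c1_def)

lemma cH: "cH \<ge> 0" using L c1 by (simp add: cH_def)

lemma Q_nonneg: "K \<ge> 0 \<Longrightarrow> Q K \<ge> 0"
  using L c1 cH young_const_pos[of "\<mu> + \<gamma>"] exponents by (simp add: Q_def)

text \<open>The value at 0 is prescribed, so the Hoelder constant controls the sup norm. Expressing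
  all bounds by 1 + C keeps them affine in \<open>C\<close>, which absorption requires.\<close>

lemma sup_bound:
  assumes C: "holder_with C \<nu> {-r..\<tau>} x" "C \<ge> 0" and "x 0 = \<eta> 0" and \<tau>: "\<tau> \<in> {0..T}" and u: "u \<in> {-r..\<tau>}"
  shows "1 + \<bar>x u\<bar> \<le> c1 * (1 + C)"
proof -
  have "\<bar>x u - x 0\<bar> \<le> C * \<bar>u - 0\<bar> powr \<nu>"
    by (rule holder_withD[OF C(1) u]) (use \<tau> r in auto)
  also have "\<dots> \<le> C * (r + T) powr \<nu>"
    using C(2) u \<tau> r exponents by (intro mult_left_mono powr_mono2) auto
  finally have "1 + \<bar>x u\<bar> \<le> 1 + \<bar>\<eta> 0\<bar> + C * (r + T) powr \<nu>" using assms(3) by linarith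
  also have "\<dots> \<le> c1 * (1 + C)"
    using C(2) by (simp add: c1_def algebra_simps)
  finally show ?thesis .
qed

lemma coeff_bounds:
  assumes x: "path x" and C: "holder_with C \<nu> {-r..\<tau>} x" "C \<ge> 0" and x0: "x 0 = \<eta> 0" and \<tau>: "\<tau> \<in> {0..T}"
  shows "s \<in> {0..\<tau>} \<Longrightarrow> \<bar>coeff x s\<bar> \<le> L * c1 * (1 + C)"
    "holder_with (cH * (1 + C)) \<mu> {0..\<tau>} (coeff x)"
proof -
  define N where "N = c1 * (1 + C) - 1"
  have N: "\<bar>x u\<bar> \<le> N" if "u \<in> {-r..\<tau>}" for u
    using sup_bound[OF C x0 \<tau> that] by (simp add: N_def)
  show "\<bar>coeff x s\<bar> \<le> L * c1 * (1 + C)" if "s \<in> {0..\<tau>}"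
  proof -
    have "\<bar>coeff x s\<bar> \<le> L * (1 + N)"
      unfolding coeff_def by (rule \<sigma>_bound[OF x]) (use that \<tau> N in auto)
    then show ?thesis by (simp add: N_def mult.assoc)
  qed
  show "holder_with (cH * (1 + C)) \<mu> {0..\<tau>} (coeff x)"
  proof (rule holder_withI)
    fix s t assume st: "s \<in> {0..\<tau>}" "t \<in> {0..\<tau>}" "s < t"
    have "\<bar>coeff x t - coeff x s\<bar> \<le> (L * (1 + N) * T powr (\<beta> - \<mu>) + L * C * T powr (\<nu> - \<mu>)) * (t - s) powr \<mu>"
      unfolding coeff_def
      by (rule \<sigma>_holder[OF x]) (use st \<tau> N C in \<open>auto intro: holder_with_subset[OF C(1)]\<close>)
    also have "\<dots> \<le> (cH * (1 + C)) * (t - s) powr \<mu>"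
    proof (rule mult_right_mono)
      have "L * C * T powr (\<nu> - \<mu>) \<le> L * T powr (\<nu> - \<mu>) * (1 + C)"
        using L by (simp add: algebra_simps)
      then show "L * (1 + N) * T powr (\<beta> - \<mu>) + L * C * T powr (\<nu> - \<mu>) \<le> cH * (1 + C)"
        by (simp add: cH_def N_def algebra_simps)
    qed simp
    finally show "\<bar>coeff x t - coeff x s\<bar> \<le> cH * (1 + C) * (t - s) powr \<mu>" .
  qed
qed

lemma noise_node:
  assumes "j \<le> 2 ^ n"
  shows "noise n x g (node n j) = (\<Sum>k<j. coeff x (node n k) * (g (node n (Suc k)) - g (node n k)))"
proof -
  have "noise n x g (node n j) =
     (\<Sum>k<2 ^ n. if k < j then coeff x (node n k) * (g (node n (Suc k)) - g (node n k)) else 0)"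
    unfolding noise_def
  proof (rule sum.cong)
    fix k
    show "coeff x (node n k) * (g (min (node n j) (node n (Suc k))) - g (min (node n j) (node n k))) =
       (if k < j then coeff x (node n k) * (g (node n (Suc k)) - g (node n k)) else 0)"
      using node(4)[of "Suc k" j n] node(4)[of k j n] node(4)[of j k n] node(4)[of j "Suc k" n]
      by (cases "k < j") (simp_all add: min_absorb1 min_absorb2)
  qed simp
  also have "\<dots> = (\<Sum>k\<in>{..<2 ^ n} \<inter> {k. k < j}. coeff x (node n k) * (g (node n (Suc k)) - g (node n k)))"
    by (simp add: sum.If_cases)
  also have "{..<2 ^ n} \<inter> {k. k < j} = {..<j}" using assms by auto
  finally show ?thesis .
qed

text \<open>\<open>discrete_young\<close> is applied to the node indices. The powers of the mesh
  size recombine with index differences into node differences, so the constant does not see the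
  mesh.\<close>

lemma noise_young:
  assumes x: "path x" and C: "holder_with C \<nu> {-r..\<tau>} x" "C \<ge> 0" and x0: "x 0 = \<eta> 0" and \<tau>: "\<tau> \<in> {0..T}"
    and g: "holder_with K \<gamma> {0..T} g" and ij: "i \<le> j" "node n j \<le> \<tau>"
  shows "\<bar>noise n x g (node n j) - noise n x g (node n i) - coeff x (node n i) * (g (node n j) - g (node n i))\<bar>
    \<le> young_const (\<mu> + \<gamma>) * (cH * (1 + C)) * K * (node n j - node n i) powr (\<mu> + \<gamma>)"
proof -
  let ?f = "\<lambda>k. coeff x (node n k)" and ?g = "\<lambda>k. g (node n k)" and ?h = "mesh n"
  have j: "j \<le> 2 ^ n" by (rule index_le) (use ij \<tau> in auto)
  have "{..<j} = {..<i} \<union> {i..<j}" "{..<i} \<inter> {i..<j} = {}" using ij by auto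
  then have diff: "noise n x g (node n j) - noise n x g (node n i) = (\<Sum>k=i..<j. ?f k * (?g (Suc k) - ?g k))"
    using noise_node[of j n x g] noise_node[of i n x g] j ij by (simp add: sum.union_disjoint)
  have nd: "node n l - node n k = ?h * (real l - real k)" for k l by (simp add: node_def algebra_simps)
  have np: "(node n l - node n k) powr q = ?h powr q * (real l - real k) powr q" for k l q
    unfolding nd by (rule powr_mult)
  have in_\<tau>: "node n l \<in> {0..\<tau>}" if "l \<le> j" for l
    using node(1)[of n l] node(4)[OF that, of n] ij by auto
  have "\<bar>(\<Sum>k=i..<j. ?f k * (?g (Suc k) - ?g k)) - ?f i * (?g j - ?g i)\<bar>
    \<le> young_const (\<mu> + \<gamma>) * (cH * (1 + C) * ?h powr \<mu>) * (K * ?h powr \<gamma>) * (real j - real i) powr (\<mu> + \<gamma>)"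
  proof (rule discrete_young)
    fix k l assume kl: "i \<le> k" "k < l" "l < j"
    have "\<bar>?f l - ?f k\<bar> \<le> cH * (1 + C) * \<bar>node n l - node n k\<bar> powr \<mu>"
      by (rule holder_withD[OF coeff_bounds(2)[OF x C x0 \<tau>]]) (use in_\<tau> kl in auto)
    also have "\<bar>node n l - node n k\<bar> = node n l - node n k" using node(5)[OF kl(2), of n] by simp
    finally show "\<bar>?f l - ?f k\<bar> \<le> cH * (1 + C) * ?h powr \<mu> * (real l - real k) powr \<mu>"
      unfolding np by (simp add: mult.assoc)
  next
    fix k l assume kl: "i \<le> k" "k < l" "l \<le> j"
    have "\<bar>?g l - ?g k\<bar> \<le> K * \<bar>node n l - node n k\<bar> powr \<gamma>"
      by (rule holder_withD[OF g]) (use in_\<tau>[of l] in_\<tau>[of k] kl \<tau> in auto)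
    also have "\<bar>node n l - node n k\<bar> = node n l - node n k" using node(5)[OF kl(2), of n] by simp
    finally show "\<bar>?g l - ?g k\<bar> \<le> K * ?h powr \<gamma> * (real l - real k) powr \<gamma>"
      unfolding np by (simp add: mult.assoc)
  qed (use exponents cH C holder_with_const_nonneg[OF g T] ij in auto)
  also have "\<dots> = young_const (\<mu> + \<gamma>) * (cH * (1 + C)) * K * (node n j - node n i) powr (\<mu> + \<gamma>)"
    unfolding np powr_add[of ?h] by (simp add: mult_ac)
  finally show ?thesis unfolding diff .
qed

lemma noise_cell:
  assumes k: "k < 2 ^ n" and st: "node n k \<le> s" "s \<le> t" "t \<le> node n (Suc k)"
  shows "noise n x g t - noise n x g s = coeff x (node n k) * (g t - g s)"
proof -
  have "noise n x g t - noise n x g s = (\<Sum>i<2 ^ n. if i = k then coeff x (node n k) * (g t - g s) else 0)"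
    unfolding noise_def sum_subtractf[symmetric]
  proof (rule sum.cong)
    fix i
    consider "i < k" | "i = k" | "k < i" by linarith
    then show "coeff x (node n i) * (g (min t (node n (Suc i))) - g (min t (node n i))) -
       coeff x (node n i) * (g (min s (node n (Suc i))) - g (min s (node n i))) =
       (if i = k then coeff x (node n k) * (g t - g s) else 0)"
    proof cases
      case 1
      then have "node n (Suc i) \<le> s" "node n i \<le> s" using node(4)[of "Suc i" k n] node(4)[of i k n] st by auto
      then show ?thesis using 1 st by (simp add: min_absorb2)
    next
      case 2
      then show ?thesis using st by (simp add: min_absorb1 min_absorb2 algebra_simps)
    next
      case 3
      then have "t \<le> node n (Suc i)" "t \<le> node n i" using node(4)[of "Suc k" "Suc i" n] node(4)[of "Suc k" i n] st by auto
      then show ?thesis using 3 st by (simp add: min_absorb1)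
    qed
  qed simp
  then show ?thesis using k by simp
qed

lemma noise_holder:
  assumes x: "path x" and C: "holder_with C \<nu> {-r..\<tau>} x" "C \<ge> 0" and x0: "x 0 = \<eta> 0" and \<tau>: "\<tau> \<in> {0..T}"
    and g: "holder_with K \<gamma> {0..T} g"
  shows "holder_with (3 * (K * (L * c1 + young_const (\<mu> + \<gamma>) * cH * T powr \<mu>) * (1 + C))) \<gamma> {0..\<tau>} (noise n x g)"
proof (rule holder_with_grid[where h = "mesh n" and n = "2 ^ n"])
  let ?Y = "young_const (\<mu> + \<gamma>)"
  let ?A = "K * (L * c1 + ?Y * cH * T powr \<mu>) * (1 + C)"
  have K: "K \<ge> 0" by (rule holder_with_const_nonneg[OF g T])
  have Y: "?Y > 0" using young_const_pos exponents by simp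
  have A1: "K * (L * c1 * (1 + C)) \<le> ?A"
    using K Y cH C by (simp add: algebra_simps)
  show "mesh n > 0" by (rule mesh)
  show "?A \<ge> 0" using K Y cH c1 L C by simp
  show "\<gamma> \<ge> 0" using exponents by simp
  show "\<tau> \<le> real (2 ^ n) * mesh n" using \<tau> mesh(3)[of n] by simp
  fix k s t assume k: "k < (2::nat) ^ n" "real k * mesh n \<le> s" "s < t" "t \<le> real (Suc k) * mesh n" "t \<le> \<tau>"
  have nk: "node n k \<le> s" "t \<le> node n (Suc k)" using k by (auto simp: node_def)
  have s0: "0 \<le> s" using nk(1) node(1)[of n k] by linarith
  have "\<bar>noise n x g t - noise n x g s\<bar> = \<bar>coeff x (node n k)\<bar> * \<bar>g t - g s\<bar>"
    using noise_cell[OF k(1) nk(1) _ nk(2), of x g] k(3) by (simp add: abs_mult)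
  also have "\<dots> \<le> (L * c1 * (1 + C)) * (K * \<bar>t - s\<bar> powr \<gamma>)"
  proof (rule mult_mono)
    show "\<bar>coeff x (node n k)\<bar> \<le> L * c1 * (1 + C)"
      by (rule coeff_bounds(1)[OF x C x0 \<tau>]) (use nk k node(1)[of n k] in auto)
    show "\<bar>g t - g s\<bar> \<le> K * \<bar>t - s\<bar> powr \<gamma>"
      by (rule holder_withD[OF g]) (use s0 k \<tau> in auto)
  qed (use L c1 C in auto)
  also have "\<dots> = K * (L * c1 * (1 + C)) * (t - s) powr \<gamma>" using k by simp
  also have "\<dots> \<le> ?A * (t - s) powr \<gamma>" using A1 by (rule mult_right_mono) simp
  finally show "\<bar>noise n x g t - noise n x g s\<bar> \<le> ?A * (t - s) powr \<gamma>" .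
next
  let ?Y = "young_const (\<mu> + \<gamma>)"
  let ?A = "K * (L * c1 + ?Y * cH * T powr \<mu>) * (1 + C)"
  have K: "K \<ge> 0" by (rule holder_with_const_nonneg[OF g T])
  have Y: "?Y > 0" using young_const_pos exponents by simp
  fix i j assume ij: "i < j" "j \<le> (2::nat) ^ n" "real j * mesh n \<le> \<tau>"
  have nj: "node n j \<le> \<tau>" using ij by (simp add: node_def)
  let ?d = "node n j - node n i"
  have d: "0 < ?d" "?d \<le> T" using node(5)[OF ij(1), of n] node(1)[of n i] nj \<tau> by auto
  have 1: "\<bar>noise n x g (node n j) - noise n x g (node n i) - coeff x (node n i) * (g (node n j) - g (node n i))\<bar>
    \<le> ?Y * (cH * (1 + C)) * K * ?d powr (\<mu> + \<gamma>)"
    by (rule noise_young[OF x C x0 \<tau> g _ nj]) (use ij in simp)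
  have 2: "\<bar>coeff x (node n i) * (g (node n j) - g (node n i))\<bar> \<le> (L * c1 * (1 + C)) * (K * \<bar>?d\<bar> powr \<gamma>)"
    unfolding abs_mult
  proof (rule mult_mono)
    show "\<bar>coeff x (node n i)\<bar> \<le> L * c1 * (1 + C)"
      by (rule coeff_bounds(1)[OF x C x0 \<tau>]) (use nj node(1)[of n i] d in auto)
    show "\<bar>g (node n j) - g (node n i)\<bar> \<le> K * \<bar>?d\<bar> powr \<gamma>"
      by (rule holder_withD[OF g]) (use nj node(1)[of n i] d \<tau> in auto)
  qed (use L c1 C in auto)
  have "?Y * (cH * (1 + C)) * K * ?d powr (\<mu> + \<gamma>) = ?Y * (cH * (1 + C)) * K * (?d powr \<mu> * ?d powr \<gamma>)"
    by (simp add: powr_add)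
  also have "\<dots> \<le> ?Y * (cH * (1 + C)) * K * (T powr \<mu> * ?d powr \<gamma>)"
    using Y cH C K d exponents by (intro mult_left_mono mult_right_mono powr_mono2) auto
  finally have 3: "?Y * (cH * (1 + C)) * K * ?d powr (\<mu> + \<gamma>) \<le> ?Y * (cH * (1 + C)) * K * (T powr \<mu> * ?d powr \<gamma>)" .
  have "\<bar>noise n x g (node n j) - noise n x g (node n i)\<bar> \<le>
      ?Y * (cH * (1 + C)) * K * (T powr \<mu> * ?d powr \<gamma>) + (L * c1 * (1 + C)) * (K * ?d powr \<gamma>)"
    using 1 2 3 d(1) by simp
  also have "\<dots> = ?A * ?d powr \<gamma>" by (simp add: algebra_simps)
  finally show "\<bar>noise n x g (real j * mesh n) - noise n x g (real i * mesh n)\<bar> \<le> ?A * (real j * mesh n - real i * mesh n) powr \<gamma>"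
    by (simp add: node_def)
qed

text \<open>\<open>Z\<close> gets exponent \<open>\<gamma>\<close> although \<open>x\<close> has
  only the smaller \<open>\<nu>\<close>. This gain, with a constant affine in \<open>C\<close>, is
  what closes the estimate.\<close>

lemma Z_holder:
  assumes x: "path x" and C: "holder_with C \<nu> {-r..\<tau>} x" "C \<ge> 0" and x0: "x 0 = \<eta> 0" and \<tau>: "\<tau> \<in> {0..T}"
    and g: "holder_with K \<gamma> {0..T} g"
  shows "holder_with (Q K * (1 + C)) \<gamma> {0..\<tau>} (Z n x g)"
proof (rule holder_withI)
  fix s t assume st: "s \<in> {0..\<tau>}" "t \<in> {0..\<tau>}" "s < t"
  define N where "N = c1 * (1 + C) - 1"
  have N: "\<bar>x u\<bar> \<le> N" if "u \<in> {-r..t}" for u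
    using sup_bound[OF C x0 \<tau>, of u] that st by (simp add: N_def)
  have "\<bar>drift n x t - drift n x s\<bar> \<le> L * (1 + N) * (t - s)"
    by (rule drift_lipschitz[OF x]) (use st \<tau> N in auto)
  also have "\<dots> = L * (1 + N) * ((t - s) powr (1 - \<gamma>) * (t - s) powr \<gamma>)" using st by (simp flip: powr_add)
  also have "\<dots> \<le> L * (1 + N) * (T powr (1 - \<gamma>) * (t - s) powr \<gamma>)"
    using L c1 C st \<tau> \<gamma> by (intro mult_left_mono mult_right_mono powr_mono2) (auto simp: N_def)
  finally have 1: "\<bar>drift n x t - drift n x s\<bar> \<le> L * c1 * T powr (1 - \<gamma>) * (1 + C) * (t - s) powr \<gamma>"
    by (simp add: N_def mult_ac)
  have 2: "\<bar>noise n x g t - noise n x g s\<bar> \<le>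
      3 * (K * (L * c1 + young_const (\<mu> + \<gamma>) * cH * T powr \<mu>) * (1 + C)) * (t - s) powr \<gamma>"
    using holder_withD[OF noise_holder[OF x C x0 \<tau> g], of t s] st by auto
  have "Z n x g t - Z n x g s = (drift n x t - drift n x s) + (noise n x g t - noise n x g s)"
    by (simp add: Z_def)
  then have "\<bar>Z n x g t - Z n x g s\<bar> \<le> L * c1 * T powr (1 - \<gamma>) * (1 + C) * (t - s) powr \<gamma> +
     3 * (K * (L * c1 + young_const (\<mu> + \<gamma>) * cH * T powr \<mu>) * (1 + C)) * (t - s) powr \<gamma>"
    using 1 2 by linarith
  also have "\<dots> = Q K * (1 + C) * (t - s) powr \<gamma>" by (simp add: Q_def distrib_right mult.assoc)
  finally show "\<bar>Z n x g t - Z n x g s\<bar> \<le> Q K * (1 + C) * (t - s) powr \<gamma>" .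
qed

text \<open>Solved from \<Delta>^(\<gamma> - \<nu>) = 1 / (4 (Q + 1)): the factor 2 of reflection
  times Q (1 + D) then leaves at most (1 + D) / 2.\<close>

definition \<Delta> :: "real \<Rightarrow> real" where
  "\<Delta> K = (1 / (4 * (Q K + 1))) powr (1 / (\<gamma> - \<nu>))"

text \<open>On a time step of length \<open>\<Delta> K\<close> the Hoelder constant enters the estimate with a factor
  at most one half, because the integrals gain the exponent \<open>\<gamma> - \<nu>\<close>; so it can be absorbed.\<close>

lemma euler_holder_step:
  assumes e: "euler n g x" and g: "holder_with K \<gamma> {0..T} g"
    and C: "holder_with C \<nu> {-r..\<tau>} x" "C \<ge> 0" and \<tau>: "0 \<le> \<tau>" "\<tau> \<le> \<tau>'" "\<tau>' \<le> T" "\<tau>' - \<tau> \<le> \<Delta> K"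
  shows "holder_with (2 * C + 1) \<nu> {-r..\<tau>'} x"
proof -
  have x: "path x" and x0: "x 0 = \<eta> 0" using e r by (auto simp: euler_def)
  have xZ: "x t = Z n x g t + regulator (Z n x g) t" if "t \<in> {0..T}" for t using e that by (auto simp: euler_def)
  have K: "K \<ge> 0" by (rule holder_with_const_nonneg[OF g T])
  have Q: "Q K \<ge> 0" by (rule Q_nonneg[OF K])
  have \<Delta>: "\<Delta> K powr (\<gamma> - \<nu>) = 1 / (4 * (Q K + 1))"
    using exponents Q by (simp add: \<Delta>_def powr_powr)
  \<comment> \<open>\<open>x\<close> is a fixed point of \<open>step\<close>, which yields the
    finite constant that absorption starts from.\<close>
  obtain C0 where C0: "C0 \<ge> 0" "holder_with C0 \<nu> {-r..T} x"
  proof -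
    obtain C0 where "C0 \<ge> 0" "holder_with C0 \<nu> {-r..T} (step n g x)" using step_holder[OF x g] by blast
    moreover have "step n g x t = x t" if "t \<in> {-r..T}" for t
      using e that step_eq[of t n g x] by (cases "t \<le> 0") (auto simp: euler_def step_def)
    ultimately show ?thesis using that holder_with_cong[of "{-r..T}" "step n g x" x] by blast
  qed
  have "holder_with (2 * (C + 1 / 2)) \<nu> {-r..\<tau>'} x"
  proof (rule holder_with_absorb)
    show "holder_with C0 \<nu> {-r..\<tau>'} x" by (rule holder_with_subset[OF C0(2)]) (use \<tau> in auto)
    fix D assume D: "D \<ge> 0" "holder_with D \<nu> {-r..\<tau>'} x"
    have "holder_with (Q K * (1 + D)) \<gamma> {0..\<tau>'} (Z n x g)"
      by (rule Z_holder[OF x D(2,1) x0 _ g]) (use \<tau> in auto)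
    then have "holder_with (2 * (Q K * (1 + D))) \<gamma> {0..\<tau>'} (\<lambda>t. Z n x g t + regulator (Z n x g) t)"
      by (rule holder_with_reflected) (use Q D exponents in auto)
    then have "holder_with (2 * (Q K * (1 + D))) \<gamma> {0..\<tau>'} x"
      using xZ \<tau> by (subst holder_with_cong) auto
    then have "holder_with (2 * (Q K * (1 + D))) \<gamma> {\<tau>..\<tau>'} x"
      by (rule holder_with_subset) (use \<tau> in auto)
    then have "holder_with (2 * (Q K * (1 + D)) * \<Delta> K powr (\<gamma> - \<nu>)) \<nu> {\<tau>..\<tau>'} x"
      by (rule holder_with_exponent_mono) (use exponents Q D \<tau> in auto)
    then have "holder_with (1 / 2 + D / 2) \<nu> {\<tau>..\<tau>'} x"
    proof (rule holder_with_mono)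
      have "2 * (Q K * (1 + D)) * \<Delta> K powr (\<gamma> - \<nu>) = (Q K / (Q K + 1)) * ((1 + D) / 2)"
        unfolding \<Delta> using Q by (simp add: field_simps)
      also have "\<dots> \<le> 1 * ((1 + D) / 2)" using Q D by (intro mult_right_mono) auto
      finally show "2 * (Q K * (1 + D)) * \<Delta> K powr (\<gamma> - \<nu>) \<le> 1 / 2 + D / 2" by (simp add: add_divide_distrib)
    qed
    then have "holder_with (C + (1 / 2 + D / 2)) \<nu> {-r..\<tau>'} x"
      using C D \<tau> exponents r by (intro holder_with_concat[OF C(1)]) auto
    then show "holder_with (C + 1 / 2 + D / 2) \<nu> {-r..\<tau>'} x" by (simp add: add.assoc)
  qed (use C C0 in auto)
  then show ?thesis by (simp add: algebra_simps)
qed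

text \<open>The step length depends on the driving path only through \<open>K\<close>, so a number
  of steps fixed in advance reaches \<open>T\<close>, each replacing C by 2C + 1.\<close>

lemma euler_holder:
  assumes K: "K \<ge> 0"
  shows "\<exists>C\<ge>0. \<forall>n g x. holder_with K \<gamma> {0..T} g \<longrightarrow> euler n g x \<longrightarrow> holder_with C \<nu> {-r..T} x"
proof -
  have "\<Delta> K > 0" using Q_nonneg[OF K] by (simp add: \<Delta>_def)
  then obtain m :: nat where m: "T < real m * \<Delta> K" using reals_Archimedean3 by blast
  have main: "\<exists>C\<ge>0. \<forall>n g x. holder_with K \<gamma> {0..T} g \<longrightarrow> euler n g x \<longrightarrow> holder_with C \<nu> {-r..min T (real i * \<Delta> K)} x" for i
  proof (induction i)
    case 0
    have "holder_with E' \<nu> {-r..0} x" if "euler n g x" for n g x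
      using \<eta>_holder(1) that by (subst holder_with_cong[of _ _ \<eta>]) (auto simp: euler_def)
    then show ?case using \<eta>_holder(2) T by auto
  next
    case (Suc i)
    then obtain C where C: "C \<ge> 0"
      "\<And>n g x. holder_with K \<gamma> {0..T} g \<Longrightarrow> euler n g x \<Longrightarrow> holder_with C \<nu> {-r..min T (real i * \<Delta> K)} x" by blast
    have "holder_with (2 * C + 1) \<nu> {-r..min T (real (Suc i) * \<Delta> K)} x"
      if "holder_with K \<gamma> {0..T} g" "euler n g x" for n g x
      by (rule euler_holder_step[OF that(2,1) C(2)[OF that] C(1)])
        (use \<open>\<Delta> K > 0\<close> T in \<open>auto simp: min_def distrib_right\<close>)
    then show ?case using C(1) by (intro exI[of _ "2 * C + 1"]) auto
  qed
  from main[of m] show ?thesis using m by (simp add: min_def)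
qed

end

section \<open>Limits of the Euler scheme\<close>

text \<open>Equicontinuity reduces uniform closeness to a finite net, whose spacing \<open>d\<close>
  is chosen so that \<open>C * d powr \<nu>\<close> is at most \<epsilon>/3.\<close>

lemma holder_pointwise_imp_uniform:
  assumes f: "\<And>n. holder_with C \<nu> {a..b} (f n)" and C: "C \<ge> 0" and \<nu>: "\<nu> > 0"
    and lim: "\<And>t. t \<in> {a..b} \<Longrightarrow> (\<lambda>n. f n t) \<longlonglongrightarrow> g t" and \<epsilon>: "\<epsilon> > 0"
  shows "\<forall>\<^sub>F n in sequentially. \<forall>t\<in>{a..b}. \<bar>f n t - g t\<bar> \<le> \<epsilon>"
proof -
  have g: "holder_with C \<nu> {a..b} g" using f lim by (rule holder_with_limit)
  define d where "d = (\<epsilon> / (3 * (C + 1))) powr (1 / \<nu>)"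
  have d: "d > 0" using \<epsilon> C by (simp add: d_def)
  have "d powr \<nu> = \<epsilon> / (3 * (C + 1))" using \<epsilon> C \<nu> by (simp add: d_def powr_powr)
  then have "C * d powr \<nu> = (C / (C + 1)) * (\<epsilon> / 3)" by simp
  also have "\<dots> \<le> 1 * (\<epsilon> / 3)" using C \<epsilon> by (intro mult_right_mono) auto
  finally have Cd: "C * d powr \<nu> \<le> \<epsilon> / 3" by simp
  obtain m :: nat where m: "b - a < real m * d" using reals_Archimedean3[OF d] by blast
  have "\<forall>\<^sub>F n in sequentially. \<forall>j\<in>{j. j < m \<and> a + real j * d \<in> {a..b}}. \<bar>f n (a + real j * d) - g (a + real j * d)\<bar> \<le> \<epsilon> / 3"
  proof (rule eventually_ball_finite)
    show "\<forall>j\<in>{j. j < m \<and> a + real j * d \<in> {a..b}}. \<forall>\<^sub>F n in sequentially. \<bar>f n (a + real j * d) - g (a + real j * d)\<bar> \<le> \<epsilon> / 3"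
    proof
      fix j assume "j \<in> {j. j < m \<and> a + real j * d \<in> {a..b}}"
      then have "(\<lambda>n. f n (a + real j * d)) \<longlonglongrightarrow> g (a + real j * d)" by (intro lim) simp
      from tendstoD[OF this, of "\<epsilon> / 3"] \<epsilon>
      show "\<forall>\<^sub>F n in sequentially. \<bar>f n (a + real j * d) - g (a + real j * d)\<bar> \<le> \<epsilon> / 3"
        by (auto elim!: eventually_mono simp: dist_real_def)
    qed
  qed simp
  then show ?thesis
  proof eventually_elim
    case (elim n)
    show ?case
    proof
      fix t assume t: "t \<in> {a..b}"
      obtain k where k: "k < m" "real k * d \<le> t - a" "t - a < real (Suc k) * d"
        by (rule exists_grid_cell[OF d, of "t - a" m]) (use t m in auto)
      let ?p = "a + real k * d"
      have p: "?p \<in> {a..b}" using k t d by auto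
      have "C * \<bar>t - ?p\<bar> powr \<nu> \<le> C * d powr \<nu>"
        using k C \<nu> by (intro mult_left_mono powr_mono2) (auto simp: distrib_right)
      then have "C * \<bar>t - ?p\<bar> powr \<nu> \<le> \<epsilon> / 3" using Cd by simp
      then have "\<bar>f n t - f n ?p\<bar> \<le> \<epsilon> / 3" "\<bar>g t - g ?p\<bar> \<le> \<epsilon> / 3"
        using holder_withD[OF f t p] holder_withD[OF g t p] by (meson order_trans)+
      moreover have "\<bar>f n ?p - g ?p\<bar> \<le> \<epsilon> / 3" using elim k p by blast
      ultimately show "\<bar>f n t - g t\<bar> \<le> \<epsilon>" by linarith
    qed
  qed
qed

text \<open>Driving paths and schemes are assumed to converge only pointwise; the common constants
  \<open>K\<close> and \<open>C\<close> supply the uniformity. The indices \<open>l k\<close> need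
  only tend to infinity, as a subsequence does.\<close>

locale euler_limit = delay_equation +
  fixes K C :: real and G :: "nat \<Rightarrow> real \<Rightarrow> real" and g :: "real \<Rightarrow> real" and l :: "nat \<Rightarrow> nat"
    and X :: "nat \<Rightarrow> real \<Rightarrow> real" and x :: "real \<Rightarrow> real"
  assumes G: "\<And>k. holder_with K \<gamma> {0..T} (G k)"
    and G_lim: "\<And>t. t \<in> {0..T} \<Longrightarrow> (\<lambda>k. G k t) \<longlonglongrightarrow> g t"
    and l: "filterlim l at_top sequentially"
    and X: "\<And>k. euler (l k) (G k) (X k)"
    and X_holder: "\<And>k. holder_with C \<nu> {-r..T} (X k)" and C: "C \<ge> 0"
    and X_lim: "\<And>t. t \<in> {-r..T} \<Longrightarrow> (\<lambda>k. X k t) \<longlonglongrightarrow> x t"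
begin

lemma x_holder: "holder_with C \<nu> {-r..T} x"
  using X_holder X_lim by (rule holder_with_limit)

lemma g_holder: "holder_with K \<gamma> {0..T} g"
  using G G_lim by (rule holder_with_limit)

lemma path_x: "path x"
  by (rule holder_with_imp_continuous_on[OF x_holder]) (rule exponents)

lemma path_X: "path (X k)"
  using X by (simp add: euler_def)

lemma X0: "X k 0 = \<eta> 0"
  using X[of k] r by (auto simp: euler_def)

lemma x_initial: "t \<in> {-r..0} \<Longrightarrow> x t = \<eta> t"
proof -
  assume t: "t \<in> {-r..0}"
  then have "X k t = \<eta> t" for k using X[of k] by (auto simp: euler_def)
  moreover have "(\<lambda>k. X k t) \<longlonglongrightarrow> x t" using X_lim[of t] t T by auto
  ultimately show "x t = \<eta> t" by (simp add: LIMSEQ_const_iff)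
qed

lemma x0: "x 0 = \<eta> 0"
  using x_initial[of 0] r by simp

lemma X_uniform: "\<epsilon> > 0 \<Longrightarrow> \<forall>\<^sub>F k in sequentially. \<forall>t\<in>{-r..T}. \<bar>X k t - x t\<bar> \<le> \<epsilon>"
  using holder_pointwise_imp_uniform[OF X_holder C exponents(1) X_lim] by blast

sublocale holder_integrator \<alpha> T \<gamma> K g
  using \<alpha> T \<gamma> g_holder by unfold_locales auto

lemma T_in: "T \<in> {0..T}" using T by simp

lemma coeff_x: "holder_with (cH * (1 + C)) \<mu> {0..T} (coeff x)"
  "s \<in> {0..T} \<Longrightarrow> \<bar>coeff x s\<bar> \<le> L * c1 * (1 + C)"
  using coeff_bounds[OF path_x x_holder C x0 T_in] by auto

section \<open>Convergence of the noise\<close>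

lemma coeff_lim:
  assumes t: "t \<in> {0..T}"
  shows "(\<lambda>k. coeff (X k) t) \<longlonglongrightarrow> coeff x t"
proof (rule tendstoI)
  fix e :: real assume e: "e > 0"
  have pos: "e / (L + 1) > 0" using e L by simp
  have "\<forall>\<^sub>F k in sequentially. \<forall>t\<in>{-r..T}. \<bar>X k t - x t\<bar> \<le> e / (L + 1)"
    by (rule X_uniform[OF pos])
  then show "\<forall>\<^sub>F k in sequentially. dist (coeff (X k) t) (coeff x t) < e"
  proof eventually_elim
    case (elim k)
    have "\<bar>coeff (X k) t - coeff x t\<bar> \<le> L * (e / (L + 1))"
      unfolding coeff_def by (rule \<sigma>_diff[OF path_X path_x t t t]) (use elim t in auto)
    also have "\<dots> < e" using e L by (simp add: field_simps)
    finally show ?case by (simp add: dist_real_def)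
  qed
qed

definition I :: "real \<Rightarrow> real" where
  "I t = gls_integral_on \<alpha> 0 T 0 t (coeff x) g"

definition cI :: real where "cI = local_const \<mu> * (cH * (1 + C))"

lemma cI_nonneg: "cI \<ge> 0"
  unfolding cI_def using local_const_nonneg[of \<mu>] exponents cH C by simp

text \<open>The integral is seen as a function of its upper limit with a remainder of order above 1,
  a form that compares directly with Riemann sums.\<close>

lemma I_increment:
  assumes st: "0 \<le> s" "s \<le> t" "t \<le> T"
  shows "\<bar>I t - I s - coeff x s * (g t - g s)\<bar> \<le> cI * (t - s) powr (1 + \<mu> - \<alpha>)"
proof -
  have "I t = I s + gls_integral_on \<alpha> 0 T s t (coeff x) g"
    unfolding I_def by (rule gls_integral_on_combine[OF coeff_x(1) exponents(7)]) (use st in auto)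
  then show ?thesis
    using holder_gls_integral_on(2)[OF coeff_x(1) exponents(7) st] by (simp add: cI_def)
qed

lemma I_zero: "I 0 = 0"
  using gls_integral_on_combine[OF coeff_x(1) exponents(7), of 0 0 0] T by (simp add: I_def)

definition cN :: real where
  "cN = 3 * (K * (L * c1 + young_const (\<mu> + \<gamma>) * cH * T powr \<mu>) * (1 + C))"

definition cY :: real where "cY = young_const (\<mu> + \<gamma>) * (cH * (1 + C)) * K"

text \<open>In the term with the factor \<open>T\<close>, the number 2^m of cells has turned one
  power of the mesh size into \<open>T\<close>. The other terms belong to the last incomplete
  cell.\<close>

definition err :: "nat \<Rightarrow> real" where
  "err m = T * (cY * mesh m powr (\<mu> + \<gamma> - 1) + cI * mesh m powr (\<mu> - \<alpha>)) +
     (cN * mesh m powr \<gamma> + (L * c1 * (1 + C) * K * mesh m powr \<gamma> + cI * mesh m powr (1 + \<mu> - \<alpha>)))"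

lemma err_tendsto: "err \<longlonglongrightarrow> 0"
proof -
  have "err \<longlonglongrightarrow> T * (cY * 0 + cI * 0) + (cN * 0 + (L * c1 * (1 + C) * K * 0 + cI * 0))"
    unfolding err_def by (intro tendsto_intros mesh_powr_tendsto) (use exponents \<alpha> in auto)
  then show ?thesis by simp
qed

text \<open>Absolute values stand inside the sum so that one quantity dominates the discrepancy at
  every coarse node.\<close>

definition coarse_diff :: "nat \<Rightarrow> nat \<Rightarrow> real" where
  "coarse_diff m k = (\<Sum>i<2 ^ m. \<bar>coeff (X k) (node m i) * (G k (node m (Suc i)) - G k (node m i)) -
     coeff x (node m i) * (g (node m (Suc i)) - g (node m i))\<bar>)"

lemma coarse_diff_tendsto: "coarse_diff m \<longlonglongrightarrow> 0"
proof -
  have "coarse_diff m \<longlonglongrightarrow> (\<Sum>i<(2::nat) ^ m. \<bar>coeff x (node m i) * (g (node m (Suc i)) - g (node m i)) -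
     coeff x (node m i) * (g (node m (Suc i)) - g (node m i))\<bar>)"
    unfolding coarse_diff_def
  proof (intro tendsto_sum tendsto_rabs tendsto_diff tendsto_mult tendsto_const)
    fix i assume i: "i \<in> {..<(2::nat) ^ m}"
    have "node m i \<in> {0..T}" "node m (Suc i) \<in> {0..T}"
      using node(1) node_le_T[of i m] node_le_T[of "Suc i" m] i by auto
    then show "(\<lambda>k. coeff (X k) (node m i)) \<longlonglongrightarrow> coeff x (node m i)"
      "(\<lambda>k. G k (node m (Suc i))) \<longlonglongrightarrow> g (node m (Suc i))" "(\<lambda>k. G k (node m i)) \<longlonglongrightarrow> g (node m i)"
      using coeff_lim G_lim by auto
  qed
  then show ?thesis by simp
qed

text \<open>Both the Riemann sums of the scheme and the integral are compared with the Riemann sums on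
  a fixed coarser mesh, with an error that is small uniformly in \<open>k\<close>.\<close>

lemma noise_close:
  assumes m: "m \<le> l k" and t: "t \<in> {0..T}"
  shows "\<bar>noise (l k) (X k) (G k) t - I t\<bar> \<le> err m + coarse_diff m k"
proof -
  let ?S = "noise (l k) (X k) (G k)"
  let ?p = "\<mu> + \<gamma>" and ?q = "1 + \<mu> - \<alpha>"
  have K: "K \<ge> 0" by (rule K_nonneg)
  have Y: "cY \<ge> 0" using K cH C young_const_pos[of ?p] exponents by (simp add: cY_def)
  \<comment> \<open>Dyadic meshes are nested: a coarse node is a fine node, so
    \<open>noise_young\<close> on the fine mesh applies to a whole coarse cell.\<close>
  have noden: "node m i = node (l k) (i * 2 ^ (l k - m))" for i
  proof -
    have "mesh m = 2 ^ (l k - m) * mesh (l k)"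
      using m by (simp add: mesh_def power_diff)
    then show ?thesis by (simp add: node_def)
  qed
  have nodeS: "node m (Suc i) - node m i = mesh m" for i by (simp add: node_def distrib_right)
  have block: "\<bar>?S (node m (Suc i)) - ?S (node m i) - coeff (X k) (node m i) * (G k (node m (Suc i)) - G k (node m i))\<bar>
     \<le> cY * mesh m powr ?p" if "i < 2 ^ m" for i
  proof -
    have "node m (Suc i) \<le> T" using node_le_T[of "Suc i" m] that by simp
    then show ?thesis
      using noise_young[OF path_X[of k] X_holder[of k] C X0 T_in G[of k], of "i * 2 ^ (l k - m)" "Suc i * 2 ^ (l k - m)" "l k"]
      unfolding noden[symmetric] nodeS cY_def by simp
  qed
  have blockI: "\<bar>I (node m (Suc i)) - I (node m i) - coeff x (node m i) * (g (node m (Suc i)) - g (node m i))\<bar>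
     \<le> cI * mesh m powr ?q" if "i < 2 ^ m" for i
    using I_increment[of "node m i" "node m (Suc i)"] node(1)[of m i] node(4)[of i "Suc i" m] node_le_T[of "Suc i" m] that
    unfolding nodeS by simp
  have S0: "?S (node m 0) = 0"
    using noise_node[of 0 "l k" "X k" "G k"] node(2) by simp
  have at_node: "\<bar>?S (node m j) - I (node m j)\<bar> \<le> T * (cY * mesh m powr (?p - 1) + cI * mesh m powr (\<mu> - \<alpha>)) + coarse_diff m k"
    if j: "j \<le> 2 ^ m" for j
  proof -
    let ?d = "\<lambda>i. \<bar>coeff (X k) (node m i) * (G k (node m (Suc i)) - G k (node m i)) -
     coeff x (node m i) * (g (node m (Suc i)) - g (node m i))\<bar>"
    have eq: "?S (node m j) - I (node m j) = (\<Sum>i<j. (?S (node m (Suc i)) - I (node m (Suc i))) - (?S (node m i) - I (node m i)))"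
      using sum_lessThan_telescope[of "\<lambda>i. ?S (node m i) - I (node m i)" j] S0 I_zero node(2) by simp
    have "\<bar>?S (node m j) - I (node m j)\<bar> \<le> (\<Sum>i<j. cY * mesh m powr ?p + cI * mesh m powr ?q + ?d i)"
      unfolding eq
    proof (rule order_trans[OF sum_abs sum_mono])
      fix i assume "i \<in> {..<j}"
      then have "i < 2 ^ m" using j by simp
      from block[OF this] blockI[OF this]
      show "\<bar>(?S (node m (Suc i)) - I (node m (Suc i))) - (?S (node m i) - I (node m i))\<bar>
        \<le> cY * mesh m powr ?p + cI * mesh m powr ?q + ?d i" by linarith
    qed
    also have "\<dots> \<le> (\<Sum>i<2 ^ m. cY * mesh m powr ?p + cI * mesh m powr ?q + ?d i)"
    proof (rule sum_mono2)
      show "{..<j} \<subseteq> {..<2 ^ m}" using j by auto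
      show "0 \<le> cY * mesh m powr ?p + cI * mesh m powr ?q + ?d i" for i
        by (intro add_nonneg_nonneg mult_nonneg_nonneg Y cI_nonneg powr_ge_zero abs_ge_zero)
    qed (rule finite_lessThan)
    also have "\<dots> = 2 ^ m * (cY * mesh m powr ?p + cI * mesh m powr ?q) + coarse_diff m k"
      unfolding coarse_diff_def by (simp only: sum.distrib sum_constant card_lessThan of_nat_power of_nat_numeral distrib_left)
    also have "2 ^ m * (cY * mesh m powr ?p + cI * mesh m powr ?q) = T * (cY * mesh m powr (?p - 1) + cI * mesh m powr (\<mu> - \<alpha>))"
    proof -
      have e: "2 ^ m * (c * mesh m powr (1 + q)) = T * (c * mesh m powr q)" for c q
      proof -
        have "mesh m powr (1 + q) = mesh m * mesh m powr q"
          using powr_mult_base[of "mesh m" q] mesh(1)[of m] by simp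
        then have "2 ^ m * (c * mesh m powr (1 + q)) = (2 ^ m * mesh m) * (c * mesh m powr q)"
          by (simp add: mult_ac)
        then show ?thesis by (simp add: mesh(2))
      qed
      have "1 + (?p - 1) = ?p" "1 + (\<mu> - \<alpha>) = ?q" by simp_all
      then show ?thesis
        using e[of cY "?p - 1"] e[of cI "\<mu> - \<alpha>"] by (simp only: distrib_left)
    qed
    finally show ?thesis .
  qed
  obtain j where j: "j \<le> 2 ^ m" "node m j \<le> t" "t \<le> node m j + mesh m"
  proof (cases "t = T")
    case True
    then show ?thesis using that[of "2 ^ m"] node(3)[of m] mesh(1)[of m] by simp
  next
    case False
    obtain i where "i < 2 ^ m" "real i * mesh m \<le> t" "t < real (Suc i) * mesh m"
      by (rule exists_grid_cell[OF mesh(1), of t "2 ^ m" m]) (use False t mesh(3)[of m] in auto)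
    then show ?thesis using that[of i] by (simp add: node_def distrib_right)
  qed
  have nj: "node m j \<in> {0..T}" using node(1)[of m j] node_le_T[OF j(1)] by simp
  have pw: "(t - node m j) powr q \<le> mesh m powr q" if "q \<ge> 0" for q
    using j that by (intro powr_mono2) auto
  have "\<bar>?S t - ?S (node m j)\<bar> \<le> cN * \<bar>t - node m j\<bar> powr \<gamma>"
    using holder_withD[OF noise_holder[OF path_X[of k] X_holder[of k] C X0 T_in G[of k], of "l k"] t nj]
    unfolding cN_def .
  also have "\<dots> \<le> cN * mesh m powr \<gamma>"
    using pw[of \<gamma>] j exponents K L c1 C cH young_const_pos[of ?p]
    by (intro mult_left_mono) (auto simp: cN_def)
  finally have 1: "\<bar>?S t - ?S (node m j)\<bar> \<le> cN * mesh m powr \<gamma>" .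
  have "\<bar>coeff x (node m j) * (g t - g (node m j))\<bar> \<le> (L * c1 * (1 + C)) * (K * \<bar>t - node m j\<bar> powr \<gamma>)"
    unfolding abs_mult using coeff_x(2)[OF nj] holder_withD[OF g_holder t nj] L c1 C
    by (intro mult_mono) auto
  also have "\<dots> \<le> L * c1 * (1 + C) * (K * mesh m powr \<gamma>)"
    using pw[of \<gamma>] j exponents K L c1 C by (intro mult_left_mono) auto
  finally have 2: "\<bar>coeff x (node m j) * (g t - g (node m j))\<bar> \<le> L * c1 * (1 + C) * K * mesh m powr \<gamma>" by simp
  have "\<bar>I t - I (node m j) - coeff x (node m j) * (g t - g (node m j))\<bar> \<le> cI * (t - node m j) powr ?q"
    by (rule I_increment) (use nj j t in auto)
  also have "\<dots> \<le> cI * mesh m powr ?q"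
    using cI_nonneg pw[of ?q] exponents by (intro mult_left_mono) auto
  finally have 3: "\<bar>I t - I (node m j) - coeff x (node m j) * (g t - g (node m j))\<bar> \<le> cI * mesh m powr ?q" .
  have "\<bar>?S t - I t\<bar> \<le> \<bar>?S t - ?S (node m j)\<bar> + \<bar>?S (node m j) - I (node m j)\<bar> +
     (\<bar>coeff x (node m j) * (g t - g (node m j))\<bar> + \<bar>I t - I (node m j) - coeff x (node m j) * (g t - g (node m j))\<bar>)"
    by linarith
  also have "\<dots> \<le> cN * mesh m powr \<gamma> +
      (T * (cY * mesh m powr (?p - 1) + cI * mesh m powr (\<mu> - \<alpha>)) + coarse_diff m k) +
      (L * c1 * (1 + C) * K * mesh m powr \<gamma> + cI * mesh m powr ?q)"
    by (intro add_mono 1 2 3 at_node j)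
  also have "\<dots> = err m + coarse_diff m k" by (simp add: err_def)
  finally show ?thesis .
qed

text \<open>The coarse level is fixed first, by \<open>err_tendsto\<close>. Only then does
  \<open>k\<close> grow, and the finitely many terms of \<open>coarse_diff\<close> vanish.\<close>

lemma noise_uniform:
  assumes \<epsilon>: "\<epsilon> > 0"
  shows "\<forall>\<^sub>F k in sequentially. \<forall>t\<in>{0..T}. \<bar>noise (l k) (X k) (G k) t - I t\<bar> \<le> \<epsilon>"
proof -
  have "\<forall>\<^sub>F m in sequentially. err m < \<epsilon> / 2"
    by (rule order_tendstoD(2)[OF err_tendsto]) (use \<epsilon> in simp)
  then obtain m where m: "err m < \<epsilon> / 2" unfolding eventually_sequentially by blast
  have "\<forall>\<^sub>F k in sequentially. coarse_diff m k < \<epsilon> / 2"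
    by (rule order_tendstoD(2)[OF coarse_diff_tendsto]) (use \<epsilon> in simp)
  moreover have "\<forall>\<^sub>F k in sequentially. m \<le> l k"
    using l by (simp add: filterlim_at_top)
  ultimately show ?thesis
  proof eventually_elim
    case (elim k)
    then show ?case using noise_close[of m k] m by fastforce
  qed
qed

section \<open>Convergence of the drift\<close>

definition drift_limit :: "real \<Rightarrow> real" where
  "drift_limit s = indicator {0..T} s * b s (segment r x s)"

lemma drift_integrand_close:
  assumes d: "\<And>t. t \<in> {-r..T} \<Longrightarrow> \<bar>X k t - x t\<bar> \<le> d" and s: "s \<in> {0..T}"
  shows "\<bar>drift_integrand (l k) (X k) s - drift_limit s\<bar> \<le> L * (d + C * mesh (l k) powr \<nu>)"
proof -
  let ?v = "grid_floor (l k) s"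
  have v: "0 \<le> ?v" "?v \<le> s" "s < ?v + mesh (l k)" using grid_floor[of s "l k"] s by auto
  have "\<bar>b s (segment r (X k) ?v) - b s (segment r x s)\<bar> \<le> L * (d + C * mesh (l k) powr \<nu>)"
  proof (rule b_diff[OF path_X path_x s])
    fix u assume u: "u \<in> {-r..0}"
    have "\<bar>X k (?v + u) - x (?v + u)\<bar> \<le> d" by (rule d) (use u v s in auto)
    moreover have "\<bar>x (?v + u) - x (s + u)\<bar> \<le> C * \<bar>?v + u - (s + u)\<bar> powr \<nu>"
      by (rule holder_withD[OF x_holder]) (use u v s in auto)
    moreover have "C * \<bar>?v + u - (s + u)\<bar> powr \<nu> \<le> C * mesh (l k) powr \<nu>"
      using C v exponents by (intro mult_left_mono powr_mono2) auto
    ultimately show "\<bar>X k (?v + u) - x (s + u)\<bar> \<le> d + C * mesh (l k) powr \<nu>" by linarith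
  qed (use v s in auto)
  then show ?thesis using s by (simp add: drift_integrand_def drift_limit_def)
qed

lemma drift_integrand_uniform:
  assumes \<epsilon>: "\<epsilon> > 0"
  shows "\<forall>\<^sub>F k in sequentially. \<forall>s. \<bar>drift_integrand (l k) (X k) s - drift_limit s\<bar> \<le> \<epsilon>"
proof -
  define d where "d = \<epsilon> / (L + 1) / 2"
  have d: "d > 0" using \<epsilon> L by (simp add: d_def)
  have "(\<lambda>k. C * mesh (l k) powr \<nu>) \<longlonglongrightarrow> C * 0"
    by (intro tendsto_mult tendsto_const filterlim_compose[OF mesh_powr_tendsto l] exponents)
  then have "\<forall>\<^sub>F k in sequentially. C * mesh (l k) powr \<nu> < d"
    using order_tendstoD(2)[of _ 0 sequentially d] d by simp
  with X_uniform[OF d] show ?thesis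
  proof eventually_elim
    case (elim k)
    show ?case
    proof
      fix s
      show "\<bar>drift_integrand (l k) (X k) s - drift_limit s\<bar> \<le> \<epsilon>"
      proof (cases "s \<in> {0..T}")
        case True
        have "\<bar>drift_integrand (l k) (X k) s - drift_limit s\<bar> \<le> L * (d + C * mesh (l k) powr \<nu>)"
          by (rule drift_integrand_close[OF _ True]) (use elim in auto)
        also have "\<dots> \<le> L * (2 * d)" using elim L by (intro mult_left_mono) auto
        also have "2 * d = \<epsilon> / (L + 1)"
        proof -
          have "2 * (a / 2) = a" for a :: real by simp
          then show ?thesis unfolding d_def .
        qed
        also have "L * (\<epsilon> / (L + 1)) = (L / (L + 1)) * \<epsilon>" by simp
        also have "\<dots> \<le> 1 * \<epsilon>" using L \<epsilon> by (intro mult_right_mono) auto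
        finally show ?thesis by simp
      next
        case False
        then show ?thesis using \<epsilon> by (simp add: drift_integrand_def drift_limit_def)
      qed
    qed
  qed
qed

lemma borel_measurable_drift_limit: "drift_limit \<in> borel_measurable borel"
proof (rule borel_measurable_LIMSEQ_real)
  show "drift_integrand (l k) (X k) \<in> borel_measurable borel" for k
    by (rule borel_measurable_drift_integrand[OF path_X])
  show "(\<lambda>k. drift_integrand (l k) (X k) s) \<longlonglongrightarrow> drift_limit s" for s
  proof (rule tendstoI)
    fix e :: real assume "e > 0"
    then have "\<forall>\<^sub>F k in sequentially. \<forall>s. \<bar>drift_integrand (l k) (X k) s - drift_limit s\<bar> \<le> e / 2"
      by (intro drift_integrand_uniform) simp
    then show "\<forall>\<^sub>F k in sequentially. dist (drift_integrand (l k) (X k) s) (drift_limit s) < e"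
    proof eventually_elim
      case (elim k)
      then have "\<bar>drift_integrand (l k) (X k) s - drift_limit s\<bar> \<le> e / 2" by blast
      then show ?case using \<open>e > 0\<close> unfolding dist_real_def by linarith
    qed
  qed
qed

lemma drift_limit_bound: "\<exists>c. \<forall>s. \<bar>drift_limit s\<bar> \<le> c"
proof -
  obtain N where N: "N \<ge> 0" "\<And>u. u \<in> {-r..T} \<Longrightarrow> \<bar>x u\<bar> \<le> N" using path_bounded[OF path_x] by blast
  have "\<bar>drift_limit s\<bar> \<le> L * (1 + N)" for s
  proof (cases "s \<in> {0..T}")
    case True
    have "\<bar>b s (segment r x s)\<bar> \<le> L * (1 + N)"
      by (rule b_bound[OF path_x True True]) (use N True in auto)
    then show ?thesis using True by (simp add: drift_limit_def)
  next
    case False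
    then show ?thesis using L N by (simp add: drift_limit_def)
  qed
  then show ?thesis by blast
qed

lemma drift_limit_integrable:
  assumes "S \<in> sets borel" "S \<subseteq> {0..T}"
  shows "set_integrable lborel S drift_limit"
  using drift_limit_bound borel_measurable_drift_limit assms bounded_set_integrable by blast

lemma drift_close:
  assumes e: "\<And>s. \<bar>drift_integrand (l k) (X k) s - drift_limit s\<bar> \<le> e" and t: "t \<in> {0..T}"
  shows "\<bar>drift (l k) (X k) t - (LBINT s:{0..<t}. drift_limit s)\<bar> \<le> e * T"
proof -
  let ?f = "drift_integrand (l k) (X k)"
  have [measurable]: "?f \<in> borel_measurable borel" "drift_limit \<in> borel_measurable borel"
    using borel_measurable_drift_integrand[OF path_X] borel_measurable_drift_limit by auto
  obtain c where c: "\<And>s. \<bar>drift_limit s\<bar> \<le> c" using drift_limit_bound by blast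
  have S: "{0..<t} \<in> sets borel" "{0..<t} \<subseteq> {0..T}" using t by auto
  have "\<bar>?f s\<bar> \<le> c + e" for s using c[of s] e[of s] by linarith
  then have i: "set_integrable lborel {0..<t} ?f" "set_integrable lborel {0..<t} drift_limit"
    using bounded_set_integrable[of ?f "{0..<t}" "c + e"] drift_limit_integrable S by auto
  have e0: "e \<ge> 0" using e[of 0] by linarith
  have eq: "drift (l k) (X k) t - (LBINT s:{0..<t}. drift_limit s) = (LBINT s:{0..<t}. ?f s - drift_limit s)"
    unfolding drift_def by (rule set_integral_diff(2)[OF i, symmetric])
  have "\<bar>drift (l k) (X k) t - (LBINT s:{0..<t}. drift_limit s)\<bar> \<le> (LBINT s:{0..<t}. \<bar>?f s - drift_limit s\<bar>)"
    unfolding eq using set_integral_norm_bound[OF set_integral_diff(1)[OF i]] by simp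
  also have "\<dots> \<le> (LBINT s:{0..<t}. e)"
    using e by (intro set_integral_mono set_integrable_abs set_integral_diff(1)[OF i])
      (auto intro: bounded_set_integrable[OF _ S])
  also have "\<dots> = e * t" using t by (simp add: set_lebesgue_integral_def)
  also have "\<dots> \<le> e * T" using t e0 by (intro mult_left_mono) auto
  finally show ?thesis .
qed

section \<open>Passage to the limit in the equation\<close>

abbreviation Zx :: "real \<Rightarrow> real" where
  "Zx \<equiv> Z_path \<alpha> r T \<eta> b \<sigma> g x"

lemma Zx_eq:
  assumes t: "t \<in> {0..T}"
  shows "Zx t = \<eta> 0 + (LBINT s:{0..<t}. drift_limit s) + I t"
proof -
  have [measurable]: "drift_limit \<in> borel_measurable borel" by (rule borel_measurable_drift_limit)
  have eq: "indicator {0..t} s *\<^sub>R b s (segment r x s) = indicator {0..t} s *\<^sub>R drift_limit s" for s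
    using t by (auto simp: drift_limit_def indicator_def)
  have "(LBINT s:{0..t}. b s (segment r x s)) = (LBINT s:{0..t}. drift_limit s)"
    unfolding set_lebesgue_integral_def eq ..
  also have "\<dots> = (LBINT s:{0..<t}. drift_limit s)"
    unfolding set_lebesgue_integral_def
  proof (rule integral_cong_AE)
    show "AE s in lborel. indicator {0..t} s *\<^sub>R drift_limit s = indicator {0..<t} s *\<^sub>R drift_limit s"
      using AE_lborel_singleton[of t] by eventually_elim (auto simp: indicator_def)
  qed measurable
  finally show ?thesis unfolding Z_path_def I_def coeff_def[abs_def] by simp
qed

lemma Z_uniform:
  assumes \<epsilon>: "\<epsilon> > 0"
  shows "\<forall>\<^sub>F k in sequentially. \<forall>t\<in>{0..T}. \<bar>Z (l k) (X k) (G k) t - Zx t\<bar> \<le> \<epsilon>"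
proof -
  have e: "\<epsilon> / (2 * T) > 0" "\<epsilon> / 2 > 0" using \<epsilon> T by auto
  from drift_integrand_uniform[OF e(1)] noise_uniform[OF e(2)] show ?thesis
  proof eventually_elim
    case (elim k)
    show ?case
    proof
      fix t assume t: "t \<in> {0..T}"
      have "\<bar>drift (l k) (X k) t - (LBINT s:{0..<t}. drift_limit s)\<bar> \<le> \<epsilon> / (2 * T) * T"
        by (rule drift_close[OF _ t]) (use elim in blast)
      then have "\<bar>drift (l k) (X k) t - (LBINT s:{0..<t}. drift_limit s)\<bar> \<le> \<epsilon> / 2" using T by simp
      moreover have "\<bar>noise (l k) (X k) (G k) t - I t\<bar> \<le> \<epsilon> / 2" using elim t by blast
      ultimately show "\<bar>Z (l k) (X k) (G k) t - Zx t\<bar> \<le> \<epsilon>"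
        unfolding Zx_eq[OF t] Z_def by linarith
    qed
  qed
qed

lemma bdd_Z:
  assumes t: "t \<in> {0..T}"
  shows "bdd_above ((\<lambda>s. neg_part (Z (l k) (X k) (G k) s)) ` {0..t})"
proof (rule bdd_above_neg_part)
  have "continuous_on {0..T} (Z (l k) (X k) (G k))"
    by (rule holder_with_imp_continuous_on[OF Z_holder[OF path_X[of k] X_holder[of k] C X0 T_in G[of k]]])
      (rule exponents)
  then show "continuous_on {0..t} (Z (l k) (X k) (G k))"
    by (rule continuous_on_subset) (use t in auto)
qed

text \<open>Boundedness is inherited from one approximation within uniform distance 1.\<close>

lemma bdd_Zx:
  assumes t: "t \<in> {0..T}"
  shows "bdd_above ((\<lambda>s. neg_part (Zx s)) ` {0..t})"
proof -
  have "\<forall>\<^sub>F k in sequentially. \<forall>s\<in>{0..T}. \<bar>Z (l k) (X k) (G k) s - Zx s\<bar> \<le> 1"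
    by (rule Z_uniform) simp
  then obtain k where k: "\<forall>s\<in>{0..T}. \<bar>Z (l k) (X k) (G k) s - Zx s\<bar> \<le> 1"
    unfolding eventually_sequentially by blast
  obtain c where c: "\<forall>s\<in>{0..t}. neg_part (Z (l k) (X k) (G k) s) \<le> c"
    using bdd_Z[OF t, of k] unfolding bdd_above_def by blast
  show ?thesis
  proof (rule bdd_aboveI2)
    fix s assume s: "s \<in> {0..t}"
    have "\<bar>Z (l k) (X k) (G k) s - Zx s\<bar> \<le> 1" using k s t by auto
    then show "neg_part (Zx s) \<le> c + 1"
      using neg_part_lipschitz[of "Z (l k) (X k) (G k) s" "Zx s"] bspec[OF c s] by linarith
  qed
qed

text \<open>\<open>regulator_dist\<close> carries the uniform convergence of \<open>Z\<close>
  through the supremum, so both sides of the scheme converge at each time.\<close>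

lemma limit_solves: "solves_path \<alpha> r T \<eta> b \<sigma> g x"
proof -
  have 1: "set_integrable lborel {0..t} (\<lambda>s. b s (segment r x s))" if t: "t \<in> {0..T}" for t
  proof -
    have eq: "indicator {0..t} s *\<^sub>R b s (segment r x s) = indicator {0..t} s *\<^sub>R drift_limit s" for s
      using t by (auto simp: drift_limit_def indicator_def)
    show ?thesis
      using drift_limit_integrable[of "{0..t}"] t unfolding set_integrable_def eq by auto
  qed
  have 2: "gls_integrable_on \<alpha> 0 T 0 t (\<lambda>s. \<sigma> s (segment r x s)) g" if "t \<in> {0..T}" for t
    using holder_gls_integral_on(1)[OF coeff_x(1) exponents(7), of 0 t] that
    unfolding coeff_def[abs_def] by simp
  have 3: "x t = Zx t + regulator Zx t" if t: "t \<in> {0..T}" for t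
  proof (rule LIMSEQ_unique)
    show "(\<lambda>k. X k t) \<longlonglongrightarrow> x t" using X_lim t r by auto
    show "(\<lambda>k. X k t) \<longlonglongrightarrow> Zx t + regulator Zx t"
    proof (rule tendstoI)
      fix e :: real assume e: "e > 0"
      then have "\<forall>\<^sub>F k in sequentially. \<forall>t\<in>{0..T}. \<bar>Z (l k) (X k) (G k) t - Zx t\<bar> \<le> e / 3"
        by (intro Z_uniform) simp
      then show "\<forall>\<^sub>F k in sequentially. dist (X k t) (Zx t + regulator Zx t) < e"
      proof eventually_elim
        case (elim k)
        have "\<bar>regulator (Z (l k) (X k) (G k)) t - regulator Zx t\<bar> \<le> e / 3"
          by (rule regulator_dist[OF _ bdd_Z[OF t] bdd_Zx[OF t]]) (use elim t in auto)
        moreover have "\<bar>Z (l k) (X k) (G k) t - Zx t\<bar> \<le> e / 3" using elim t by blast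
        moreover have "X k t = Z (l k) (X k) (G k) t + regulator (Z (l k) (X k) (G k)) t"
          using X[of k] t by (auto simp: euler_def)
        ultimately show ?case unfolding dist_real_def using e by linarith
      qed
    qed
  qed
  show ?thesis
    unfolding solves_path_def by (intro conjI ballI 1 2 3 bdd_Zx x_initial)
qed

end

section \<open>The solution process\<close>

text \<open>Every component has countable range, so the list can be built one entry at a time by
  countable composition.\<close>

lemma measurable_map_count_space:
  fixes F :: "'i \<Rightarrow> 'a \<Rightarrow> 'b::countable"
  assumes "\<And>k. k \<in> set ks \<Longrightarrow> F k \<in> measurable M (count_space UNIV)"
  shows "(\<lambda>\<omega>. map (\<lambda>k. F k \<omega>) ks) \<in> measurable M (count_space UNIV)"
  using assms
proof (induction ks)
  case (Cons k ks)
  then have IH: "(\<lambda>\<omega>. map (\<lambda>k. F k \<omega>) ks) \<in> measurable M (count_space UNIV)" by simp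
  have "(\<lambda>\<omega>. y # map (\<lambda>k. F k \<omega>) ks) \<in> measurable M (count_space UNIV)" for y
    by (rule measurable_compose[OF IH]) simp
  then have "(\<lambda>\<omega>. F k \<omega> # map (\<lambda>k. F k \<omega>) ks) \<in> measurable M (count_space UNIV)"
    by (rule measurable_compose_countable) (rule Cons.prems, simp)
  then show ?case by simp
qed simp

text \<open>By equicontinuity the sequence is Cauchy at \<open>t\<close> as soon as it is Cauchy at
  a sufficiently close rational.\<close>

lemma convergent_of_dense:
  assumes f: "\<And>k. holder_with C \<nu> {a..b} (f k)" and C: "C \<ge> 0" and \<nu>: "\<nu> > 0"
    and dense: "\<And>q :: rat. convergent (\<lambda>k. f k (max a (min b (of_rat q))))" and t: "t \<in> {a..b}"
  shows "convergent (\<lambda>k::nat. f k t :: real)"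
proof (rule Cauchy_convergent, rule metric_CauchyI)
  fix e :: real assume e: "e > 0"
  define d where "d = (e / (4 * (C + 1))) powr (1 / \<nu>)"
  have d: "d > 0" using e C by (simp add: d_def)
  have "d powr \<nu> = e / (4 * (C + 1))" using e C \<nu> by (simp add: d_def powr_powr)
  then have "C * d powr \<nu> = (C / (C + 1)) * (e / 4)" by simp
  also have "\<dots> \<le> 1 * (e / 4)" using C e by (intro mult_right_mono) auto
  finally have Cd: "C * d powr \<nu> \<le> e / 4" by simp
  \<comment> \<open>The rational lies within \<open>d\<close> below \<open>t\<close>; clamping it to
    [a,b] can only move it closer to \<open>t\<close>.\<close>
  obtain q :: rat where q: "t - d < of_rat q" "of_rat q < t" using of_rat_dense[of "t - d" t] d by auto
  define p where "p = max a (min b (of_rat q :: real))"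
  have p: "p \<in> {a..b}" "\<bar>t - p\<bar> \<le> d" using t q by (auto simp: p_def)
  have near: "\<bar>f k t - f k p\<bar> \<le> e / 4" for k
  proof -
    have "\<bar>f k t - f k p\<bar> \<le> C * \<bar>t - p\<bar> powr \<nu>" by (rule holder_withD[OF f t p(1)])
    also have "\<dots> \<le> C * d powr \<nu>" using p C \<nu> by (intro mult_left_mono powr_mono2) auto
    finally show ?thesis using Cd by linarith
  qed
  have "Cauchy (\<lambda>k. f k p)" using dense[of q] unfolding p_def by (rule convergent_Cauchy)
  then obtain M where M: "\<And>m n. m \<ge> M \<Longrightarrow> n \<ge> M \<Longrightarrow> dist (f m p) (f n p) < e / 4"
    using metric_CauchyD[of "\<lambda>k. f k p" "e / 4"] e by auto
  show "\<exists>M. \<forall>m\<ge>M. \<forall>n\<ge>M. dist (f m t) (f n t) < e"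
  proof (intro exI allI impI)
    fix m n assume "m \<ge> M" "n \<ge> M"
    then have "\<bar>f m p - f n p\<bar> < e / 4" using M by (simp add: dist_real_def)
    then show "dist (f m t) (f n t) < e"
      using near[of m] near[of n] e unfolding dist_real_def by linarith
  qed
qed

context delay_equation
begin

text \<open>The driving path is sampled on the mesh and rounded to multiples of the mesh size. So the
  scheme depends on \<open>\<omega>\<close> only through a list of integers, and measurability is automatic.\<close>

definition sample :: "nat \<Rightarrow> (real \<Rightarrow> real) \<Rightarrow> int list" where
  "sample n g = map (\<lambda>k. \<lfloor>g (node n k) / mesh n\<rfloor>) [0..<Suc (2 ^ n)]"

definition sample_value :: "nat \<Rightarrow> int list \<Rightarrow> real \<Rightarrow> real" where
  "sample_value n zs u = mesh n * real_of_int (zs ! nat \<lfloor>u / mesh n\<rfloor>)"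

definition sample_path :: "nat \<Rightarrow> int list \<Rightarrow> real \<Rightarrow> real" where
  "sample_path n zs = lin_interp (2 ^ n) (mesh n) (sample_value n zs)"

text \<open>The arbitrary selection does no harm: every function on the discrete set of integer
  lists is measurable.\<close>

definition scheme :: "nat \<Rightarrow> int list \<Rightarrow> real \<Rightarrow> real" where
  "scheme n zs = (SOME x. euler n (sample_path n zs) x)"

lemma sample_value:
  assumes "k \<le> 2 ^ n"
  shows "\<bar>sample_value n (sample n g) (real k * mesh n) - g (real k * mesh n)\<bar> \<le> mesh n"
proof -
  have k: "k < Suc (2 ^ n)" using assms by simp
  have e: "nat \<lfloor>real k * mesh n / mesh n\<rfloor> = k" using mesh(1)[of n] by simp
  have "sample n g ! k = \<lfloor>g (real k * mesh n) / mesh n\<rfloor>"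
    unfolding sample_def node_def using k by (simp del: upt_Suc)
  then have v: "sample_value n (sample n g) (real k * mesh n) = mesh n * real_of_int \<lfloor>g (real k * mesh n) / mesh n\<rfloor>"
    unfolding sample_value_def e by simp
  let ?z = "g (real k * mesh n) / mesh n"
  have "\<bar>real_of_int \<lfloor>?z\<rfloor> - ?z\<bar> \<le> 1" by linarith
  then have "mesh n * \<bar>real_of_int \<lfloor>?z\<rfloor> - ?z\<bar> \<le> mesh n * 1" using mesh(1)[of n] by (intro mult_left_mono) auto
  also have "mesh n * \<bar>real_of_int \<lfloor>?z\<rfloor> - ?z\<bar> = \<bar>mesh n * real_of_int \<lfloor>?z\<rfloor> - mesh n * ?z\<bar>"
  proof -
    have "c * \<bar>u - v\<bar> = \<bar>c * u - c * v\<bar>" if "c > 0" for c u v :: real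
      using that unfolding right_diff_distrib[symmetric] by (simp add: abs_mult)
    then show ?thesis using mesh(1) .
  qed
  finally show ?thesis using mesh(1)[of n] unfolding v by simp
qed

text \<open>Distinct nodes are at least one mesh size apart, so twice the mesh size is at most 2
  T^(1-\<gamma>) times the \<gamma>-th power of their distance. Rounding therefore keeps the Hoelder
  bound uniform in \<open>n\<close>.\<close>

lemma sample_path_holder:
  assumes g: "holder_with K \<gamma> {0..T} g"
  shows "holder_with (3 * (K + 2 * T powr (1 - \<gamma>))) \<gamma> {0..T} (sample_path n (sample n g))"
proof -
  let ?\<phi> = "sample_value n (sample n g)"
  have K: "K \<ge> 0" by (rule holder_with_const_nonneg[OF g T])
  have "holder_with (3 * (K + 2 * T powr (1 - \<gamma>))) \<gamma> {0..real (2 ^ n) * mesh n} (sample_path n (sample n g))"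
    unfolding sample_path_def
  proof (rule holder_with_lin_interp)
    fix i j :: nat assume ij: "i < j" "j \<le> 2 ^ n"
    let ?d = "real j * mesh n - real i * mesh n"
    have nodes: "real i * mesh n \<in> {0..T}" "real j * mesh n \<in> {0..T}"
      using node(1)[of n i] node(1)[of n j] node_le_T[of i n] node_le_T[of j n] ij by (auto simp: node_def)
    have "1 * mesh n \<le> (real j - real i) * mesh n"
      using ij mesh(1)[of n] by (intro mult_right_mono) auto
    then have d: "mesh n \<le> ?d" by (simp add: left_diff_distrib)
    have d': "0 < ?d" "?d \<le> T"
      using d mesh(1)[of n] nodes unfolding atLeastAtMost_iff by linarith+
    have "mesh n \<le> ?d powr (1 - \<gamma>) * ?d powr \<gamma>" using d d' by (simp flip: powr_add)
    also have "\<dots> \<le> T powr (1 - \<gamma>) * ?d powr \<gamma>"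
      using d' \<gamma> by (intro mult_right_mono powr_mono2) auto
    finally have m: "mesh n \<le> T powr (1 - \<gamma>) * ?d powr \<gamma>" .
    have "\<bar>g (real j * mesh n) - g (real i * mesh n)\<bar> \<le> K * \<bar>?d\<bar> powr \<gamma>"
      by (rule holder_withD[OF g nodes(2,1)])
    then have "\<bar>g (real j * mesh n) - g (real i * mesh n)\<bar> \<le> K * ?d powr \<gamma>" using d' by simp
    then have "\<bar>?\<phi> (real j * mesh n) - ?\<phi> (real i * mesh n)\<bar> \<le> K * ?d powr \<gamma> + 2 * mesh n"
      using sample_value[of i n g] sample_value[of j n g] ij by linarith
    also have "\<dots> \<le> (K + 2 * T powr (1 - \<gamma>)) * ?d powr \<gamma>"
      using m by (simp add: distrib_right)
    finally show "\<bar>?\<phi> (real j * mesh n) - ?\<phi> (real i * mesh n)\<bar> \<le> (K + 2 * T powr (1 - \<gamma>)) * ?d powr \<gamma>" .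
  qed (use mesh K \<gamma> exponents in auto)
  then show ?thesis unfolding mesh(3) .
qed

lemma sample_path_tendsto:
  assumes g: "holder_with K \<gamma> {0..T} g" and t: "t \<in> {0..T}"
  shows "(\<lambda>n. sample_path n (sample n g) t) \<longlonglongrightarrow> g t"
proof -
  let ?K = "3 * (K + 2 * T powr (1 - \<gamma>))"
  have K: "K \<ge> 0" by (rule holder_with_const_nonneg[OF g T])
  have "\<bar>sample_path n (sample n g) t - g t\<bar> \<le> (?K + K) * mesh n powr \<gamma> + mesh n" for n
    unfolding sample_path_def
  proof (rule lin_interp_dist[where n = "2 ^ n"])
    show "holder_with ?K \<gamma> {0..real (2 ^ n) * mesh n} (lin_interp (2 ^ n) (mesh n) (sample_value n (sample n g)))"
      using sample_path_holder[OF g, of n] unfolding mesh(3) sample_path_def .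
  qed (use mesh(1)[of n] mesh(3)[of n] exponents g t K sample_value in auto)
  moreover have "(\<lambda>n. (?K + K) * mesh n powr \<gamma> + mesh n) \<longlonglongrightarrow> (?K + K) * 0 + 0"
    by (rule tendsto_add[OF tendsto_mult[OF tendsto_const mesh_powr_tendsto] mesh_tendsto]) (rule exponents)
  ultimately have "(\<lambda>n. sample_path n (sample n g) t - g t) \<longlonglongrightarrow> 0"
    by (intro Lim_null_comparison[of "\<lambda>n. sample_path n (sample n g) t - g t" "\<lambda>n. (?K + K) * mesh n powr \<gamma> + mesh n"]) auto
  then show ?thesis by (simp add: LIM_zero_iff)
qed

lemma scheme_euler:
  assumes g: "holder_with K \<gamma> {0..T} g"
  shows "euler n (sample_path n (sample n g)) (scheme n (sample n g))"
  using someI_ex[OF euler_exists[OF sample_path_holder[OF g]]] unfolding scheme_def .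

lemma scheme_holder:
  assumes g: "holder_with K \<gamma> {0..T} g"
  shows "\<exists>C\<ge>0. \<forall>n. holder_with C \<nu> {-r..T} (scheme n (sample n g))"
proof -
  have "3 * (K + 2 * T powr (1 - \<gamma>)) \<ge> 0" using holder_with_const_nonneg[OF g T] by simp
  from euler_holder[OF this] show ?thesis
    using sample_path_holder[OF g] scheme_euler[OF g] by blast
qed

lemma solution_from_subsequence:
  assumes g: "holder_with K \<gamma> {0..T} g" and \<rho>: "strict_mono \<rho>"
    and conv: "\<And>t. t \<in> {-r..T} \<Longrightarrow> (\<lambda>k. scheme (\<rho> k) (sample (\<rho> k) g) t) \<longlonglongrightarrow> x t"
  shows "solves_path \<alpha> r T \<eta> b \<sigma> g x" "holder_on \<nu> {-r..T} x"
proof -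
  obtain C where C: "C \<ge> 0" "\<And>n. holder_with C \<nu> {-r..T} (scheme n (sample n g))"
    using scheme_holder[OF g] by blast
  have \<rho>': "filterlim \<rho> at_top sequentially" using \<rho> by (rule filterlim_subseq)
  interpret euler_limit r T \<theta> \<beta> \<gamma> \<alpha> L E \<eta> b \<sigma> "3 * (K + 2 * T powr (1 - \<gamma>))" C
    "\<lambda>k. sample_path (\<rho> k) (sample (\<rho> k) g)" g \<rho> "\<lambda>k. scheme (\<rho> k) (sample (\<rho> k) g)" x
  proof unfold_locales
    show "holder_with (3 * (K + 2 * T powr (1 - \<gamma>))) \<gamma> {0..T} (sample_path (\<rho> k) (sample (\<rho> k) g))" for k
      by (rule sample_path_holder[OF g])
    show "(\<lambda>k. sample_path (\<rho> k) (sample (\<rho> k) g) t) \<longlonglongrightarrow> g t" if "t \<in> {0..T}" for t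
      by (rule filterlim_compose[OF sample_path_tendsto[OF g that] \<rho>'])
    show "euler (\<rho> k) (sample_path (\<rho> k) (sample (\<rho> k) g)) (scheme (\<rho> k) (sample (\<rho> k) g))" for k
      by (rule scheme_euler[OF g])
  qed (use \<rho>' C conv in auto)
  show "solves_path \<alpha> r T \<eta> b \<sigma> g x" by (rule limit_solves)
  show "holder_on \<nu> {-r..T} x" using x_holder unfolding holder_on_iff_with by blast
qed

lemma scheme_bounded:
  assumes g: "holder_with K \<gamma> {0..T} g" and t: "t \<in> {-r..T}"
  shows "bounded (range (\<lambda>n. scheme n (sample n g) t))"
proof -
  obtain C where C: "C \<ge> 0" "\<And>n. holder_with C \<nu> {-r..T} (scheme n (sample n g))"
    using scheme_holder[OF g] by blast
  have "\<bar>scheme n (sample n g) t\<bar> \<le> \<bar>\<eta> 0\<bar> + C * \<bar>t - 0\<bar> powr \<nu>" for n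
  proof -
    have "scheme n (sample n g) 0 = \<eta> 0"
      using scheme_euler[OF g, of n] r by (auto simp: euler_def)
    moreover have "\<bar>scheme n (sample n g) t - scheme n (sample n g) 0\<bar> \<le> C * \<bar>t - 0\<bar> powr \<nu>"
      by (rule holder_withD[OF C(2) t]) (use T r in auto)
    ultimately show ?thesis by linarith
  qed
  then show ?thesis unfolding bounded_iff by auto
qed

text \<open>This path serves on the exceptional null set, so that every trajectory and not only
  almost every one is Hoelder.\<close>

lemma frozen_holder: "holder_on \<nu> {-r..T} (\<lambda>t. \<eta> (min t 0))"
proof -
  have "holder_with E' \<nu> {-r..T} (\<lambda>t. \<eta> (min t 0))"
  proof (rule holder_withI)
    fix s t assume st: "s \<in> {-r..T}" "t \<in> {-r..T}" "s < t"
    have "\<bar>\<eta> (min t 0) - \<eta> (min s 0)\<bar> \<le> E' * \<bar>min t 0 - min s 0\<bar> powr \<nu>"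
      by (rule holder_withD[OF \<eta>_holder(1)]) (use st r in auto)
    also have "\<dots> \<le> E' * (t - s) powr \<nu>"
      using st exponents \<eta>_holder(2) by (intro mult_left_mono powr_mono2) auto
    finally show "\<bar>\<eta> (min t 0) - \<eta> (min s 0)\<bar> \<le> E' * (t - s) powr \<nu>" .
  qed
  then show ?thesis unfolding holder_on_iff_with by blast
qed

lemma exists_solution_process:
  fixes M :: "'a measure" and B :: "real \<Rightarrow> 'a \<Rightarrow> real"
  assumes Bm: "\<And>t. t \<in> {0..T} \<Longrightarrow> B t \<in> borel_measurable M"
    and BH: "AE \<omega> in M. \<exists>K. holder_with K \<gamma> {0..T} (\<lambda>t. B t \<omega>)"
  shows "\<exists>X. is_solution M \<alpha> r T \<eta> b \<sigma> B X \<and> (\<forall>\<omega>\<in>space M. holder_on \<nu> {-r..T} (\<lambda>t. X t \<omega>))"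
proof -
  \<comment> \<open>A measurable null set covers the bad outcomes; the definitions that follow are
    split along it.\<close>
  obtain N where N: "{\<omega> \<in> space M. \<not> (\<exists>K. holder_with K \<gamma> {0..T} (\<lambda>t. B t \<omega>))} \<subseteq> N" "N \<in> null_sets M"
    using BH unfolding eventually_ae_filter by blast
  then have [measurable]: "N \<in> sets M" by blast
  have good: "\<exists>K. holder_with K \<gamma> {0..T} (\<lambda>t. B t \<omega>)" if "\<omega> \<in> space M - N" for \<omega>
    using that N by blast
  define S where "S = (\<lambda>n \<omega>. sample n (\<lambda>t. B t \<omega>))"
  have [measurable]: "S n \<in> measurable M (count_space UNIV)" for n
    unfolding S_def sample_def
  proof (rule measurable_map_count_space)
    fix k assume "k \<in> set [0..<Suc (2 ^ n)]"
    then have "node n k \<in> {0..T}" using node(1)[of n k] node_le_T[of k n] by auto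
    from Bm[OF this] show "(\<lambda>\<omega>. \<lfloor>B (node n k) \<omega> / mesh n\<rfloor>) \<in> measurable M (count_space UNIV)"
      by measurable
  qed
  define U where "U = (\<lambda>n t \<omega>. scheme n (S n \<omega>) t)"
  have Um [measurable]: "U n t \<in> borel_measurable M" for n t
  proof -
    have "(\<lambda>zs. scheme n zs t) \<in> measurable (count_space UNIV) borel" by simp
    from measurable_compose[OF \<open>S n \<in> measurable M (count_space UNIV)\<close> this]
    show ?thesis unfolding U_def .
  qed
  define p where "p = (\<lambda>q::rat. max (-r) (min T (of_rat q :: real)))"
  have p: "p q \<in> {-r..T}" for q using T r by (auto simp: p_def)
  \<comment> \<open>Zero on \<open>N\<close>, because the subsequence lemma asks for boundedness at
    every outcome.\<close>
  define a where "a = (\<lambda>n i \<omega>. if \<omega> \<in> N then 0 else U n (p (from_nat i)) \<omega>)"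
  have "\<exists>\<rho> :: 'a \<Rightarrow> nat \<Rightarrow> nat. (\<forall>\<omega>. strict_mono (\<rho> \<omega>)) \<and>
    (\<forall>k. (\<lambda>\<omega>. \<rho> \<omega> k) \<in> measurable M (count_space UNIV)) \<and>
    (\<forall>\<omega>\<in>space M. \<forall>i. convergent (\<lambda>k. a (\<rho> \<omega> k) i \<omega>))"
  proof (rule measurable_convergent_subsequence[of a M])
    show "a n i \<in> borel_measurable M" for n i unfolding a_def by measurable
    show "bounded (range (\<lambda>n. a n i \<omega>))" if \<omega>: "\<omega> \<in> space M" for \<omega> i
    proof (cases "\<omega> \<in> N")
      case True
      then show ?thesis by (simp add: a_def)
    next
      case False
      then obtain K where "holder_with K \<gamma> {0..T} (\<lambda>t. B t \<omega>)" using good \<omega> by blast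
      from scheme_bounded[OF this p] False show ?thesis unfolding a_def U_def S_def by simp
    qed
  qed
  then obtain \<rho> :: "'a \<Rightarrow> nat \<Rightarrow> nat" where \<rho>: "\<And>\<omega>. strict_mono (\<rho> \<omega>)"
    "\<And>k. (\<lambda>\<omega>. \<rho> \<omega> k) \<in> measurable M (count_space UNIV)"
    "\<And>\<omega> i. \<omega> \<in> space M \<Longrightarrow> convergent (\<lambda>k. a (\<rho> \<omega> k) i \<omega>)"
    by blast
  define X where "X = (\<lambda>t \<omega>. if \<omega> \<in> space M - N then lim (\<lambda>k. U (\<rho> \<omega> k) t \<omega>) else \<eta> (min t 0))"
  have conv: "(\<lambda>k. U (\<rho> \<omega> k) t \<omega>) \<longlonglongrightarrow> X t \<omega>" if \<omega>: "\<omega> \<in> space M - N" and t: "t \<in> {-r..T}" for \<omega> t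
  proof -
    obtain K where K: "holder_with K \<gamma> {0..T} (\<lambda>t. B t \<omega>)" using good \<omega> by blast
    obtain C where C: "C \<ge> 0" "\<And>n. holder_with C \<nu> {-r..T} (scheme n (S n \<omega>))"
      using scheme_holder[OF K] unfolding S_def by blast
    have "convergent (\<lambda>k. scheme (\<rho> \<omega> k) (S (\<rho> \<omega> k) \<omega>) t)"
    proof (rule convergent_of_dense[OF C(2,1) exponents(1) _ t])
      fix q :: rat
      have "convergent (\<lambda>k. a (\<rho> \<omega> k) (to_nat q) \<omega>)" using \<rho>(3) \<omega> by blast
      then show "convergent (\<lambda>k. scheme (\<rho> \<omega> k) (S (\<rho> \<omega> k) \<omega>) (max (-r) (min T (of_rat q))))"
        using \<omega> by (simp add: a_def U_def p_def)
    qed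
    then have "convergent (\<lambda>k. U (\<rho> \<omega> k) t \<omega>)" unfolding U_def .
    then show ?thesis using \<omega> by (simp add: X_def convergent_LIMSEQ_iff)
  qed
  have sol: "solves_path \<alpha> r T \<eta> b \<sigma> (\<lambda>t. B t \<omega>) (\<lambda>t. X t \<omega>)" "holder_on \<nu> {-r..T} (\<lambda>t. X t \<omega>)"
    if \<omega>: "\<omega> \<in> space M - N" for \<omega>
  proof -
    obtain K where K: "holder_with K \<gamma> {0..T} (\<lambda>t. B t \<omega>)" using good \<omega> by blast
    from solution_from_subsequence[OF K \<rho>(1)[of \<omega>], of "\<lambda>t. X t \<omega>"] conv[OF \<omega>]
    show "solves_path \<alpha> r T \<eta> b \<sigma> (\<lambda>t. B t \<omega>) (\<lambda>t. X t \<omega>)" "holder_on \<nu> {-r..T} (\<lambda>t. X t \<omega>)"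
      unfolding U_def S_def by auto
  qed
  have hold: "holder_on \<nu> {-r..T} (\<lambda>t. X t \<omega>)" if "\<omega> \<in> space M" for \<omega>
  proof (cases "\<omega> \<in> N")
    case True
    then show ?thesis using frozen_holder by (simp add: X_def)
  next
    case False
    then show ?thesis using sol(2) that by blast
  qed
  \<comment> \<open>A random index with countable range can be substituted without losing
    measurability; the limit over \<open>k\<close> is then pointwise at every outcome, also on
    \<open>N\<close>.\<close>
  have meas: "X t \<in> borel_measurable M" if t: "t \<in> {-r..T}" for t
  proof (rule borel_measurable_LIMSEQ_real)
    show "(\<lambda>\<omega>. if \<omega> \<in> N then \<eta> (min t 0) else U (\<rho> \<omega> k) t \<omega>) \<in> borel_measurable M" for k
    proof -
      have "(\<lambda>\<omega>. U (\<rho> \<omega> k) t \<omega>) \<in> borel_measurable M"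
        by (rule measurable_compose_countable[OF Um \<rho>(2)])
      then show ?thesis by measurable
    qed
    show "(\<lambda>k. if \<omega> \<in> N then \<eta> (min t 0) else U (\<rho> \<omega> k) t \<omega>) \<longlonglongrightarrow> X t \<omega>" if "\<omega> \<in> space M" for \<omega>
      using conv[OF _ t, of \<omega>] that by (cases "\<omega> \<in> N") (auto simp: X_def)
  qed
  have cont: "continuous_on {-r..T} (\<lambda>t. X t \<omega>)" if "\<omega> \<in> space M" for \<omega>
    using hold[OF that] holder_with_imp_continuous_on exponents(1) unfolding holder_on_iff_with by blast
  have "AE \<omega> in M. solves_path \<alpha> r T \<eta> b \<sigma> (\<lambda>t. B t \<omega>) (\<lambda>t. X t \<omega>)"
    by (rule AE_I'[OF N(2)]) (use sol(1) in blast)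
  with meas cont hold show ?thesis unfolding is_solution_def by blast
qed

end

lemma C_space_bounded:
  assumes "x \<in> mspace (C_space r)"
  shows "bounded (x ` {-r..0})"
proof -
  have "Met_TC.mbounded (x ` {-r..0})"
    using assms unfolding C_space_def mspace_cfunspace by simp
  then show ?thesis by (simp only: mbounded_iff_bounded)
qed

text \<open>Boundedness makes the real supremum meaningful. Nonnegativity is what allows the
  constants in front of the norm to be enlarged to a common one.\<close>

lemma C_norm_nonneg:
  assumes "r > 0" "bounded (f ` {-r..0})"
  shows "C_norm r f \<ge> 0"
proof -
  obtain c where "\<forall>s\<in>{-r..0}. \<bar>f s\<bar> \<le> c"
    using assms(2) unfolding bounded_iff by auto
  then have "bdd_above ((\<lambda>s. \<bar>f s\<bar>) ` {-r..0})" by (intro bdd_aboveI2[of _ _ c]) blast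
  then have "\<bar>f 0\<bar> \<le> C_norm r f"
    unfolding C_norm_def using assms(1) by (intro cSUP_upper) auto
  then show ?thesis by linarith
qed

theorem theorem6p1:
  fixes M :: "'a measure" and B :: "real \<Rightarrow> 'a \<Rightarrow> real"
    and T r H \<theta> \<beta> \<alpha> :: real
    and \<eta> :: "real \<Rightarrow> real"
    and b \<sigma> :: "real \<Rightarrow> (real \<Rightarrow> real) \<Rightarrow> real"
  assumes "T > 0" and "r > 0" and "1 / 2 < H" and "H < 1"
    and "prob_space M" and "complete_measure M"
    and "fractional_brownian_motion M T H B"
    and "0 < \<theta>" and "\<theta> \<le> 1"
    and "\<And>t. t \<in> {-r..0} \<Longrightarrow> \<eta> t \<ge> 0" and "holder_on \<theta> {-r..0} \<eta>"
    and "drift_assms r T b"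
    and "0 < \<beta>" and "\<beta> < 1" and "diffusion_assms r T \<beta> \<sigma>"
    and "1 - H < min \<theta> \<beta>"
    and "1 - H < \<alpha>" and "\<alpha> < min (1 / 2) (min \<theta> \<beta>)"
  shows "\<exists>X. is_solution M \<alpha> r T \<eta> b \<sigma> B X \<and>
           (\<forall>\<omega>\<in>space M. holder_on (min \<theta> (1 / 2)) {-r..T} (\<lambda>t. X t \<omega>))"
proof -
  \<comment> \<open>The midpoint of 1 - \<alpha> and H, which lie in this order because 1 - H <
    \<alpha>. It exceeds 1 - \<alpha> for the integral and stays below H for the regularity of the
    driving paths.\<close>
  define \<gamma> where "\<gamma> = (1 - \<alpha> + H) / 2"
  have \<gamma>_bounds: "1 - \<alpha> < \<gamma>" "\<gamma> < H" "0 < \<gamma>" using assms(3,4,17,18) by (auto simp: \<gamma>_def)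
  obtain E where E: "holder_with E \<theta> {-r..0} \<eta>" using assms(11) unfolding holder_on_iff_with by blast
  obtain L1 L2 where b:
    "\<And>t x. t \<in> {0..T} \<Longrightarrow> x \<in> mspace (C_space r) \<Longrightarrow> \<bar>b t x\<bar> \<le> L1 * (1 + C_norm r x)"
    "\<And>t x y. t \<in> {0..T} \<Longrightarrow> x \<in> mspace (C_space r) \<Longrightarrow> y \<in> mspace (C_space r) \<Longrightarrow>
      \<bar>b t x - b t y\<bar> \<le> L2 * C_norm r (\<lambda>s. x s - y s)"
    and bm: "(\<lambda>(t, x). b t x) \<in> borel_measurable (restrict_space borel {0..T} \<Otimes>\<^sub>M C_borel r)"
    using assms(12) unfolding drift_assms_def by blast
  obtain L3 L4 L5 where \<sigma>:
    "\<And>t x. t \<in> {0..T} \<Longrightarrow> x \<in> mspace (C_space r) \<Longrightarrow> \<bar>\<sigma> t x\<bar> \<le> L3 * (1 + C_norm r x)"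
    "\<And>s t x. s \<in> {0..T} \<Longrightarrow> t \<in> {0..T} \<Longrightarrow> x \<in> mspace (C_space r) \<Longrightarrow>
      \<bar>\<sigma> t x - \<sigma> s x\<bar> \<le> L4 * \<bar>t - s\<bar> powr \<beta> * (1 + C_norm r x)"
    "\<And>t x y. t \<in> {0..T} \<Longrightarrow> x \<in> mspace (C_space r) \<Longrightarrow> y \<in> mspace (C_space r) \<Longrightarrow>
      \<bar>\<sigma> t x - \<sigma> t y\<bar> \<le> L5 * C_norm r (\<lambda>s. x s - y s)"
    using assms(15) unfolding diffusion_assms_def by blast
  \<comment> \<open>The given constants carry no sign, so their absolute values are added.\<close>
  define L where "L = \<bar>L1\<bar> + \<bar>L2\<bar> + \<bar>L3\<bar> + \<bar>L4\<bar> + \<bar>L5\<bar>"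
  have L: "L1 \<le> L" "L2 \<le> L" "L3 \<le> L" "L4 \<le> L" "L5 \<le> L" "0 \<le> L" by (auto simp: L_def)
  have n1: "0 \<le> 1 + C_norm r x" if "x \<in> mspace (C_space r)" for x
    using C_norm_nonneg[OF assms(2) C_space_bounded[OF that]] by simp
  have n2: "0 \<le> C_norm r (\<lambda>s. x s - y s)" if "x \<in> mspace (C_space r)" "y \<in> mspace (C_space r)" for x y
    by (rule C_norm_nonneg[OF assms(2) bounded_minus_comp[OF C_space_bounded[OF that(1)] C_space_bounded[OF that(2)]]])
  interpret delay_equation r T \<theta> \<beta> \<gamma> \<alpha> L E \<eta> b \<sigma>
  proof
    show "\<bar>b t x\<bar> \<le> L * (1 + C_norm r x)" if "t \<in> {0..T}" "x \<in> mspace (C_space r)" for t x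
      using b(1)[OF that] mult_right_mono[OF L(1) n1[OF that(2)]] by linarith
    show "\<bar>b t x - b t y\<bar> \<le> L * C_norm r (\<lambda>s. x s - y s)"
      if "t \<in> {0..T}" "x \<in> mspace (C_space r)" "y \<in> mspace (C_space r)" for t x y
      using b(2)[OF that] mult_right_mono[OF L(2) n2[OF that(2,3)]] by linarith
    show "\<bar>\<sigma> t x\<bar> \<le> L * (1 + C_norm r x)" if "t \<in> {0..T}" "x \<in> mspace (C_space r)" for t x
      using \<sigma>(1)[OF that] mult_right_mono[OF L(3) n1[OF that(2)]] by linarith
    show "\<bar>\<sigma> t x - \<sigma> s x\<bar> \<le> L * \<bar>t - s\<bar> powr \<beta> * (1 + C_norm r x)"
      if "s \<in> {0..T}" "t \<in> {0..T}" "x \<in> mspace (C_space r)" for s t x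
    proof -
      have "L4 * \<bar>t - s\<bar> powr \<beta> * (1 + C_norm r x) \<le> L * \<bar>t - s\<bar> powr \<beta> * (1 + C_norm r x)"
        using L(4) n1[OF that(3)] by (intro mult_right_mono) auto
      then show ?thesis using \<sigma>(2)[OF that] by linarith
    qed
    show "\<bar>\<sigma> t x - \<sigma> t y\<bar> \<le> L * C_norm r (\<lambda>s. x s - y s)"
      if "t \<in> {0..T}" "x \<in> mspace (C_space r)" "y \<in> mspace (C_space r)" for t x y
      using \<sigma>(3)[OF that] mult_right_mono[OF L(5) n2[OF that(2,3)]] by linarith
  qed (use assms \<gamma>_bounds E bm L in auto)
  have "\<exists>X. is_solution M \<alpha> r T \<eta> b \<sigma> B X \<and> (\<forall>\<omega>\<in>space M. holder_on \<nu> {-r..T} (\<lambda>t. X t \<omega>))"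
  proof (rule exists_solution_process)
    show "B t \<in> borel_measurable M" if "t \<in> {0..T}" for t
      by (rule fractional_brownian_motion_measurable(1)[OF assms(7) that])
    show "AE \<omega> in M. \<exists>K. holder_with K \<gamma> {0..T} (\<lambda>t. B t \<omega>)"
      by (rule fractional_brownian_motion_holder[OF assms(5,7,1) \<gamma>_bounds(3,2)])
  qed
  then show ?thesis unfolding \<nu>_def .
qed

end
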